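(* The exponential plethystic bialgebra $\mathcal P_{\mathrm{exp}}$ is isomorphic to the homotopy cardinality of the incidence bialgebra of the simplicial groupoid $\mathcal B\,\mathcal T_{\mathsf S^{\mathrm r}}(\mathsf{Ass})$.
   Context: Monads and operads. $\mathbf{Grpd}$ is the category of groupoids. $\mathsf{M}^{\mathrm r}$ is the monad on $\mathbf{Grpd}$ sending $A$ to $\bigsqcup_{n\ge 1}A^n$ (nonempty tuples, morphisms componentwise), unit $a\mapsto (a)$, multiplication $\mu$ concatenation. $\mathsf{S}^{\mathrm r}$ sends $A$ to $\bigsqcup_{n\ge1}A^n/\!/\mathfrak S_n$ (same objects, with additional isomorphisms $(a_1,\dots,a_n)\to(a_{\sigma(1)},\dots,a_{\sigma(n)})$, $\sigma\in\mathfrak S_n$), same unit and multiplication. For $\mathsf P\in\{\mathsf M^{\mathrm r},\mathsf S^{\mathrm r}\}$ a $\mathsf P$-operad $Q$ consists of groupoids $Q_0$ (colours), $Q_1$ (operations), functors $s\colon Q_1\to\mathsf PQ_0$, $t\colon Q_1\to Q_0$, composition $m\colon\mathsf PQ_1\times_{\mathsf PQ_0}Q_1\to Q_1$ (the $Q_1$ factor the root) and units $e$, with the usual laws. $\mathsf{Ass}$ is the terminal $\mathsf M^{\mathrm r}$-operad on one colour: $Q_0=1$, $Q_1=\mathsf M^{\mathrm r}1$ (discrete; one $n$-ary operation for each $n\ge1$), composition given by $\mu$. $\mathcal T$-construction. (i) For a category $C$ internal to $\mathbf{Grpd}$ with discrete $C_0$, $\mathcal T_{\mathsf S^{\mathrm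 r}}(C)$ is the $\mathsf S^{\mathrm r}$-operad with colours $C_0$ whose operations are the pullback of $\mathsf S^{\mathrm r}(\text{target})$ along $C_0\times\mathsf S^{\mathrm r}1\to\mathsf S^{\mathrm r}C_0$, $(c,(\ast,\dots,\ast))\mapsto(c,\dots,c)$: nonempty tuples $(f_1,\dots,f_n)$ of arrows of $C$ with common target $c$ (inputs the sources, output $c$) with the morphisms of $\mathsf S^{\mathrm r}C_1$; composition $(f_1,\dots,f_k)\circ((g^1_j)_j,\dots,(g^k_j)_j)=(f_1g^1_1,\dots,f_1g^1_{n_1},\dots,f_kg^k_{n_k})$; units identities. (ii) For an $\mathsf M^{\mathrm r}$-operad $Q$ with discrete $Q_0$, $\mathcal T^{\mathsf M^{\mathrm r}}(Q)$ is the category with objects $Q_0$, arrows $c\to d$ the operations with all inputs $c$ and output $d$, composition $y\circ x=m((x,\dots,x);y)$, identities $e$ (for $\mathsf{Ass}$ this is the monoid $(\mathbb N_{\ge1},\times)$). (iii) $\mathcal T_{\mathsf S^{\mathrm r}}(Q):=\mathcal T_{\mathsf S^{\mathrm r}}(\mathcal T^{\mathsf M^{\mathrm r}}(Q))$. Bar construction. For an $\mathsf S^{\mathrm r}$-operad $Q$, $Q_n:=\mathsf S^{\mathrm r}Q_{n-1}\times_{\mathsf S^{\mathrm r}Q_0}Q_1$ ($n\ge2$). $\mathcal BQ$ has $\mathcal B_nQ=\mathsf S^{\mathrm r}Q_n$; $d_0$ discards the top (leafward) level keeping outputs, $d_n$ discards the root level and flattens via $\mu$, inner faces compose adjacent levels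 via $m$, degeneracies insert units. Incidence bialgebra. $|G|=\sum_{[x]}1/|\mathrm{Aut}(x)|$. For $X=\mathcal BQ$, $\mathbb Q_{\pi_0X_1}$ has basis $\delta_a$; $\Delta(\delta_f)=\sum_{a,b}\frac{|\Phi_{f;a,b}|}{|\mathrm{Aut}(a)||\mathrm{Aut}(b)|}\delta_a\otimes\delta_b$ with $\Phi_{f;a,b}$ the homotopy fibre over $(a,b)$ of $(d_2,d_0)$ restricted to the homotopy fibre of $d_1$ over $f$; $\epsilon(\delta_f)=$ cardinality of the homotopy fibre of $s_0$ over $f$; product by juxtaposition (unit adjoined). The bialgebra. $\Lambda$ is the set of sequences $\lambda=(\lambda_1,\lambda_2,\dots)$ of natural numbers, not all zero, with $\lambda_i=0$ for $i$ large; $\mathbf x^\lambda=\prod x_i^{\lambda_i}$, $\lambda!=\prod\lambda_i!$. Power series in $x_1,x_2,\dots$ without constant term are written $F=\sum_{\lambda}F_\lambda\mathbf x^\lambda/\lambda!$. Plethystic substitution: $(G\circledast F)(x_1,x_2,\dots)=G(F_1,F_2,\dots)$, $F_k(x_1,x_2,\dots)=F(x_k,x_{2k},\dots)$. $\mathcal P_{\mathrm{exp}}$ is the polynomial algebra $\mathbb Q[a_\lambda:\lambda\in\Lambda]$, $a_\lambda(F)=F_\lambda$, with $\Delta(a_\lambda)(F,G)=a_\lambda(G\circledast F)$ and $\epsilon(a_\lambda)=a_\lambda(x_1)$. *)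

theory Defs
  imports Complex_Main "HOL-Library.Poly_Mapping" "HOL-Library.Product_Plus"
begin

section \<open>Groupoids\<close>

text \<open>The records for groupoids, functors, operads, internal categories, simplicial groupoids and bialgebras
  carry the data only; the laws are properties of the particular structures built below.\<close>

record ('a, 'f) grpd =
  Obj :: "'a set"
  Arr :: "'f set"
  Dom :: "'f \<Rightarrow> 'a"
  Cod :: "'f \<Rightarrow> 'a"
  Idn :: "'a \<Rightarrow> 'f"
  Cmp :: "'f \<Rightarrow> 'f \<Rightarrow> 'f"  \<comment> \<open>\<open>Cmp G g f\<close> is \<open>g \<circ> f\<close>\<close>

record ('a, 'f, 'b, 'g) gfun =
  fo :: "'a \<Rightarrow> 'b"
  fm :: "'f \<Rightarrow> 'g"

definition gf_comp :: "('b,'g,'c,'h) gfun \<Rightarrow> ('a,'f,'b,'g) gfun \<Rightarrow> ('a,'f,'c,'h) gfun"  (infixr \<open>\<bullet>\<close> 55)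
  where "F \<bullet> G = \<lparr>fo = fo F \<circ> fo G, fm = fm F \<circ> fm G\<rparr>"

definition gf_pair :: "('a,'f,'b,'g) gfun \<Rightarrow> ('a,'f,'c,'h) gfun \<Rightarrow> ('a,'f,'b \<times> 'c,'g \<times> 'h) gfun"
  where "gf_pair F G = \<lparr>fo = (\<lambda>x. (fo F x, fo G x)), fm = (\<lambda>f. (fm F f, fm G f))\<rparr>"

definition discrete :: "'a set \<Rightarrow> ('a, 'a) grpd"
  where "discrete A = \<lparr>Obj = A, Arr = A, Dom = id, Cod = id, Idn = id, Cmp = (\<lambda>g f. f)\<rparr>"

definition full_sub :: "('a,'f) grpd \<Rightarrow> ('a \<Rightarrow> bool) \<Rightarrow> ('a,'f) grpd"
  where "full_sub G P = G\<lparr>Obj := {x \<in> Obj G. P x}, Arr := {f \<in> Arr G. P (Dom G f) \<and> P (Cod G f)}\<rparr>"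

definition prod_grpd :: "('a,'f) grpd \<Rightarrow> ('b,'g) grpd \<Rightarrow> ('a \<times> 'b, 'f \<times> 'g) grpd"
  where "prod_grpd G H = \<lparr>Obj = Obj G \<times> Obj H, Arr = Arr G \<times> Arr H,
     Dom = map_prod (Dom G) (Dom H), Cod = map_prod (Cod G) (Cod H),
     Idn = map_prod (Idn G) (Idn H), Cmp = (\<lambda>(g, g') (f, f'). (Cmp G g f, Cmp H g' f'))\<rparr>"

definition pullback ::
  "('a,'f) grpd \<Rightarrow> ('a,'f,'c,'h) gfun \<Rightarrow> ('b,'g) grpd \<Rightarrow> ('b,'g,'c,'h) gfun \<Rightarrow> ('a \<times> 'b, 'f \<times> 'g) grpd"
  where "pullback G F H F' = (prod_grpd G H)
     \<lparr>Obj := {(x, y). x \<in> Obj G \<and> y \<in> Obj H \<and> fo F x = fo F' y},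
      Arr := {(f, g). f \<in> Arr G \<and> g \<in> Arr H \<and> fm F f = fm F' g}\<rparr>"

text \<open>Transport of a groupoid along injections \<open>e\<close>, \<open>e'\<close> with left inverses \<open>d\<close>, \<open>d'\<close>.\<close>

definition relabel ::
  "('a \<Rightarrow> 'b) \<Rightarrow> ('b \<Rightarrow> 'a) \<Rightarrow> ('f \<Rightarrow> 'g) \<Rightarrow> ('g \<Rightarrow> 'f) \<Rightarrow> ('a,'f) grpd \<Rightarrow> ('b,'g) grpd"
  where "relabel e d e' d' G = \<lparr>Obj = e ` Obj G, Arr = e' ` Arr G,
     Dom = e \<circ> Dom G \<circ> d', Cod = e \<circ> Cod G \<circ> d', Idn = e' \<circ> Idn G \<circ> d,
     Cmp = (\<lambda>g f. e' (Cmp G (d' g) (d' f)))\<rparr>"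

definition pi0 :: "('a,'f) grpd \<Rightarrow> 'a set set"
  where "pi0 G = Obj G // {(x, y). \<exists>f\<in>Arr G. Dom G f = x \<and> Cod G f = y}"

definition iso_class :: "('a,'f) grpd \<Rightarrow> 'a \<Rightarrow> 'a set"
  where "iso_class G x = {(x, y). \<exists>f\<in>Arr G. Dom G f = x \<and> Cod G f = y} `` {x}"

definition rep :: "'a set \<Rightarrow> 'a"
  where "rep c = (SOME x. x \<in> c)"

definition aut :: "('a,'f) grpd \<Rightarrow> 'a \<Rightarrow> 'f set"
  where "aut G x = {f \<in> Arr G. Dom G f = x \<and> Cod G f = x}"

text \<open>Homotopy cardinality, meaningful for groupoids with finite \<open>pi0\<close> and finite automorphism groups.\<close>

definition hcard :: "('a,'f) grpd \<Rightarrow> rat"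
  where "hcard G = (\<Sum>c\<in>pi0 G. 1 / of_nat (card (aut G (rep c))))"

text \<open>The homotopy fibre of \<open>F : G \<rightarrow> H\<close> over \<open>h\<close>: objects are pairs \<open>(x, p : F x \<rightarrow> h)\<close>.  An arrow
  \<open>g : (x, q) \<rightarrow> (y, p)\<close> is stored as \<open>(g, p)\<close>, since \<open>q = p \<circ> F g\<close> is determined by it.\<close>

definition hofib ::
  "('a,'f,'b,'g) gfun \<Rightarrow> ('a,'f) grpd \<Rightarrow> ('b,'g) grpd \<Rightarrow> 'b \<Rightarrow> ('a \<times> 'g, 'f \<times> 'g) grpd"
  where "hofib F G H h =
    \<lparr>Obj = {(x, p). x \<in> Obj G \<and> p \<in> Arr H \<and> Dom H p = fo F x \<and> Cod H p = h},
     Arr = {(g, p). g \<in> Arr G \<and> p \<in> Arr H \<and> Dom H p = fo F (Cod G g) \<and> Cod H p = h},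
     Dom = (\<lambda>(g, p). (Dom G g, Cmp H p (fm F g))),
     Cod = (\<lambda>(g, p). (Cod G g, p)),
     Idn = (\<lambda>(x, p). (Idn G x, p)),
     Cmp = (\<lambda>(g', p') (g, p). (Cmp G g' g, p'))\<rparr>"

definition hofib_forget :: "('a \<times> 'g, 'f \<times> 'g, 'a, 'f) gfun"
  where "hofib_forget = \<lparr>fo = fst, fm = fst\<rparr>"


section \<open>The monads for nonempty and for nonempty symmetric tuples\<close>

definition M_grpd :: "('a,'f) grpd \<Rightarrow> ('a list, 'f list) grpd"
  where "M_grpd G =
    \<lparr>Obj = {as. as \<noteq> [] \<and> set as \<subseteq> Obj G}, Arr = {fs. fs \<noteq> [] \<and> set fs \<subseteq> Arr G},
     Dom = map (Dom G), Cod = map (Cod G), Idn = map (Idn G), Cmp = map2 (Cmp G)\<rparr>"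

definition M_mu :: "('a list list, 'f list list, 'a list, 'f list) gfun"
  where "M_mu = \<lparr>fo = concat, fm = concat\<rparr>"

definition M_unit :: "('a, 'f, 'a list, 'f list) gfun"
  where "M_unit = \<lparr>fo = (\<lambda>a. [a]), fm = (\<lambda>f. [f])\<rparr>"

text \<open>An arrow \<open>(a\<^sub>0,\<dots>,a\<^sub>n\<^sub>-\<^sub>1) \<rightarrow> (b\<^sub>0,\<dots>,b\<^sub>n\<^sub>-\<^sub>1)\<close> of the symmetric version is a list whose \<open>i\<close>-th entry is
  \<open>(\<sigma> i, f\<^sub>i : a\<^sub>\<sigma>\<^sub>i \<rightarrow> b\<^sub>i)\<close> for a permutation \<open>\<sigma>\<close>.  The component leaving position \<open>k\<close> of the domain is
  found by looking up the key \<open>k\<close>.\<close>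

type_synonym 'f smor = "(nat \<times> 'f) list"

definition leaving :: "'f smor \<Rightarrow> nat \<Rightarrow> 'f"
  where "leaving ps k = the (map_of ps k)"

definition S_grpd :: "('a,'f) grpd \<Rightarrow> ('a list, 'f smor) grpd"
  where "S_grpd G =
    \<lparr>Obj = {as. as \<noteq> [] \<and> set as \<subseteq> Obj G},
     Arr = {ps. ps \<noteq> [] \<and> distinct (map fst ps) \<and> set (map fst ps) = {..<length ps} \<and> set (map snd ps) \<subseteq> Arr G},
     Dom = (\<lambda>ps. map (\<lambda>k. Dom G (leaving ps k)) [0..<length ps]),
     Cod = map (Cod G \<circ> snd),
     Idn = (\<lambda>as. zip [0..<length as] (map (Idn G) as)),
     Cmp = (\<lambda>qs ps. map (\<lambda>(j, g). (fst (ps ! j), Cmp G g (snd (ps ! j)))) qs)\<rparr>"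

definition S_map :: "('a,'f,'b,'g) gfun \<Rightarrow> ('a list, 'f smor, 'b list, 'g smor) gfun"
  where "S_map F = \<lparr>fo = map (fo F), fm = map (map_prod id (fm F))\<rparr>"

definition S_unit :: "('a, 'f, 'a list, 'f smor) gfun"
  where "S_unit = \<lparr>fo = (\<lambda>a. [a]), fm = (\<lambda>f. [(0, f)])\<rparr>"

text \<open>On arrows, flattening yields the block permutation: the \<open>j\<close>-th entry of the \<open>k\<close>-th block of the
  domain sits at position \<open>j\<close> plus the lengths of the preceding blocks of the domain.\<close>

definition S_mu :: "('a list list, 'f smor smor, 'a list, 'f smor) gfun"
  where "S_mu = \<lparr>fo = concat,
     fm = (\<lambda>pss. concat (map (\<lambda>(k, ps). map (\<lambda>(j, f). ((\<Sum>l<k. length (leaving pss l)) + j, f)) ps) pss))\<rparr>"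


section \<open>Operads and the T-construction\<close>

text \<open>Composition of operads is given on the pullback of operations of leaves and root, the root being
  the second component.\<close>

record ('c,'cm,'q,'qm) m_operad =
  m_col :: "('c,'cm) grpd"
  m_ops :: "('q,'qm) grpd"
  m_src :: "('q,'qm,'c list,'cm list) gfun"
  m_tgt :: "('q,'qm,'c,'cm) gfun"
  m_mult :: "('q list \<times> 'q, 'qm list \<times> 'qm, 'q, 'qm) gfun"
  m_unit :: "('c,'cm,'q,'qm) gfun"

record ('c,'cm,'q,'qm) s_operad =
  s_col :: "('c,'cm) grpd"
  s_ops :: "('q,'qm) grpd"
  s_src :: "('q,'qm,'c list,'cm smor) gfun"
  s_tgt :: "('q,'qm,'c,'cm) gfun"
  s_mult :: "('q list \<times> 'q, 'qm smor \<times> 'qm, 'q, 'qm) gfun"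
  s_unit :: "('c,'cm,'q,'qm) gfun"

text \<open>Categories internal to groupoids; \<open>i_comp\<close> sends \<open>(g, f)\<close> to \<open>g \<circ> f\<close>.\<close>

record ('c,'cm,'x,'xm) int_cat =
  i_ob :: "('c,'cm) grpd"
  i_ar :: "('x,'xm) grpd"
  i_src :: "('x,'xm,'c,'cm) gfun"
  i_tgt :: "('x,'xm,'c,'cm) gfun"
  i_comp :: "('x \<times> 'x, 'xm \<times> 'xm, 'x, 'xm) gfun"
  i_id :: "('c,'cm,'x,'xm) gfun"

text \<open>In the composition of \<open>Ass\<close> the root has one input for each of the given leaf operations, so it
  carries no further information.\<close>

definition Ass :: "(unit, unit, unit list, unit list) m_operad"
  where "Ass = \<lparr>m_col = discrete {()}, m_ops = M_grpd (discrete {()}),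
     m_src = \<lparr>fo = id, fm = id\<rparr>, m_tgt = \<lparr>fo = (\<lambda>_. ()), fm = (\<lambda>_. ())\<rparr>,
     m_mult = M_mu \<bullet> \<lparr>fo = fst, fm = fst\<rparr>, m_unit = M_unit\<rparr>"

text \<open>Applied to operads with discrete groupoid of colours.  Sources are nonempty lists, so for an
  operation with all inputs equal the common input is the head.\<close>

definition T_M :: "('c,'cm,'q,'qm) m_operad \<Rightarrow> ('c,'cm,'q,'qm) int_cat"
  where "T_M Q = \<lparr>i_ob = m_col Q,
     i_ar = full_sub (m_ops Q) (\<lambda>x. \<exists>c. \<forall>a\<in>set (fo (m_src Q) x). a = c),
     i_src = \<lparr>fo = hd, fm = hd\<rparr> \<bullet> m_src Q, i_tgt = m_tgt Q,
     i_comp = m_mult Q \<bullet>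
       \<lparr>fo = (\<lambda>(y, x). (replicate (length (fo (m_src Q) y)) x, y)),
        fm = (\<lambda>(g, f). (replicate (length (fm (m_src Q) g)) f, g))\<rparr>,
     i_id = m_unit Q\<rparr>"

text \<open>Applied to categories with discrete groupoid of objects.  The pullback is along an inclusion that
  is full in this case, hence a full subgroupoid.\<close>

definition T_S :: "('c,'cm,'x,'xm) int_cat \<Rightarrow> ('c,'cm,'x list,'xm smor) s_operad"
  where "T_S C = \<lparr>s_col = i_ob C,
     s_ops = full_sub (S_grpd (i_ar C)) (\<lambda>fs. \<exists>c. \<forall>f\<in>set fs. fo (i_tgt C) f = c),
     s_src = S_map (i_src C),
     s_tgt = i_tgt C \<bullet> \<lparr>fo = hd, fm = snd \<circ> hd\<rparr>,
     s_mult = S_mu \<bullet>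
       \<lparr>fo = (\<lambda>(gss, fs). map2 (\<lambda>gs f. map (\<lambda>g. fo (i_comp C) (f, g)) gs) gss fs),
        fm = (\<lambda>(pss, rs). map2 (\<lambda>(k, ps) (_, r). (k, map (\<lambda>(j, p). (j, fm (i_comp C) (r, p))) ps)) pss rs)\<rparr>,
     s_unit = S_unit \<bullet> i_id C\<rparr>"

definition T_S_M :: "('c,'cm,'q,'qm) m_operad \<Rightarrow> ('c,'cm,'q list,'qm smor) s_operad"
  where "T_S_M Q = T_S (T_M Q)"


section \<open>The bar construction\<close>

record ('a,'f) simp_grpd =
  level :: "nat \<Rightarrow> ('a,'f) grpd"
  face :: "nat \<Rightarrow> nat \<Rightarrow> ('a,'f,'a,'f) gfun"   \<comment> \<open>\<open>face X n i : X\<^sub>n \<rightarrow> X\<^sub>n\<^sub>-\<^sub>1\<close>\<close>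
  degen :: "nat \<Rightarrow> nat \<Rightarrow> ('a,'f,'a,'f) gfun"  \<comment> \<open>\<open>degen X n i : X\<^sub>n \<rightarrow> X\<^sub>n\<^sub>+\<^sub>1\<close>\<close>

text \<open>One type for the objects (arrows) of all \<open>Q\<^sub>n\<close>: colours for \<open>n = 0\<close>, operations for \<open>n = 1\<close>, and for
  \<open>n \<ge> 2\<close> a tuple of elements of \<open>Q\<^sub>n\<^sub>-\<^sub>1\<close> grafted onto a root operation.\<close>

datatype ('c,'q) tree = Col (the_col: 'c) | Opn (root_op: 'q) | Lev (subs: "('c,'q) tree list") (root_op: 'q)

datatype ('c,'q) mtree = MCol (mthe_col: 'c) | MOpn (mroot_op: 'q) | MLev (msubs: "('c,'q) mtree smor") (mroot_op: 'q)

definition Col_f :: "('c,'cm,('c,'q) tree,('cm,'qm) mtree) gfun"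
  where "Col_f = \<lparr>fo = Col, fm = MCol\<rparr>"

definition root_f :: "(('c,'q) tree,('cm,'qm) mtree,'q,'qm) gfun"
  where "root_f = \<lparr>fo = root_op, fm = mroot_op\<rparr>"

definition out_f :: "('c,'cm,'q,'qm) s_operad \<Rightarrow> (('c,'q) tree,('cm,'qm) mtree,'c,'cm) gfun"
  where "out_f Q =
    \<lparr>fo = (\<lambda>x. case x of Col c \<Rightarrow> c | Opn q \<Rightarrow> fo (s_tgt Q) q | Lev ts q \<Rightarrow> fo (s_tgt Q) q),
     fm = (\<lambda>x. case x of MCol c \<Rightarrow> c | MOpn q \<Rightarrow> fm (s_tgt Q) q | MLev ts q \<Rightarrow> fm (s_tgt Q) q)\<rparr>"

text \<open>The projection from \<open>Q\<^sub>n\<close> to tuples in \<open>Q\<^sub>n\<^sub>-\<^sub>1\<close>, for \<open>n \<ge> 1\<close>; for \<open>n = 1\<close> it is the source.\<close>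

definition below_f ::
  "('c,'cm,'q,'qm) s_operad \<Rightarrow> (('c,'q) tree,('cm,'qm) mtree,('c,'q) tree list,('cm,'qm) mtree smor) gfun"
  where "below_f Q =
    \<lparr>fo = (\<lambda>x. case x of Col c \<Rightarrow> [] | Opn q \<Rightarrow> map Col (fo (s_src Q) q) | Lev ts q \<Rightarrow> ts),
     fm = (\<lambda>x. case x of MCol c \<Rightarrow> [] | MOpn q \<Rightarrow> map (map_prod id MCol) (fm (s_src Q) q) | MLev ts q \<Rightarrow> ts)\<rparr>"

text \<open>Grafting a tuple in \<open>Q\<^sub>n\<^sub>-\<^sub>1\<close> onto a root operation gives an element of \<open>Q\<^sub>n\<close>, for \<open>n \<ge> 1\<close>; for \<open>n = 1\<close>
  the tuple is just the source of the operation and is dropped.\<close>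

definition graft_f ::
  "nat \<Rightarrow> (('c,'q) tree list \<times> 'q, ('cm,'qm) mtree smor \<times> 'qm, ('c,'q) tree,('cm,'qm) mtree) gfun"
  where "graft_f n =
    (if n = 1 then \<lparr>fo = (\<lambda>(ts, q). Opn q), fm = (\<lambda>(ts, q). MOpn q)\<rparr>
     else \<lparr>fo = (\<lambda>(ts, q). Lev ts q), fm = (\<lambda>(ts, q). MLev ts q)\<rparr>)"

fun barQ :: "('c,'cm,'q,'qm) s_operad \<Rightarrow> nat \<Rightarrow> (('c,'q) tree,('cm,'qm) mtree) grpd"
  where
    "barQ Q 0 = relabel Col the_col MCol mthe_col (s_col Q)"
  | "barQ Q (Suc 0) = relabel Opn root_op MOpn mroot_op (s_ops Q)"
  | "barQ Q (Suc (Suc n)) =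
       relabel (\<lambda>(ts, q). Lev ts q) (\<lambda>x. (subs x, root_op x)) (\<lambda>(ts, q). MLev ts q) (\<lambda>x. (msubs x, mroot_op x))
         (pullback (S_grpd (barQ Q (Suc n))) (S_map (out_f Q)) (s_ops Q) (s_src Q))"

text \<open>The face \<open>d\<^sub>i\<close> of \<open>Q\<^sub>n\<^sub>+\<^sub>1\<close> for \<open>i \<le> n\<close>, that is, all faces except the one discarding the root level.
  For \<open>i < n\<close> it acts on the subtrees; for \<open>i = n\<close> it composes the root level with the one above it
  if \<open>n \<ge> 1\<close>, and discards the only level, keeping its output, if \<open>n = 0\<close>.\<close>

fun tree_face ::
  "('c,'cm,'q,'qm) s_operad \<Rightarrow> nat \<Rightarrow> nat \<Rightarrow> (('c,'q) tree,('cm,'qm) mtree,('c,'q) tree,('cm,'qm) mtree) gfun"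
  where
    "tree_face Q 0 i = Col_f \<bullet> out_f Q"
  | "tree_face Q (Suc n) i =
       (if i \<le> n
        then graft_f (Suc n) \<bullet> gf_pair (S_map (tree_face Q n i) \<bullet> below_f Q) root_f
        else graft_f (Suc n) \<bullet> gf_pair
               (S_mu \<bullet> S_map (below_f Q) \<bullet> below_f Q)
               (s_mult Q \<bullet> gf_pair (S_map root_f \<bullet> below_f Q) root_f))"

text \<open>The degeneracy \<open>s\<^sub>i\<close> of \<open>Q\<^sub>n\<close> for \<open>i \<le> n\<close>: a unit is grafted below the root if \<open>i = n\<close>.\<close>

definition tree_unit ::
  "('c,'cm,'q,'qm) s_operad \<Rightarrow> nat \<Rightarrow> (('c,'q) tree,('cm,'qm) mtree,('c,'q) tree,('cm,'qm) mtree) gfun"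
  where "tree_unit Q n = graft_f (Suc n) \<bullet> gf_pair S_unit (s_unit Q \<bullet> out_f Q)"

fun tree_degen ::
  "('c,'cm,'q,'qm) s_operad \<Rightarrow> nat \<Rightarrow> nat \<Rightarrow> (('c,'q) tree,('cm,'qm) mtree,('c,'q) tree,('cm,'qm) mtree) gfun"
  where
    "tree_degen Q 0 i = tree_unit Q 0"
  | "tree_degen Q (Suc n) i =
       (if i \<le> n then graft_f (Suc (Suc n)) \<bullet> gf_pair (S_map (tree_degen Q n i) \<bullet> below_f Q) root_f
        else tree_unit Q (Suc n))"

definition bar :: "('c,'cm,'q,'qm) s_operad \<Rightarrow> (('c,'q) tree list, ('cm,'qm) mtree smor) simp_grpd"
  where "bar Q = \<lparr>level = (\<lambda>n. S_grpd (barQ Q n)),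
     face = (\<lambda>n i. if i < n then S_map (tree_face Q (n - 1) i) else S_mu \<bullet> S_map (below_f Q)),
     degen = (\<lambda>n i. S_map (tree_degen Q n i))\<rparr>"


section \<open>Bialgebras\<close>

text \<open>A bialgebra over the rationals is presented as the space of finitely supported functions on a set
  \<open>bbasis\<close>; its tensor square is the space of finitely supported functions on pairs of basis elements.\<close>

record 'b bialg =
  bbasis :: "'b set"
  bone :: "'b \<Rightarrow>\<^sub>0 rat"
  bmult :: "('b \<Rightarrow>\<^sub>0 rat) \<Rightarrow> ('b \<Rightarrow>\<^sub>0 rat) \<Rightarrow> ('b \<Rightarrow>\<^sub>0 rat)"
  bcomult :: "('b \<Rightarrow>\<^sub>0 rat) \<Rightarrow> ('b \<times> 'b \<Rightarrow>\<^sub>0 rat)"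
  bcounit :: "('b \<Rightarrow>\<^sub>0 rat) \<Rightarrow> rat"

definition bscale :: "rat \<Rightarrow> ('b \<Rightarrow>\<^sub>0 rat) \<Rightarrow> ('b \<Rightarrow>\<^sub>0 rat)"
  where "bscale c v = Poly_Mapping.map ((*) c) v"

definition delta :: "'b \<Rightarrow> ('b \<Rightarrow>\<^sub>0 rat)"
  where "delta b = Poly_Mapping.single b 1"

definition lin_ext :: "('a \<Rightarrow> ('b \<Rightarrow>\<^sub>0 rat)) \<Rightarrow> ('a \<Rightarrow>\<^sub>0 rat) \<Rightarrow> ('b \<Rightarrow>\<^sub>0 rat)"
  where "lin_ext f v = (\<Sum>a\<in>Poly_Mapping.keys v. bscale (Poly_Mapping.lookup v a) (f a))"

definition tensor :: "('a \<Rightarrow>\<^sub>0 rat) \<Rightarrow> ('b \<Rightarrow>\<^sub>0 rat) \<Rightarrow> ('a \<times> 'b \<Rightarrow>\<^sub>0 rat)"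
  where "tensor u v = lin_ext (\<lambda>a. lin_ext (\<lambda>b. delta (a, b)) v) u"

definition tensor_map ::
  "(('a \<Rightarrow>\<^sub>0 rat) \<Rightarrow> ('b \<Rightarrow>\<^sub>0 rat)) \<Rightarrow> ('a \<times> 'a \<Rightarrow>\<^sub>0 rat) \<Rightarrow> ('b \<times> 'b \<Rightarrow>\<^sub>0 rat)"
  where "tensor_map h = lin_ext (\<lambda>(a, b). tensor (h (delta a)) (h (delta b)))"

definition bcarrier :: "'b bialg \<Rightarrow> ('b \<Rightarrow>\<^sub>0 rat) set"
  where "bcarrier A = {v. Poly_Mapping.keys v \<subseteq> bbasis A}"

definition bialg_iso :: "'a bialg \<Rightarrow> 'b bialg \<Rightarrow> (('a \<Rightarrow>\<^sub>0 rat) \<Rightarrow> ('b \<Rightarrow>\<^sub>0 rat)) \<Rightarrow> bool"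
  where "bialg_iso A B h \<longleftrightarrow>
     bij_betw h (bcarrier A) (bcarrier B) \<and>
     (\<forall>u\<in>bcarrier A. \<forall>v\<in>bcarrier A. h (u + v) = h u + h v) \<and>
     (\<forall>c. \<forall>v\<in>bcarrier A. h (bscale c v) = bscale c (h v)) \<and>
     h (bone A) = bone B \<and>
     (\<forall>u\<in>bcarrier A. \<forall>v\<in>bcarrier A. h (bmult A u v) = bmult B (h u) (h v)) \<and>
     (\<forall>v\<in>bcarrier A. bcomult B (h v) = tensor_map h (bcomult A v)) \<and>
     (\<forall>v\<in>bcarrier A. bcounit B (h v) = bcounit A v)"

definition isomorphic_bialg :: "'a bialg \<Rightarrow> 'b bialg \<Rightarrow> bool"
  where "isomorphic_bialg A B \<longleftrightarrow> (\<exists>h. bialg_iso A B h)"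


section \<open>The incidence bialgebra\<close>

definition Phi ::
  "('a,'f) simp_grpd \<Rightarrow> 'a \<Rightarrow> 'a \<Rightarrow> 'a \<Rightarrow> (('a \<times> 'f) \<times> 'f \<times> 'f, ('f \<times> 'f) \<times> 'f \<times> 'f) grpd"
  where "Phi X f a b =
     hofib (gf_pair (face X 2 2) (face X 2 0) \<bullet> hofib_forget)
       (hofib (face X 2 1) (level X 2) (level X 1) f)
       (prod_grpd (level X 1) (level X 1)) (a, b)"

definition inc_coeff :: "('a,'f) simp_grpd \<Rightarrow> 'a set \<Rightarrow> 'a set \<Rightarrow> 'a set \<Rightarrow> rat"
  where "inc_coeff X f a b = hcard (Phi X (rep f) (rep a) (rep b)) /
     (of_nat (card (aut (level X 1) (rep a))) * of_nat (card (aut (level X 1) (rep b))))"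

text \<open>The basis element \<open>None\<close> is the adjoined unit.\<close>

fun juxt :: "('x list,'f) grpd \<Rightarrow> 'x list set option \<Rightarrow> 'x list set option \<Rightarrow> 'x list set option"
  where
    "juxt G None b = b"
  | "juxt G (Some a) None = Some a"
  | "juxt G (Some a) (Some b) = Some (iso_class G (rep a @ rep b))"

fun inc_comult :: "('a,'f) simp_grpd \<Rightarrow> 'a set option \<Rightarrow> ('a set option \<times> 'a set option \<Rightarrow>\<^sub>0 rat)"
  where
    "inc_comult X None = delta (None, None)"
  | "inc_comult X (Some f) =
       (\<Sum>(a, b) \<in> {(a, b) \<in> pi0 (level X 1) \<times> pi0 (level X 1). inc_coeff X f a b \<noteq> 0}.
          bscale (inc_coeff X f a b) (delta (Some a, Some b)))"

fun inc_counit :: "('a,'f) simp_grpd \<Rightarrow> 'a set option \<Rightarrow> rat"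
  where
    "inc_counit X None = 1"
  | "inc_counit X (Some f) = hcard (hofib (degen X 0 0) (level X 0) (level X 1) (rep f))"

definition incidence_bialg :: "('x list,'f) simp_grpd \<Rightarrow> 'x list set option bialg"
  where "incidence_bialg X = \<lparr>bbasis = insert None (Some ` pi0 (level X 1)),
     bone = delta None,
     bmult = (\<lambda>u v. lin_ext (\<lambda>a. lin_ext (\<lambda>b. delta (juxt (level X 1) a b)) v) u),
     bcomult = lin_ext (inc_comult X),
     bcounit = (\<lambda>v. \<Sum>a\<in>Poly_Mapping.keys v. Poly_Mapping.lookup v a * inc_counit X a)\<rparr>"


section \<open>Power series in countably many variables\<close>

type_synonym mono = "nat \<Rightarrow>\<^sub>0 nat"

typedef mps = "UNIV :: (mono \<Rightarrow> rat) set"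
  morphisms coef Mps by simp

lemma coef_Mps [simp]: "coef (Mps f) = f"
  by (simp add: Mps_inverse)

lemma mps_eqI: "(\<And>l. coef F l = coef G l) \<Longrightarrow> F = G"
  by (metis coef_inject ext)

definition splits :: "mono \<Rightarrow> (mono \<times> mono) set"
  where "splits l = {(m, n). m + n = l}"

lemma finite_splits [simp]: "finite (splits l)"
proof -
  define K where "K = Poly_Mapping.keys l"
  define b where "b = Max (insert 0 (Poly_Mapping.lookup l ` K))"
  define S where "S = {f :: nat \<Rightarrow> nat. \<forall>i. (i \<in> K \<longrightarrow> f i \<in> {..b}) \<and> (i \<notin> K \<longrightarrow> f i = 0)}"
  have "finite S"
    unfolding S_def by (rule finite_set_of_finite_funs) (simp_all add: K_def)
  then have fin: "finite (Poly_Mapping.lookup -` S)"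
    by (rule finite_vimageI) (simp add: inj_on_def)
  have sub: "m \<in> Poly_Mapping.lookup -` S" if "m + n = l" for m n
  proof -
    have le: "Poly_Mapping.lookup m i \<le> Poly_Mapping.lookup l i" for i
      using that by (auto simp: lookup_add)
    have "Poly_Mapping.lookup m i \<le> b" if "i \<in> K" for i
    proof -
      have "Poly_Mapping.lookup l i \<le> b"
        unfolding b_def by (rule Max_ge) (use that in \<open>simp_all add: K_def\<close>)
      with le[of i] show ?thesis by linarith
    qed
    moreover have "Poly_Mapping.lookup m i = 0" if "i \<notin> K" for i
      using that le[of i] by (simp add: K_def in_keys_iff)
    ultimately show ?thesis by (simp add: S_def)
  qed
  have "splits l \<subseteq> (Poly_Mapping.lookup -` S) \<times> (Poly_Mapping.lookup -` S)"
  proof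
    fix p assume "p \<in> splits l"
    then have "fst p + snd p = l" "snd p + fst p = l"
      by (auto simp: splits_def add.commute)
    from this[THEN sub] show "p \<in> (Poly_Mapping.lookup -` S) \<times> (Poly_Mapping.lookup -` S)"
      by (simp only: mem_Times_iff)
  qed
  then show ?thesis using fin by (meson finite_SigmaI finite_subset)
qed

instantiation mps :: comm_monoid_mult
begin

definition one_mps :: mps
  where "1 = Mps (\<lambda>l. if l = 0 then 1 else 0)"

definition times_mps :: "mps \<Rightarrow> mps \<Rightarrow> mps"
  where "F * G = Mps (\<lambda>l. \<Sum>(m, n)\<in>splits l. coef F m * coef G n)"

instance
proof
  fix F G H :: mps
  show "F * G = G * F"
  proof (rule mps_eqI)
    fix l
    show "coef (F * G) l = coef (G * F) l"
      unfolding times_mps_def coef_Mps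
      by (rule sum.reindex_bij_witness[of _ prod.swap prod.swap])
        (auto simp: splits_def add.commute mult.commute)
  qed
  show "1 * F = F"
  proof (rule mps_eqI)
    fix l
    have "coef (1 * F) l = (\<Sum>p\<in>splits l. if p = (0, l) then coef F l else 0)"
      unfolding times_mps_def one_mps_def coef_Mps
      by (rule sum.cong) (simp_all add: splits_def split: prod.splits, fastforce)
    also have "\<dots> = coef F l"
      by (subst sum.delta, rule finite_splits) (simp add: splits_def)
    finally show "coef (1 * F) l = coef F l" .
  qed
  show "F * G * H = F * (G * H)"
  proof (rule mps_eqI)
    fix l
    have "coef (F * G * H) l = (\<Sum>p\<in>splits l. \<Sum>q\<in>splits (fst p). coef F (fst q) * coef G (snd q) * coef H (snd p))"
      by (simp add: times_mps_def case_prod_unfold sum_distrib_right)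
    also have "\<dots> = (\<Sum>x\<in>(SIGMA p:splits l. splits (fst p)). coef F (fst (snd x)) * coef G (snd (snd x)) * coef H (snd (fst x)))"
      by (simp add: sum.Sigma case_prod_unfold)
    also have "\<dots> = (\<Sum>x\<in>(SIGMA p:splits l. splits (snd p)). coef F (fst (fst x)) * (coef G (fst (snd x)) * coef H (snd (snd x))))"
      by (rule sum.reindex_bij_witness
          [of _ "\<lambda>x. ((fst (fst x) + fst (snd x), snd (snd x)), (fst (fst x), fst (snd x)))"
                "\<lambda>x. ((fst (snd x), snd (snd x) + snd (fst x)), (snd (snd x), snd (fst x)))"])
        (auto simp: splits_def ac_simps)
    also have "\<dots> = (\<Sum>p\<in>splits l. \<Sum>q\<in>splits (snd p). coef F (fst p) * (coef G (fst q) * coef H (snd q)))"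
      by (simp add: sum.Sigma case_prod_unfold)
    also have "\<dots> = coef (F * (G * H)) l"
      by (simp add: times_mps_def case_prod_unfold sum_distrib_left)
    finally show "coef (F * G * H) l = coef (F * (G * H)) l" .
  qed
qed

end

definition mps_var :: "nat \<Rightarrow> mps"
  where "mps_var i = Mps (\<lambda>l. if l = Poly_Mapping.single i 1 then 1 else 0)"

text \<open>\<open>mps_subst G H = G(H\<^sub>0, H\<^sub>1, H\<^sub>2, \<dots>)\<close>; the sum is over all monomials of \<open>G\<close> that contribute to the
  coefficient of \<open>l\<close>.\<close>

definition mps_subst :: "mps \<Rightarrow> (nat \<Rightarrow> mps) \<Rightarrow> mps"
  where "mps_subst G H =
     Mps (\<lambda>l. Sum_any (\<lambda>m. coef G m * coef (\<Prod>k\<in>Poly_Mapping.keys m. H k ^ Poly_Mapping.lookup m k) l))"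

text \<open>Only the variables with positive index are used; \<open>Lam\<close> consists of the exponents of the nonconstant
  monomials in them.\<close>

definition Lam :: "mono set"
  where "Lam = {l. l \<noteq> 0 \<and> Poly_Mapping.lookup l 0 = 0}"

definition pseries :: "mps set"
  where "pseries = {F. \<forall>l. l \<notin> Lam \<longrightarrow> coef F l = 0}"

definition mono_fact :: "mono \<Rightarrow> nat"
  where "mono_fact l = (\<Prod>i\<in>Poly_Mapping.keys l. fact (Poly_Mapping.lookup l i))"

definition a_coef :: "mono \<Rightarrow> mps \<Rightarrow> rat"
  where "a_coef l F = of_nat (mono_fact l) * coef F l"

definition dilate :: "nat \<Rightarrow> mps \<Rightarrow> mps"
  where "dilate k F = mps_subst F (\<lambda>i. mps_var (i * k))"

definition plethysm :: "mps \<Rightarrow> mps \<Rightarrow> mps"  (infixr \<open>\<circledast>\<close> 70)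
  where "G \<circledast> F = mps_subst G (\<lambda>k. dilate k F)"


section \<open>The exponential plethystic bialgebra\<close>

text \<open>Polynomials in the \<open>a\<^sub>\<lambda>\<close> are finitely supported functions on monomials \<open>mono \<Rightarrow>\<^sub>0 nat\<close> supported on
  \<open>Lam\<close>.  The convolution product on functions on pairs of monomials is the product of the tensor square.\<close>

type_synonym amono = "mono \<Rightarrow>\<^sub>0 nat"

definition amonos :: "amono set"
  where "amonos = {m. Poly_Mapping.keys m \<subseteq> Lam}"

definition eval_amono :: "amono \<Rightarrow> mps \<Rightarrow> rat"
  where "eval_amono m F = (\<Prod>l\<in>Poly_Mapping.keys m. a_coef l F ^ Poly_Mapping.lookup m l)"

definition eval1 :: "(amono \<Rightarrow>\<^sub>0 rat) \<Rightarrow> mps \<Rightarrow> rat"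
  where "eval1 p F = (\<Sum>m\<in>Poly_Mapping.keys p. Poly_Mapping.lookup p m * eval_amono m F)"

definition eval2 :: "(amono \<times> amono \<Rightarrow>\<^sub>0 rat) \<Rightarrow> mps \<Rightarrow> mps \<Rightarrow> rat"
  where "eval2 w F G =
     (\<Sum>(m, n)\<in>Poly_Mapping.keys w. Poly_Mapping.lookup w (m, n) * eval_amono m F * eval_amono n G)"

definition P_comult_gen :: "mono \<Rightarrow> (amono \<times> amono \<Rightarrow>\<^sub>0 rat)"
  where "P_comult_gen l = (THE w. Poly_Mapping.keys w \<subseteq> amonos \<times> amonos \<and>
     (\<forall>F\<in>pseries. \<forall>G\<in>pseries. eval2 w F G = a_coef l (G \<circledast> F)))"

definition P_exp :: "amono bialg"
  where "P_exp = \<lparr>bbasis = amonos, bone = 1, bmult = (*),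
     bcomult = lin_ext (\<lambda>m. \<Prod>l\<in>Poly_Mapping.keys m. P_comult_gen l ^ Poly_Mapping.lookup m l),
     bcounit = (\<lambda>p. eval1 p (mps_var 1))\<rparr>"

end

theory Submission
  imports Defs "HOL-Combinatorics.Multiset_Permutations"
begin

text \<open>For a finite groupoid, homotopy cardinality is the sum over objects of the reciprocal of the number of
  arrows leaving the object, and a homotopy fibre has as many arrows leaving \<open>(x, p)\<close> as there are leaving \<open>x\<close>.
  Hence the coefficient of \<open>\<delta>\<^sub>a \<otimes> \<delta>\<^sub>b\<close> in \<open>\<Delta>(\<delta>\<^sub>f)\<close> is \<open>|Aut f|\<close> times the sum of these reciprocals over the
  two-level trees that compose to \<open>f\<close>, with leaves of class \<open>a\<close> and root of class \<open>b\<close>.  Tuples of trees come with a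
  factor \<open>1/n!\<close>, so the exponential formula makes this multiplicative in \<open>f\<close>, and \<open>a\<^sub>\<lambda> \<mapsto> \<delta>\<^sub>\<lambda>\<close> needs no rescaling.
  For connected \<open>f\<close> the same sum over trees is the expansion of the coefficient of \<open>G \<circledast> F\<close>, when each
  monomial \<open>\<mu>\<close> with its factor \<open>1/\<mu>!\<close> is spread over the lists that represent it.  Distinct monomials in the coefficients
  of \<open>F\<close> and \<open>G\<close> are distinct characters, so this determines the coproduct of the generators.\<close>

section \<open>Groupoids and homotopy fibres\<close>

text \<open>The coefficients are defined by representatives of classes and by nested homotopy
  fibres; a direct count would need the stabilisers of two-level trees. With weights on objects no
  class of trees is ever described, and everything becomes a finite sum over lists. The factorials
  then have one source on both sides: the lists with content \<lambda> have total weight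
  1/\<lambda>!, which is the reciprocal of the number of automorphisms of an operation of class
  \<lambda> and also the normalisation of the coefficients of a series. Finiteness rests on nonempty
  tuples: every operation has an input and every arrow of the monoid is a positive integer, so
  neither level of a tree can exceed its composite. There is one colour and the arrows of the monoid
  form a discrete groupoid, so the root of a tree adds no isomorphisms of its own. The records
  contain no laws; functoriality has to be established, but only in levels 0 to 2, where the
  coproduct and the counit live. In the tensor square the leaves come first and the root second:
  \<open>d_2\<close> goes with \<open>F\<close> and \<open>d_0\<close> with \<open>G\<close> in
  \<open>G \<circledast> F\<close>.\<close>

definition grpd :: "('a,'f) grpd \<Rightarrow> bool"
  where "grpd G \<longleftrightarrow>
    (\<forall>f\<in>Arr G. Dom G f \<in> Obj G \<and> Cod G f \<in> Obj G) \<and>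
    (\<forall>x\<in>Obj G. Idn G x \<in> Arr G \<and> Dom G (Idn G x) = x \<and> Cod G (Idn G x) = x) \<and>
    (\<forall>f\<in>Arr G. \<forall>g\<in>Arr G. Cod G f = Dom G g \<longrightarrow>
       Cmp G g f \<in> Arr G \<and> Dom G (Cmp G g f) = Dom G f \<and> Cod G (Cmp G g f) = Cod G g) \<and>
    (\<forall>f\<in>Arr G. Cmp G f (Idn G (Dom G f)) = f \<and> Cmp G (Idn G (Cod G f)) f = f) \<and>
    (\<forall>f\<in>Arr G. \<forall>g\<in>Arr G. \<forall>h\<in>Arr G. Cod G f = Dom G g \<longrightarrow> Cod G g = Dom G h \<longrightarrow>
       Cmp G h (Cmp G g f) = Cmp G (Cmp G h g) f) \<and>
    (\<forall>f\<in>Arr G. \<exists>g\<in>Arr G. Dom G g = Cod G f \<and> Cod G g = Dom G f \<and>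
       Cmp G g f = Idn G (Dom G f) \<and> Cmp G f g = Idn G (Cod G f))"

lemma grpdI:
  assumes "\<And>f. f \<in> Arr G \<Longrightarrow> Dom G f \<in> Obj G" "\<And>f. f \<in> Arr G \<Longrightarrow> Cod G f \<in> Obj G"
    "\<And>x. x \<in> Obj G \<Longrightarrow> Idn G x \<in> Arr G" "\<And>x. x \<in> Obj G \<Longrightarrow> Dom G (Idn G x) = x"
    "\<And>x. x \<in> Obj G \<Longrightarrow> Cod G (Idn G x) = x"
    "\<And>f g. f \<in> Arr G \<Longrightarrow> g \<in> Arr G \<Longrightarrow> Cod G f = Dom G g \<Longrightarrow> Cmp G g f \<in> Arr G"
    "\<And>f g. f \<in> Arr G \<Longrightarrow> g \<in> Arr G \<Longrightarrow> Cod G f = Dom G g \<Longrightarrow> Dom G (Cmp G g f) = Dom G f"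
    "\<And>f g. f \<in> Arr G \<Longrightarrow> g \<in> Arr G \<Longrightarrow> Cod G f = Dom G g \<Longrightarrow> Cod G (Cmp G g f) = Cod G g"
    "\<And>f. f \<in> Arr G \<Longrightarrow> Cmp G f (Idn G (Dom G f)) = f"
    "\<And>f. f \<in> Arr G \<Longrightarrow> Cmp G (Idn G (Cod G f)) f = f"
    "\<And>f g h. f \<in> Arr G \<Longrightarrow> g \<in> Arr G \<Longrightarrow> h \<in> Arr G \<Longrightarrow> Cod G f = Dom G g \<Longrightarrow> Cod G g = Dom G h
       \<Longrightarrow> Cmp G h (Cmp G g f) = Cmp G (Cmp G h g) f"
    "\<And>f. f \<in> Arr G \<Longrightarrow> \<exists>g\<in>Arr G. Dom G g = Cod G f \<and> Cod G g = Dom G f \<and>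
       Cmp G g f = Idn G (Dom G f) \<and> Cmp G f g = Idn G (Cod G f)"
  shows "grpd G"
  unfolding grpd_def using assms by auto

lemma
  assumes "grpd G"
  shows grpd_Dom: "f \<in> Arr G \<Longrightarrow> Dom G f \<in> Obj G"
    and grpd_Cod: "f \<in> Arr G \<Longrightarrow> Cod G f \<in> Obj G"
    and grpd_Idn: "x \<in> Obj G \<Longrightarrow> Idn G x \<in> Arr G"
    and grpd_Dom_Idn: "x \<in> Obj G \<Longrightarrow> Dom G (Idn G x) = x"
    and grpd_Cod_Idn: "x \<in> Obj G \<Longrightarrow> Cod G (Idn G x) = x"
    and grpd_Cmp: "f \<in> Arr G \<Longrightarrow> g \<in> Arr G \<Longrightarrow> Cod G f = Dom G g \<Longrightarrow> Cmp G g f \<in> Arr G"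
    and grpd_Dom_Cmp: "f \<in> Arr G \<Longrightarrow> g \<in> Arr G \<Longrightarrow> Cod G f = Dom G g \<Longrightarrow> Dom G (Cmp G g f) = Dom G f"
    and grpd_Cod_Cmp: "f \<in> Arr G \<Longrightarrow> g \<in> Arr G \<Longrightarrow> Cod G f = Dom G g \<Longrightarrow> Cod G (Cmp G g f) = Cod G g"
    and grpd_Idn_right: "f \<in> Arr G \<Longrightarrow> Cmp G f (Idn G (Dom G f)) = f"
    and grpd_Idn_left: "f \<in> Arr G \<Longrightarrow> Cmp G (Idn G (Cod G f)) f = f"
    and grpd_assoc: "f \<in> Arr G \<Longrightarrow> g \<in> Arr G \<Longrightarrow> h \<in> Arr G \<Longrightarrow> Cod G f = Dom G g \<Longrightarrow> Cod G g = Dom G h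
       \<Longrightarrow> Cmp G h (Cmp G g f) = Cmp G (Cmp G h g) f"
    and grpd_inverse: "f \<in> Arr G \<Longrightarrow> \<exists>g\<in>Arr G. Dom G g = Cod G f \<and> Cod G g = Dom G f \<and>
       Cmp G g f = Idn G (Dom G f) \<and> Cmp G f g = Idn G (Cod G f)"
  using assms unfolding grpd_def by simp_all

lemmas grpd_simps = grpd_Dom grpd_Cod grpd_Idn grpd_Dom_Idn grpd_Cod_Idn grpd_Cmp grpd_Dom_Cmp
  grpd_Cod_Cmp grpd_Idn_right grpd_Idn_left

definition inv_arr :: "('a,'f) grpd \<Rightarrow> 'f \<Rightarrow> 'f"
  where "inv_arr G f = (SOME g. g \<in> Arr G \<and> Dom G g = Cod G f \<and> Cod G g = Dom G f \<and>
       Cmp G g f = Idn G (Dom G f) \<and> Cmp G f g = Idn G (Cod G f))"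

lemma
  assumes "grpd G" "f \<in> Arr G"
  shows inv_arr_Arr: "inv_arr G f \<in> Arr G"
    and Dom_inv_arr: "Dom G (inv_arr G f) = Cod G f"
    and Cod_inv_arr: "Cod G (inv_arr G f) = Dom G f"
    and inv_arr_left: "Cmp G (inv_arr G f) f = Idn G (Dom G f)"
    and inv_arr_right: "Cmp G f (inv_arr G f) = Idn G (Cod G f)"
proof -
  have "\<exists>g. g \<in> Arr G \<and> Dom G g = Cod G f \<and> Cod G g = Dom G f \<and>
       Cmp G g f = Idn G (Dom G f) \<and> Cmp G f g = Idn G (Cod G f)"
    using grpd_inverse[OF assms] by blast
  from someI_ex[OF this]
  show "inv_arr G f \<in> Arr G" "Dom G (inv_arr G f) = Cod G f" "Cod G (inv_arr G f) = Dom G f"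
    "Cmp G (inv_arr G f) f = Idn G (Dom G f)" "Cmp G f (inv_arr G f) = Idn G (Cod G f)"
    unfolding inv_arr_def by blast+
qed

lemmas inv_arr_simps = inv_arr_Arr Dom_inv_arr Cod_inv_arr inv_arr_left inv_arr_right

lemma Cmp_inv_cancel:
  assumes G: "grpd G" and "f \<in> Arr G" "p \<in> Arr G" "Dom G p = Dom G f"
  shows "Cmp G (Cmp G p (inv_arr G f)) f = p"
proof -
  have "Cmp G (Cmp G p (inv_arr G f)) f = Cmp G p (Cmp G (inv_arr G f) f)"
    by (rule grpd_assoc[symmetric]) (use assms in \<open>simp_all add: inv_arr_simps\<close>)
  also have "\<dots> = p"
    using assms by (metis inv_arr_left grpd_Idn_right)
  finally show ?thesis .
qed

lemma Cmp_cancel_right: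
  assumes G: "grpd G" and f: "f \<in> Arr G" and p: "p \<in> Arr G" "p' \<in> Arr G"
    and "Dom G p = Cod G f" "Dom G p' = Cod G f" and eq: "Cmp G p f = Cmp G p' f"
  shows "p = p'"
proof -
  have *: "Cmp G (Cmp G q f) (inv_arr G f) = q" if "q \<in> Arr G" "Dom G q = Cod G f" for q
  proof -
    have "Cmp G (Cmp G q f) (inv_arr G f) = Cmp G q (Cmp G f (inv_arr G f))"
      by (rule grpd_assoc[symmetric]) (use assms that in \<open>simp_all add: inv_arr_simps\<close>)
    also have "\<dots> = q"
      using G f that by (metis inv_arr_right grpd_Idn_right)
    finally show ?thesis .
  qed
  from * assms show ?thesis by metis
qed

lemma Cmp_cancel_left:
  assumes G: "grpd G" and f: "f \<in> Arr G" and p: "p \<in> Arr G" "p' \<in> Arr G"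
    and "Cod G p = Dom G f" "Cod G p' = Dom G f" and eq: "Cmp G f p = Cmp G f p'"
  shows "p = p'"
proof -
  have *: "Cmp G (inv_arr G f) (Cmp G f q) = q" if "q \<in> Arr G" "Cod G q = Dom G f" for q
  proof -
    have "Cmp G (inv_arr G f) (Cmp G f q) = Cmp G (Cmp G (inv_arr G f) f) q"
      by (rule grpd_assoc) (use assms that in \<open>simp_all add: inv_arr_simps\<close>)
    also have "\<dots> = q"
      using G f that by (metis inv_arr_left grpd_Idn_left)
    finally show ?thesis .
  qed
  from * assms show ?thesis by metis
qed

section \<open>Isomorphism classes and the counting of arrows\<close>

definition hom :: "('a,'f) grpd \<Rightarrow> 'a \<Rightarrow> 'a \<Rightarrow> 'f set"
  where "hom G x y = {f \<in> Arr G. Dom G f = x \<and> Cod G f = y}"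

text \<open>The size of this set, unlike that of the automorphism group, factors over the entries of
  a tuple even if some of them are isomorphic, so that no stabilisers appear.\<close>

definition star :: "('a,'f) grpd \<Rightarrow> 'a \<Rightarrow> 'f set"
  where "star G x = {f \<in> Arr G. Dom G f = x}"

definition isorel :: "('a,'f) grpd \<Rightarrow> ('a \<times> 'a) set"
  where "isorel G = {(x, y). \<exists>f\<in>Arr G. Dom G f = x \<and> Cod G f = y}"

lemma pi0_isorel: "pi0 G = Obj G // isorel G"
  by (simp add: pi0_def isorel_def)

lemma iso_class_isorel: "iso_class G x = isorel G `` {x}"
  by (simp add: iso_class_def isorel_def)

lemma aut_hom: "aut G x = hom G x x"
  by (simp add: aut_def hom_def)

lemma isorel_hom: "(x, y) \<in> isorel G \<longleftrightarrow> hom G x y \<noteq> {}"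
  by (auto simp: isorel_def hom_def)

lemma equiv_isorel:
  assumes "grpd G"
  shows "equiv (Obj G) (isorel G)"
proof (rule equivI)
  show "isorel G \<subseteq> Obj G \<times> Obj G"
    using assms by (auto simp: isorel_def grpd_simps)
  show "refl_on (Obj G) (isorel G)"
  proof (rule refl_onI)
    fix x assume "x \<in> Obj G"
    with assms show "(x, x) \<in> isorel G"
      by (auto simp: isorel_def grpd_simps intro!: bexI[of _ "Idn G x"])
  qed
  show "sym (isorel G)"
  proof (rule symI)
    fix x y assume "(x, y) \<in> isorel G"
    then obtain f where "f \<in> Arr G" "Dom G f = x" "Cod G f = y" by (auto simp: isorel_def)
    with assms show "(y, x) \<in> isorel G"
      by (auto simp: isorel_def inv_arr_simps intro!: bexI[of _ "inv_arr G f"])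
  qed
  show "trans (isorel G)"
  proof (rule transI)
    fix x y z assume "(x, y) \<in> isorel G" "(y, z) \<in> isorel G"
    then obtain f g where "f \<in> Arr G" "g \<in> Arr G" "Dom G f = x" "Cod G f = Dom G g" "Cod G g = z"
      by (auto simp: isorel_def)
    with assms show "(x, z) \<in> isorel G"
      by (auto simp: isorel_def intro!: bexI[of _ "Cmp G g f"] simp: grpd_simps)
  qed
qed

text \<open>Composing with fixed arrows on both sides is injective by cancellation. Used in both
  directions, this shows that the size of a hom-set depends only on the classes of its ends.\<close>

lemma card_hom_le:
  assumes G: "grpd G" and a: "a \<in> hom G x' x" and b: "b \<in> hom G y y'" and fin: "finite (hom G x' y')"
  shows "card (hom G x y) \<le> card (hom G x' y')"
proof (rule card_inj_on_le[OF _ _ fin])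
  show "inj_on (\<lambda>f. Cmp G (Cmp G b f) a) (hom G x y)"
  proof (rule inj_onI)
    fix f g assume f: "f \<in> hom G x y" and g: "g \<in> hom G x y"
      and eq: "Cmp G (Cmp G b f) a = Cmp G (Cmp G b g) a"
    have "Cmp G b f = Cmp G b g"
      by (rule Cmp_cancel_right[OF G _ _ _ _ _ eq])
        (use G a b f g in \<open>auto simp: hom_def grpd_simps\<close>)
    then show "f = g"
      by (rule Cmp_cancel_left[OF G, rotated -1])
        (use G a b f g in \<open>auto simp: hom_def grpd_simps\<close>)
  qed
  show "(\<lambda>f. Cmp G (Cmp G b f) a) ` hom G x y \<subseteq> hom G x' y'"
    using G a b by (auto simp: hom_def grpd_simps)
qed

lemma card_hom_isorel:
  assumes G: "grpd G" and fin: "\<And>x y. finite (hom G x y)"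
    and "(x, x') \<in> isorel G" "(y, y') \<in> isorel G"
  shows "card (hom G x y) = card (hom G x' y')"
proof -
  have sym: "sym (isorel G)" using equiv_isorel[OF G] by (rule equivE)
  obtain a b c d where "a \<in> hom G x' x" "b \<in> hom G y y'" "c \<in> hom G x x'" "d \<in> hom G y' y"
    using assms(3,4) sym by (meson isorel_hom symD all_not_in_conv)
  with card_hom_le[OF G _ _ fin] show ?thesis by (meson le_antisym)
qed

lemma finite_hom: "finite (star G x) \<Longrightarrow> finite (hom G x y)"
  by (rule finite_subset[rotated]) (auto simp: star_def hom_def)

text \<open>Sort the arrows leaving \<open>x\<close> by codomain: it stays in the class, and all
  hom-sets within a class have equal size.\<close>

lemma card_star_class:
  assumes G: "grpd G" and fin: "\<And>x. finite (star G x)"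
    and c: "c \<in> pi0 G" "finite c" "x \<in> c" "y \<in> c"
  shows "card (star G x) = card c * card (hom G y y)"
proof -
  have eqv: "equiv (Obj G) (isorel G)" by (rule equiv_isorel[OF G])
  have rel: "(u, v) \<in> isorel G" if "u \<in> c" "v \<in> c" for u v
    using quotient_eq_iff[OF eqv, of c c u v] c that by (simp add: pi0_isorel)
  have sub: "v \<in> c" if "(u, v) \<in> isorel G" "u \<in> c" for u v
    using c(1) that eqv unfolding pi0_isorel by (metis in_quotient_imp_closed)
  have "star G x = (\<Union>v\<in>c. hom G x v)"
  proof
    show "star G x \<subseteq> (\<Union>v\<in>c. hom G x v)"
      using sub[OF _ c(3)] by (auto simp: star_def hom_def isorel_def)
  qed (auto simp: star_def hom_def)
  also have "card \<dots> = (\<Sum>v\<in>c. card (hom G x v))"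
    by (rule card_UN_disjoint) (use c finite_hom[OF fin] in \<open>auto simp: hom_def\<close>)
  also have "\<dots> = (\<Sum>v\<in>c. card (hom G y y))"
    by (rule sum.cong) (use c rel card_hom_isorel[OF G finite_hom[OF fin]] in blast)+
  finally show ?thesis by simp
qed

text \<open>The factor \<open>card c\<close> in the size of each star is compensated by the number
  of summands.\<close>

lemma sum_star_class:
  assumes G: "grpd G" and fin: "\<And>x. finite (star G x)" and c: "c \<in> pi0 G" "finite c" "y \<in> c"
  shows "(\<Sum>x\<in>c. 1 / of_nat (card (star G x)) :: rat) = 1 / of_nat (card (hom G y y))"
proof -
  have "(\<Sum>x\<in>c. 1 / of_nat (card (star G x)) :: rat) = (\<Sum>x\<in>c. 1 / of_nat (card c * card (hom G y y)))"
    by (rule sum.cong) (use card_star_class[OF G fin c(1,2) _ c(3)] in simp_all)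
  also have "\<dots> = 1 / of_nat (card (hom G y y))"
    using c by (auto simp: divide_simps)
  finally show ?thesis .
qed

lemma rep_in: "grpd G \<Longrightarrow> c \<in> pi0 G \<Longrightarrow> rep c \<in> c"
  unfolding rep_def pi0_isorel by (metis equiv_isorel in_quotient_imp_non_empty some_in_eq)

lemma pi0_subset: "grpd G \<Longrightarrow> c \<in> pi0 G \<Longrightarrow> c \<subseteq> Obj G"
  unfolding pi0_isorel by (metis equiv_isorel in_quotient_imp_subset)

lemma hcard_eq_sum:
  assumes G: "grpd G" and fin: "\<And>x. finite (star G x)" and fo: "finite (Obj G)"
  shows "hcard G = (\<Sum>x\<in>Obj G. 1 / of_nat (card (star G x)))"
proof -
  have eqv: "equiv (Obj G) (isorel G)" by (rule equiv_isorel[OF G])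
  have finc: "finite c" if "c \<in> pi0 G" for c
    using that fo by (meson G pi0_subset finite_subset)
  have "(\<Sum>x\<in>Obj G. 1 / of_nat (card (star G x)) :: rat) = (\<Sum>x\<in>\<Union>(pi0 G). 1 / of_nat (card (star G x)))"
    using Union_quotient[OF eqv] by (simp add: pi0_isorel)
  also have "\<dots> = (\<Sum>c\<in>pi0 G. \<Sum>x\<in>c. 1 / of_nat (card (star G x)))"
    by (subst sum.Union_disjoint)
      (use finc quotient_disj[OF eqv] in \<open>auto simp: pi0_isorel\<close>)
  also have "\<dots> = (\<Sum>c\<in>pi0 G. 1 / of_nat (card (aut G (rep c))))"
    by (rule sum.cong) (use sum_star_class[OF G fin _ finc rep_in[OF G]] in \<open>simp_all add: aut_hom\<close>)
  finally show ?thesis by (simp add: hcard_def)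
qed

section \<open>Functors, products and pullbacks\<close>

definition gfunctor :: "('a,'f,'b,'g) gfun \<Rightarrow> ('a,'f) grpd \<Rightarrow> ('b,'g) grpd \<Rightarrow> bool"
  where "gfunctor F G H \<longleftrightarrow>
    (\<forall>x\<in>Obj G. fo F x \<in> Obj H) \<and>
    (\<forall>f\<in>Arr G. fm F f \<in> Arr H \<and> Dom H (fm F f) = fo F (Dom G f) \<and> Cod H (fm F f) = fo F (Cod G f)) \<and>
    (\<forall>f\<in>Arr G. \<forall>g\<in>Arr G. Cod G f = Dom G g \<longrightarrow> fm F (Cmp G g f) = Cmp H (fm F g) (fm F f))"

lemma gfunctorI:
  assumes "\<And>x. x \<in> Obj G \<Longrightarrow> fo F x \<in> Obj H"
    "\<And>f. f \<in> Arr G \<Longrightarrow> fm F f \<in> Arr H"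
    "\<And>f. f \<in> Arr G \<Longrightarrow> Dom H (fm F f) = fo F (Dom G f)"
    "\<And>f. f \<in> Arr G \<Longrightarrow> Cod H (fm F f) = fo F (Cod G f)"
    "\<And>f g. f \<in> Arr G \<Longrightarrow> g \<in> Arr G \<Longrightarrow> Cod G f = Dom G g \<Longrightarrow> fm F (Cmp G g f) = Cmp H (fm F g) (fm F f)"
  shows "gfunctor F G H"
  using assms by (simp add: gfunctor_def)

lemma
  assumes "gfunctor F G H"
  shows gfunctor_Obj: "x \<in> Obj G \<Longrightarrow> fo F x \<in> Obj H"
    and gfunctor_Arr: "f \<in> Arr G \<Longrightarrow> fm F f \<in> Arr H"
    and gfunctor_Dom: "f \<in> Arr G \<Longrightarrow> Dom H (fm F f) = fo F (Dom G f)"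
    and gfunctor_Cod: "f \<in> Arr G \<Longrightarrow> Cod H (fm F f) = fo F (Cod G f)"
    and gfunctor_Cmp: "f \<in> Arr G \<Longrightarrow> g \<in> Arr G \<Longrightarrow> Cod G f = Dom G g \<Longrightarrow>
      fm F (Cmp G g f) = Cmp H (fm F g) (fm F f)"
  using assms by (simp_all add: gfunctor_def)

lemmas gfunctor_simps = gfunctor_Obj gfunctor_Arr gfunctor_Dom gfunctor_Cod gfunctor_Cmp

text \<open>The image of an identity is idempotent, and cancellation leaves the identity as the only
  idempotent arrow at an object.\<close>

lemma gfunctor_Idn:
  assumes G: "grpd G" and H: "grpd H" and F: "gfunctor F G H" and x: "x \<in> Obj G"
  shows "fm F (Idn G x) = Idn H (fo F x)"
proof -
  let ?i = "fm F (Idn G x)"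
  have i: "?i \<in> Arr H" "Dom H ?i = fo F x" "Cod H ?i = fo F x"
    using G F x by (simp_all add: gfunctor_simps grpd_simps)
  have "Cmp H ?i ?i = fm F (Cmp G (Idn G x) (Idn G x))"
    using G F x by (simp add: gfunctor_simps grpd_simps)
  also have "Cmp G (Idn G x) (Idn G x) = Idn G x"
    using G x by (metis grpd_Idn grpd_Dom_Idn grpd_Idn_right)
  finally have "Cmp H ?i ?i = ?i" .
  also have "?i = Cmp H ?i (Idn H (fo F x))"
    using H i by (metis grpd_Idn_right)
  finally show ?thesis
    by (rule Cmp_cancel_left[OF H, rotated -1]) (use H i F x in \<open>auto simp: grpd_simps gfunctor_simps\<close>)
qed

lemma gfunctor_inv:
  assumes G: "grpd G" and H: "grpd H" and F: "gfunctor F G H" and f: "f \<in> Arr G"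
  shows "fm F (inv_arr G f) = inv_arr H (fm F f)"
proof (rule Cmp_cancel_right[OF H])
  have "Cmp H (fm F (inv_arr G f)) (fm F f) = fm F (Cmp G (inv_arr G f) f)"
    by (rule gfunctor_Cmp[OF F, symmetric]) (use G f in \<open>simp_all add: inv_arr_simps\<close>)
  also have "\<dots> = Idn H (fo F (Dom G f))"
    using assms by (simp add: inv_arr_simps gfunctor_Idn grpd_simps)
  also have "\<dots> = Cmp H (inv_arr H (fm F f)) (fm F f)"
    using assms by (simp add: inv_arr_simps gfunctor_simps)
  finally show "Cmp H (fm F (inv_arr G f)) (fm F f) = Cmp H (inv_arr H (fm F f)) (fm F f)" .
qed (use assms in \<open>simp_all add: gfunctor_simps inv_arr_simps\<close>)

lemma gfunctor_comp:
  assumes "gfunctor F H K" "gfunctor E G H"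
  shows "gfunctor (F \<bullet> E) G K"
  by (rule gfunctorI) (use assms in \<open>simp_all add: gf_comp_def gfunctor_simps\<close>)

lemma gfunctor_pair:
  assumes "gfunctor F G H" "gfunctor E G K"
  shows "gfunctor (gf_pair F E) G (prod_grpd H K)"
  by (rule gfunctorI) (use assms in \<open>simp_all add: gf_pair_def prod_grpd_def gfunctor_simps\<close>)

lemma prod_grpd_simps [simp]:
  "Obj (prod_grpd G H) = Obj G \<times> Obj H" "Arr (prod_grpd G H) = Arr G \<times> Arr H"
  "Dom (prod_grpd G H) = map_prod (Dom G) (Dom H)" "Cod (prod_grpd G H) = map_prod (Cod G) (Cod H)"
  "Idn (prod_grpd G H) = map_prod (Idn G) (Idn H)"
  "Cmp (prod_grpd G H) (g, g') (f, f') = (Cmp G g f, Cmp H g' f')"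
  by (simp_all add: prod_grpd_def)

lemma grpd_prod:
  assumes G: "grpd G" and H: "grpd H"
  shows "grpd (prod_grpd G H)"
proof (rule grpdI)
  fix f assume "f \<in> Arr (prod_grpd G H)"
  then obtain a b where f: "f = (a, b)" "a \<in> Arr G" "b \<in> Arr H" by auto
  show "\<exists>g\<in>Arr (prod_grpd G H). Dom (prod_grpd G H) g = Cod (prod_grpd G H) f \<and>
      Cod (prod_grpd G H) g = Dom (prod_grpd G H) f \<and>
      Cmp (prod_grpd G H) g f = Idn (prod_grpd G H) (Dom (prod_grpd G H) f) \<and>
      Cmp (prod_grpd G H) f g = Idn (prod_grpd G H) (Cod (prod_grpd G H) f)"
    by (rule bexI[of _ "(inv_arr G a, inv_arr H b)"]) (use f G H in \<open>simp_all add: inv_arr_simps\<close>)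
qed (use G H in \<open>auto simp: grpd_simps grpd_assoc\<close>)

lemma pullback_simps [simp]:
  "Obj (pullback G F H F') = {(x, y). x \<in> Obj G \<and> y \<in> Obj H \<and> fo F x = fo F' y}"
  "Arr (pullback G F H F') = {(f, g). f \<in> Arr G \<and> g \<in> Arr H \<and> fm F f = fm F' g}"
  "Dom (pullback G F H F') = map_prod (Dom G) (Dom H)" "Cod (pullback G F H F') = map_prod (Cod G) (Cod H)"
  "Idn (pullback G F H F') = map_prod (Idn G) (Idn H)"
  "Cmp (pullback G F H F') (g, g') (f, f') = (Cmp G g f, Cmp H g' f')"
  by (simp_all add: pullback_def prod_grpd_def)

text \<open>Identities and inverses lie in the pullback because both functors preserve them.\<close>

lemma grpd_pullback:
  assumes G: "grpd G" and H: "grpd H" and K: "grpd K" and F: "gfunctor F G K" and F': "gfunctor F' H K"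
  shows "grpd (pullback G F H F')"
proof (rule grpdI)
  fix f assume f: "f \<in> Arr (pullback G F H F')"
  then obtain a b where ab: "f = (a, b)" "a \<in> Arr G" "b \<in> Arr H" "fm F a = fm F' b" by auto
  show "\<exists>g\<in>Arr (pullback G F H F'). Dom (pullback G F H F') g = Cod (pullback G F H F') f \<and>
      Cod (pullback G F H F') g = Dom (pullback G F H F') f \<and>
      Cmp (pullback G F H F') g f = Idn (pullback G F H F') (Dom (pullback G F H F') f) \<and>
      Cmp (pullback G F H F') f g = Idn (pullback G F H F') (Cod (pullback G F H F') f)"
    by (rule bexI[of _ "(inv_arr G a, inv_arr H b)"])
      (use ab G H in \<open>simp_all add: inv_arr_simps gfunctor_inv[OF G K F] gfunctor_inv[OF H K F']\<close>)
  show "Dom (pullback G F H F') f \<in> Obj (pullback G F H F')"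
    using ab gfunctor_Dom[OF F ab(2)] gfunctor_Dom[OF F' ab(3)] G H by (simp add: grpd_simps)
  show "Cod (pullback G F H F') f \<in> Obj (pullback G F H F')"
    using ab gfunctor_Cod[OF F ab(2)] gfunctor_Cod[OF F' ab(3)] G H by (simp add: grpd_simps)
qed (use G H in \<open>auto simp: grpd_simps grpd_assoc gfunctor_Cmp[OF F] gfunctor_Cmp[OF F']
  gfunctor_Idn[OF G K F] gfunctor_Idn[OF H K F']\<close>)

lemma gfunctor_fst_pullback: "gfunctor \<lparr>fo = fst, fm = fst\<rparr> (pullback G F H F') G"
  by (rule gfunctorI) auto

lemma gfunctor_snd_pullback: "gfunctor \<lparr>fo = snd, fm = snd\<rparr> (pullback G F H F') H"
  by (rule gfunctorI) auto

section \<open>Homotopy fibres and their cardinality\<close>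

lemma hofib_simps [simp]:
  "Obj (hofib F G H h) = {(x, p). x \<in> Obj G \<and> p \<in> Arr H \<and> Dom H p = fo F x \<and> Cod H p = h}"
  "Arr (hofib F G H h) = {(g, p). g \<in> Arr G \<and> p \<in> Arr H \<and> Dom H p = fo F (Cod G g) \<and> Cod H p = h}"
  "Dom (hofib F G H h) (g, p) = (Dom G g, Cmp H p (fm F g))"
  "Cod (hofib F G H h) (g, p) = (Cod G g, p)"
  "Idn (hofib F G H h) (x, p) = (Idn G x, p)"
  "Cmp (hofib F G H h) (g', p') (g, p) = (Cmp G g' g, p')"
  by (simp_all add: hofib_def)

lemma grpd_hofib:
  assumes G: "grpd G" and H: "grpd H" and F: "gfunctor F G H"
  shows "grpd (hofib F G H h)"
proof -
  note s = G H F gfunctor_simps[OF F] grpd_simps[OF G] grpd_simps[OF H] gfunctor_Idn[OF G H F]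
  have idr: "Cmp H p (Idn H (fo F x)) = p" if "p \<in> Arr H" "Dom H p = fo F x" for p x
    using grpd_Idn_right[OF H that(1)] that(2) by simp
  \<comment> \<open>An arrow stores the structure map of its codomain; the one of its domain has to
    be recomputed, and this makes it compatible with composition.\<close>
  have ass: "Cmp H p (fm F (Cmp G g f)) = Cmp H (Cmp H p (fm F g)) (fm F f)"
    if "f \<in> Arr G" "g \<in> Arr G" "Cod G f = Dom G g" "p \<in> Arr H" "Dom H p = fo F (Cod G g)" for f g p
    using that by (subst gfunctor_Cmp[OF F]) (simp_all add: s grpd_assoc[OF H])
  show ?thesis
  proof (rule grpdI)
    fix f assume f: "f \<in> Arr (hofib F G H h)"
    then obtain g p where gp: "f = (g, p)" "g \<in> Arr G" "p \<in> Arr H" "Dom H p = fo F (Cod G g)" "Cod H p = h"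
      by auto
    note t = inv_arr_simps[OF G gp(2)]
    \<comment> \<open>The inverse of \<open>(g, p)\<close> carries the structure map of the old
      domain, which is \<open>p\<close> after \<open>F g\<close>; transported along the inverse of
      \<open>g\<close> it becomes \<open>p\<close> again.\<close>
    have "Cmp H (Cmp H p (fm F g)) (fm F (inv_arr G g)) = Cmp H p (fm F (Cmp G g (inv_arr G g)))"
      by (rule ass[symmetric]) (use gp in \<open>simp_all add: t\<close>)
    also have "\<dots> = p"
      using gp by (simp add: t s idr)
    finally show "\<exists>g\<in>Arr (hofib F G H h). Dom (hofib F G H h) g = Cod (hofib F G H h) f \<and>
        Cod (hofib F G H h) g = Dom (hofib F G H h) f \<and>
        Cmp (hofib F G H h) g f = Idn (hofib F G H h) (Dom (hofib F G H h) f) \<and>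
        Cmp (hofib F G H h) f g = Idn (hofib F G H h) (Cod (hofib F G H h) f)"
      by (intro bexI[of _ "(inv_arr G g, Cmp H p (fm F g))"]) (use gp t in \<open>auto simp: s\<close>)
  next
    fix f g assume f: "f \<in> Arr (hofib F G H h)" and g: "g \<in> Arr (hofib F G H h)"
      and fg: "Cod (hofib F G H h) f = Dom (hofib F G H h) g"
    obtain f1 f2 g1 g2 where fg': "f = (f1, f2)" "g = (g1, g2)" by (metis prod.exhaust)
    with f g fg have *: "f1 \<in> Arr G" "g1 \<in> Arr G" "Cod G f1 = Dom G g1" "g2 \<in> Arr H"
      "Dom H g2 = fo F (Cod G g1)" "Cod H g2 = h" "f2 = Cmp H g2 (fm F g1)"
      by auto
    then show "Cmp (hofib F G H h) g f \<in> Arr (hofib F G H h)"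
      "Cod (hofib F G H h) (Cmp (hofib F G H h) g f) = Cod (hofib F G H h) g"
      by (simp_all add: fg' grpd_simps[OF G])
    from * show "Dom (hofib F G H h) (Cmp (hofib F G H h) g f) = Dom (hofib F G H h) f"
      by (simp add: fg' grpd_simps[OF G] ass)
  next
    fix f g k assume fgk: "f \<in> Arr (hofib F G H h)" "g \<in> Arr (hofib F G H h)" "k \<in> Arr (hofib F G H h)"
      "Cod (hofib F G H h) f = Dom (hofib F G H h) g" "Cod (hofib F G H h) g = Dom (hofib F G H h) k"
    obtain f1 f2 g1 g2 k1 k2 where "f = (f1, f2)" "g = (g1, g2)" "k = (k1, k2)" by (metis prod.exhaust)
    with fgk show "Cmp (hofib F G H h) k (Cmp (hofib F G H h) g f) = Cmp (hofib F G H h) (Cmp (hofib F G H h) k g) f"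
      by (simp add: grpd_assoc[OF G])
  next
    fix f assume "f \<in> Arr (hofib F G H h)"
    then obtain g p where gp: "f = (g, p)" "g \<in> Arr G" "p \<in> Arr H" "Dom H p = fo F (Cod G g)" "Cod H p = h"
      by auto
    then show "Dom (hofib F G H h) f \<in> Obj (hofib F G H h)" "Cod (hofib F G H h) f \<in> Obj (hofib F G H h)"
      "Cmp (hofib F G H h) f (Idn (hofib F G H h) (Dom (hofib F G H h) f)) = f"
      "Cmp (hofib F G H h) (Idn (hofib F G H h) (Cod (hofib F G H h) f)) f = f"
      by (simp_all add: s)
  next
    fix y assume "y \<in> Obj (hofib F G H h)"
    then obtain x p where xp: "y = (x, p)" "x \<in> Obj G" "p \<in> Arr H" "Dom H p = fo F x" "Cod H p = h"
      by auto
    then show "Idn (hofib F G H h) y \<in> Arr (hofib F G H h)"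
      "Dom (hofib F G H h) (Idn (hofib F G H h) y) = y" "Cod (hofib F G H h) (Idn (hofib F G H h) y) = y"
      by (simp_all add: s idr)
  qed
qed

text \<open>The structure map at the far end of an arrow leaving \<open>(x, q)\<close> is forced to
  be \<open>q\<close> after the inverse of \<open>F g\<close>, so \<open>g\<close> alone determines
  the arrow, and every \<open>g\<close> occurs.\<close>

lemma bij_betw_star_hofib:
  assumes G: "grpd G" and H: "grpd H" and F: "gfunctor F G H" and x: "(x, q) \<in> Obj (hofib F G H h)"
  shows "bij_betw fst (star (hofib F G H h) (x, q)) (star G x)"
proof (rule bij_betw_imageI)
  note s = gfunctor_simps[OF F] grpd_simps[OF G] grpd_simps[OF H]
  have "p = p'" if "(g, p) \<in> star (hofib F G H h) (x, q)" "(g, p') \<in> star (hofib F G H h) (x, q)" for g p p'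
    by (rule Cmp_cancel_right[OF H, of "fm F g"]) (use that in \<open>auto simp: star_def s\<close>)
  then show "inj_on fst (star (hofib F G H h) (x, q))"
    by (auto simp: inj_on_def)
  show "fst ` star (hofib F G H h) (x, q) = star G x"
  proof
    show "fst ` star (hofib F G H h) (x, q) \<subseteq> star G x" by (auto simp: star_def)
    show "star G x \<subseteq> fst ` star (hofib F G H h) (x, q)"
    proof
      fix g assume g: "g \<in> star G x"
      then have "(g, Cmp H q (inv_arr H (fm F g))) \<in> star (hofib F G H h) (x, q)"
        using x H by (auto simp: star_def s inv_arr_simps Cmp_inv_cancel)
      then show "g \<in> fst ` star (hofib F G H h) (x, q)" by force
    qed
  qed
qed

lemma gfunctor_hofib_forget: "gfunctor hofib_forget (hofib F G H h) G"
  by (rule gfunctorI) (auto simp: hofib_forget_def)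

lemma star_empty: "grpd G \<Longrightarrow> x \<notin> Obj G \<Longrightarrow> star G x = {}"
  by (auto simp: star_def grpd_simps)

lemma finite_star_hofib:
  assumes G: "grpd G" and H: "grpd H" and F: "gfunctor F G H" and fin: "\<And>x. finite (star G x)"
  shows "finite (star (hofib F G H h) y)"
proof (cases "y \<in> Obj (hofib F G H h)")
  case True
  then show ?thesis
    using bij_betw_finite[OF bij_betw_star_hofib[OF G H F], of "fst y" "snd y" h] fin by simp
qed (simp add: star_empty[OF grpd_hofib[OF G H F]])

lemma Obj_hofib_Sigma: "Obj (hofib F G H h) = (SIGMA x:{x \<in> Obj G. (fo F x, h) \<in> isorel H}. hom H (fo F x) h)"
  by (auto simp: hom_def isorel_def)

text \<open>Over each \<open>x\<close> whose image is isomorphic to \<open>h\<close> there are as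
  many objects of the fibre as \<open>h\<close> has automorphisms, each with a star as large as that
  of \<open>x\<close>. The predicate \<open>P\<close> anticipates a second homotopy fibre taken
  inside the first.\<close>

lemma
  assumes G: "grpd G" and H: "grpd H" and F: "gfunctor F G H"
    and finG: "\<And>x. finite (star G x)" and finH: "\<And>x. finite (star H x)"
    and fin: "finite {x \<in> Obj G. (fo F x, h) \<in> isorel H}" and h: "h \<in> Obj H"
  shows finite_Obj_hofib: "finite (Obj (hofib F G H h))"
    and sum_hofib: "(\<Sum>y | y \<in> Obj (hofib F G H h) \<and> P (fst y). 1 / of_nat (card (star (hofib F G H h) y)) :: rat) =
      of_nat (card (aut H h)) *
      (\<Sum>x | x \<in> Obj G \<and> (fo F x, h) \<in> isorel H \<and> P x. 1 / of_nat (card (star G x)))"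
    and hcard_hofib: "hcard (hofib F G H h) = of_nat (card (aut H h)) *
      (\<Sum>x | x \<in> Obj G \<and> (fo F x, h) \<in> isorel H. 1 / of_nat (card (star G x)))"
proof -
  have hh: "(h, h) \<in> isorel H" using equiv_isorel[OF H] h by (meson equivE refl_onD)
  have homs: "card (hom H (fo F x) h) = card (aut H h)" if "(fo F x, h) \<in> isorel H" for x
    unfolding aut_hom by (rule card_hom_isorel[OF H finite_hom[OF finH] that hh])
  show fo: "finite (Obj (hofib F G H h))"
    unfolding Obj_hofib_Sigma by (rule finite_SigmaI) (use fin finite_hom[OF finH] in auto)
  have *: "(\<Sum>y | y \<in> Obj (hofib F G H h) \<and> P (fst y). 1 / of_nat (card (star (hofib F G H h) y)) :: rat) =
      of_nat (card (aut H h)) *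
      (\<Sum>x | x \<in> Obj G \<and> (fo F x, h) \<in> isorel H \<and> P x. 1 / of_nat (card (star G x)))" for P
  proof -
    let ?A = "{x. x \<in> Obj G \<and> (fo F x, h) \<in> isorel H \<and> P x}"
    have finA: "finite ?A" by (rule finite_subset[OF _ fin]) auto
    have "(\<Sum>y | y \<in> Obj (hofib F G H h) \<and> P (fst y). 1 / of_nat (card (star (hofib F G H h) y)) :: rat) =
        (\<Sum>y | y \<in> Obj (hofib F G H h) \<and> P (fst y). 1 / of_nat (card (star G (fst y))))"
      by (rule sum.cong) (use bij_betw_same_card[OF bij_betw_star_hofib[OF G H F]] in auto)
    also have "\<dots> = (\<Sum>y\<in>(SIGMA x:?A. hom H (fo F x) h). 1 / of_nat (card (star G (fst y))))"
      by (rule sum.cong) (auto simp: Obj_hofib_Sigma simp del: hofib_simps)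
    also have "\<dots> = (\<Sum>x\<in>?A. \<Sum>p\<in>hom H (fo F x) h. 1 / of_nat (card (star G x)))"
      by (subst sum.Sigma) (use finA finite_hom[OF finH] in \<open>auto simp: case_prod_unfold\<close>)
    also have "\<dots> = (\<Sum>x\<in>?A. of_nat (card (aut H h)) * (1 / of_nat (card (star G x))))"
      by (rule sum.cong) (use homs in auto)
    finally show ?thesis by (simp only: sum_distrib_left)
  qed
  then show "(\<Sum>y | y \<in> Obj (hofib F G H h) \<and> P (fst y). 1 / of_nat (card (star (hofib F G H h) y)) :: rat) =
      of_nat (card (aut H h)) *
      (\<Sum>x | x \<in> Obj G \<and> (fo F x, h) \<in> isorel H \<and> P x. 1 / of_nat (card (star G x)))" .
  show "hcard (hofib F G H h) = of_nat (card (aut H h)) *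
      (\<Sum>x | x \<in> Obj G \<and> (fo F x, h) \<in> isorel H. 1 / of_nat (card (star G x)))"
    using hcard_eq_sum[OF grpd_hofib[OF G H F] finite_star_hofib[OF G H F finG] fo] *[of "\<lambda>_. True"]
    by simp
qed

lemma star_prod: "star (prod_grpd G H) (x, y) = star G x \<times> star H y"
  by (auto simp: star_def)

lemma aut_prod: "aut (prod_grpd G H) (x, y) = aut G x \<times> aut H y"
  by (auto simp: aut_def)

lemma isorel_prod: "((x, y), (x', y')) \<in> isorel (prod_grpd G H) \<longleftrightarrow> (x, x') \<in> isorel G \<and> (y, y') \<in> isorel H"
  by (auto simp: isorel_def)

text \<open>Turns statements about the arbitrary representative back into membership, so that the
  choice made by \<open>rep\<close> disappears.\<close>

lemma isorel_rep:
  assumes G: "grpd G" and c: "c \<in> pi0 G"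
  shows "(x, rep c) \<in> isorel G \<longleftrightarrow> x \<in> c"
proof
  have eqv: "equiv (Obj G) (isorel G)" by (rule equiv_isorel[OF G])
  show "x \<in> c" if "(x, rep c) \<in> isorel G"
    using in_quotient_imp_closed[OF eqv] c rep_in[OF G c] that eqv
    unfolding pi0_isorel by (meson equivE symD)
  show "(x, rep c) \<in> isorel G" if "x \<in> c"
    using quotient_eq_iff[OF eqv, of c c x "rep c"] c rep_in[OF G c] that by (simp add: pi0_isorel)
qed

text \<open>The outer homotopy fibre, over \<open>(a, b)\<close>, contributes the orders of the
  automorphism groups of \<open>a\<close> and \<open>b\<close>, which cancel the denominators of
  \<open>inc_coeff\<close>; the inner one contributes that of \<open>f\<close>.\<close>

lemma inc_coeff_eq:
  fixes X :: "('a,'f) simp_grpd"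
  assumes G1: "grpd (level X 1)" and G2: "grpd (level X 2)"
    and F: "\<And>i. i \<le> 2 \<Longrightarrow> gfunctor (face X 2 i) (level X 2) (level X 1)"
    and fin1: "\<And>x. finite (star (level X 1) x)" and fin2: "\<And>x. finite (star (level X 2) x)"
    and f: "f \<in> pi0 (level X 1)" and a: "a \<in> pi0 (level X 1)" and b: "b \<in> pi0 (level X 1)"
    and fin: "finite {x \<in> Obj (level X 2). fo (face X 2 1) x \<in> f}"
  shows "inc_coeff X f a b = of_nat (card (aut (level X 1) (rep f))) *
    (\<Sum>x | x \<in> Obj (level X 2) \<and> fo (face X 2 1) x \<in> f \<and> fo (face X 2 2) x \<in> a \<and> fo (face X 2 0) x \<in> b.
       1 / of_nat (card (star (level X 2) x)))"
proof -
  let ?X1 = "level X 1" and ?X2 = "level X 2"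
  let ?E = "hofib (face X 2 1) ?X2 ?X1 (rep f)"
  let ?B = "prod_grpd ?X1 ?X1"
  let ?F = "gf_pair (face X 2 2) (face X 2 0) \<bullet> hofib_forget"
  have F1: "gfunctor (face X 2 1) ?X2 ?X1" by (rule F) simp
  have rep: "rep c \<in> Obj ?X1" "aut ?X1 (rep c) \<noteq> {}" if "c \<in> pi0 ?X1" for c
  proof -
    show r: "rep c \<in> Obj ?X1" using rep_in[OF G1 that] pi0_subset[OF G1 that] by blast
    then have "Idn ?X1 (rep c) \<in> aut ?X1 (rep c)"
      using G1 unfolding aut_def by (auto simp: grpd_Idn grpd_Dom_Idn grpd_Cod_Idn)
    then show "aut ?X1 (rep c) \<noteq> {}" by blast
  qed
  have fin_aut: "finite (aut ?X1 x)" for x unfolding aut_hom by (rule finite_hom[OF fin1])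
  \<comment> \<open>The identity makes the group nonempty; this permits the cancellation of the
    denominators at the end.\<close>
  have pos: "card (aut ?X1 (rep c)) \<noteq> 0" if "c \<in> pi0 ?X1" for c
    using rep(2)[OF that] fin_aut by simp
  have E: "grpd ?E" by (rule grpd_hofib[OF G2 G1 F1])
  have B: "grpd ?B" by (rule grpd_prod[OF G1 G1])
  have FF: "gfunctor ?F ?E ?B"
    by (intro gfunctor_comp[OF gfunctor_pair gfunctor_hofib_forget] F) simp_all
  have fin': "finite {x \<in> Obj ?X2. (fo (face X 2 1) x, rep f) \<in> isorel ?X1}"
    using fin by (simp only: isorel_rep[OF G1 f])
  have finE: "finite (Obj ?E)"
    by (rule finite_Obj_hofib[OF G2 G1 F1 fin2 fin1 fin' rep(1)[OF f]])
  have "hcard (Phi X (rep f) (rep a) (rep b)) = of_nat (card (aut ?B (rep a, rep b))) *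
      (\<Sum>y | y \<in> Obj ?E \<and> (fo ?F y, (rep a, rep b)) \<in> isorel ?B. 1 / of_nat (card (star ?E y)))"
    unfolding Phi_def
  proof (rule hcard_hofib[OF E B FF])
    show "finite (star ?E x)" for x by (rule finite_star_hofib[OF G2 G1 F1 fin2])
    show "finite (star ?B x)" for x using fin1 by (cases x) (simp add: star_prod)
    show "finite {x \<in> Obj ?E. (fo ?F x, (rep a, rep b)) \<in> isorel ?B}" using finE by simp
  qed (use rep a b in simp)
  also have "(\<Sum>y | y \<in> Obj ?E \<and> (fo ?F y, (rep a, rep b)) \<in> isorel ?B. 1 / of_nat (card (star ?E y)) :: rat) =
      (\<Sum>y | y \<in> Obj ?E \<and> fo (face X 2 2) (fst y) \<in> a \<and> fo (face X 2 0) (fst y) \<in> b. 1 / of_nat (card (star ?E y)))"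
    by (simp only: gf_comp_def gf_pair_def hofib_forget_def isorel_prod gfun.simps comp_apply
      isorel_rep[OF G1 a] isorel_rep[OF G1 b])
  also have "\<dots> = of_nat (card (aut ?X1 (rep f))) *
      (\<Sum>x | x \<in> Obj ?X2 \<and> fo (face X 2 1) x \<in> f \<and> fo (face X 2 2) x \<in> a \<and> fo (face X 2 0) x \<in> b.
        1 / of_nat (card (star ?X2 x)))"
    using sum_hofib[OF G2 G1 F1 fin2 fin1 fin' rep(1)[OF f],
      where P = "\<lambda>x. fo (face X 2 2) x \<in> a \<and> fo (face X 2 0) x \<in> b"]
    by (simp only: isorel_rep[OF G1 f])
  finally show ?thesis
    using pos[OF a] pos[OF b] by (simp add: inc_coeff_def aut_prod card_cartesian_product)
qed

section \<open>Symmetric tuples\<close>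

lemma grpd_discrete: "grpd (discrete A)"
  by (rule grpdI) (auto simp: discrete_def)

lemma relabel_simps [simp]:
  "Obj (relabel e d e' d' G) = e ` Obj G" "Arr (relabel e d e' d' G) = e' ` Arr G"
  "Dom (relabel e d e' d' G) f = e (Dom G (d' f))" "Cod (relabel e d e' d' G) f = e (Cod G (d' f))"
  "Idn (relabel e d e' d' G) x = e' (Idn G (d x))"
  "Cmp (relabel e d e' d' G) g f = e' (Cmp G (d' g) (d' f))"
  by (simp_all add: relabel_def)

lemma grpd_relabel:
  assumes G: "grpd G" and d: "\<And>x. d (e x) = x" "\<And>f. d' (e' f) = f"
  shows "grpd (relabel e d e' d' G)"
proof -
  have inj: "e x = e y \<longleftrightarrow> x = y" for x y using d(1) by metis
  show ?thesis
  proof (rule grpdI)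
    fix f assume "f \<in> Arr (relabel e d e' d' G)"
    then obtain a where a: "f = e' a" "a \<in> Arr G" by auto
    show "\<exists>g\<in>Arr (relabel e d e' d' G). Dom (relabel e d e' d' G) g = Cod (relabel e d e' d' G) f \<and>
        Cod (relabel e d e' d' G) g = Dom (relabel e d e' d' G) f \<and>
        Cmp (relabel e d e' d' G) g f = Idn (relabel e d e' d' G) (Dom (relabel e d e' d' G) f) \<and>
        Cmp (relabel e d e' d' G) f g = Idn (relabel e d e' d' G) (Cod (relabel e d e' d' G) f)"
      by (rule bexI[of _ "e' (inv_arr G a)"]) (use a G in \<open>auto simp: d inv_arr_simps\<close>)
  qed (use G in \<open>auto simp: d inj grpd_simps grpd_assoc\<close>)
qed

lemma gfunctor_relabel:
  assumes "\<And>x. d (e x) = x" "\<And>f. d' (e' f) = f"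
  shows "gfunctor \<lparr>fo = e, fm = e'\<rparr> G (relabel e d e' d' G)"
  by (rule gfunctorI) (use assms in auto)

lemma gfunctor_unrelabel:
  assumes "\<And>x. d (e x) = x" "\<And>f. d' (e' f) = f"
  shows "gfunctor \<lparr>fo = d, fm = d'\<rparr> (relabel e d e' d' G) G"
  by (rule gfunctorI) (use assms in auto)

lemma star_relabel:
  assumes "\<And>x. d (e x) = x" "\<And>f. d' (e' f) = f"
  shows "star (relabel e d e' d' G) (e x) = e' ` star G x"
proof -
  have "e x = e y \<longleftrightarrow> x = y" for x y using assms(1) by metis
  then show ?thesis by (auto simp: star_def assms(2))
qed

section \<open>The groupoid of symmetric tuples\<close>

lemma Obj_S_grpd [simp]: "Obj (S_grpd G) = {as. as \<noteq> [] \<and> set as \<subseteq> Obj G}"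
  by (simp add: S_grpd_def)

lemma Idn_S_grpd [simp]: "Idn (S_grpd G) as = zip [0..<length as] (map (Idn G) as)"
  by (simp add: S_grpd_def)

lemma Cod_S_grpd [simp]: "Cod (S_grpd G) ps = map (Cod G \<circ> snd) ps"
  by (simp add: S_grpd_def)

lemma length_Dom_S [simp]: "length (Dom (S_grpd G) ps) = length ps"
  by (simp add: S_grpd_def)

text \<open>Injectivity of the keys suffices: \<open>length ps\<close> distinct keys below
  \<open>length ps\<close> are all of them.\<close>

lemma S_ArrI:
  assumes "ps \<noteq> []" "\<And>i. i < length ps \<Longrightarrow> fst (ps ! i) < length ps"
    and "\<And>i j. i < length ps \<Longrightarrow> j < length ps \<Longrightarrow> fst (ps ! i) = fst (ps ! j) \<Longrightarrow> i = j"
    and "\<And>i. i < length ps \<Longrightarrow> snd (ps ! i) \<in> Arr G"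
  shows "ps \<in> Arr (S_grpd G)"
proof -
  have dist: "distinct (map fst ps)"
    using assms(3) by (auto simp: distinct_conv_nth)
  have "set (map fst ps) \<subseteq> {..<length ps}"
    using assms(2) by (metis (no_types) in_set_conv_nth length_map lessThan_iff nth_map subsetI)
  moreover have "card (set (map fst ps)) = card {..<length ps}"
    using distinct_card[OF dist] by simp
  ultimately have "set (map fst ps) = {..<length ps}"
    by (simp add: card_subset_eq)
  moreover have "set (map snd ps) \<subseteq> Arr G"
    using assms(4) by (metis (no_types) in_set_conv_nth length_map nth_map subsetI)
  ultimately show ?thesis using dist assms(1) by (simp add: S_grpd_def)
qed

lemma
  assumes "ps \<in> Arr (S_grpd G)"
  shows S_Arr_nonempty: "ps \<noteq> []"
    and S_fst_less: "i < length ps \<Longrightarrow> fst (ps ! i) < length ps"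
    and S_fst_inj: "i < length ps \<Longrightarrow> j < length ps \<Longrightarrow> fst (ps ! i) = fst (ps ! j) \<Longrightarrow> i = j"
    and S_fst_surj: "k < length ps \<Longrightarrow> \<exists>i<length ps. fst (ps ! i) = k"
    and S_snd: "i < length ps \<Longrightarrow> snd (ps ! i) \<in> Arr G"
    and S_leaving: "i < length ps \<Longrightarrow> leaving ps (fst (ps ! i)) = snd (ps ! i)"
proof -
  from assms have ps: "ps \<noteq> []" "distinct (map fst ps)" "set (map fst ps) = {..<length ps}"
    "set (map snd ps) \<subseteq> Arr G"
    by (auto simp: S_grpd_def)
  show "ps \<noteq> []" by fact
  show "fst (ps ! i) < length ps" if "i < length ps"
    using ps(3) nth_mem[of i "map fst ps"] that by auto
  show "i = j" if "i < length ps" "j < length ps" "fst (ps ! i) = fst (ps ! j)"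
    using ps(2) that nth_eq_iff_index_eq[of "map fst ps" i j] by simp
  show "\<exists>i<length ps. fst (ps ! i) = k" if "k < length ps"
  proof -
    have "k \<in> set (map fst ps)" using ps(3) that by simp
    then show ?thesis by (metis in_set_conv_nth length_map nth_map)
  qed
  show "snd (ps ! i) \<in> Arr G" if "i < length ps"
    using ps(4) nth_mem[of i "map snd ps"] that by auto
  show "leaving ps (fst (ps ! i)) = snd (ps ! i)" if "i < length ps"
    using ps(2) that unfolding leaving_def
    by (metis map_of_eq_Some_iff nth_mem option.sel prod.collapse)
qed

lemma S_Dom_nth:
  assumes "ps \<in> Arr (S_grpd G)" "i < length ps"
  shows "Dom (S_grpd G) ps ! fst (ps ! i) = Dom G (snd (ps ! i))"
  using S_fst_less[OF assms] S_leaving[OF assms] by (simp add: S_grpd_def)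

text \<open>The domain is compared only at the keys. As these exhaust all positions, the inverse
  permutation need not be written down.\<close>

lemma S_Dom_eqI:
  assumes ps: "ps \<in> Arr (S_grpd G)" and "length xs = length ps"
    and "\<And>i. i < length ps \<Longrightarrow> xs ! fst (ps ! i) = Dom G (snd (ps ! i))"
  shows "Dom (S_grpd G) ps = xs"
proof (rule nth_equalityI)
  fix k assume "k < length (Dom (S_grpd G) ps)"
  then obtain i where "i < length ps" "fst (ps ! i) = k"
    using S_fst_surj[OF ps] by auto
  then show "Dom (S_grpd G) ps ! k = xs ! k"
    using S_Dom_nth[OF ps] assms(3) by fastforce
qed (use assms(2) in simp)

lemma length_Cmp_S [simp]: "length (Cmp (S_grpd G) qs ps) = length qs"
  by (simp add: S_grpd_def)

lemma Cmp_S_nth: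
  "i < length qs \<Longrightarrow> Cmp (S_grpd G) qs ps ! i =
     (fst (ps ! fst (qs ! i)), Cmp G (snd (qs ! i)) (snd (ps ! fst (qs ! i))))"
  by (simp add: S_grpd_def case_prod_unfold)

lemma S_composable:
  assumes "qs \<in> Arr (S_grpd G)" "Cod (S_grpd G) ps = Dom (S_grpd G) qs"
  shows "length ps = length qs"
    and "i < length qs \<Longrightarrow> Cod G (snd (ps ! fst (qs ! i))) = Dom G (snd (qs ! i))"
proof -
  show *: "length ps = length qs" using assms(2) by (metis Cod_S_grpd length_Dom_S length_map)
  show "Cod G (snd (ps ! fst (qs ! i))) = Dom G (snd (qs ! i))" if "i < length qs"
    using S_Dom_nth[OF assms(1) that] S_fst_less[OF assms(1) that] assms(2)[symmetric] * by simp
qed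

lemma grpd_S:
  assumes G: "grpd G"
  shows "grpd (S_grpd G)"
proof (rule grpdI)
  fix ps assume ps: "ps \<in> Arr (S_grpd G)"
  note a = S_Arr_nonempty[OF ps] S_fst_less[OF ps] S_snd[OF ps]
  have D: "Dom (S_grpd G) ps ! k \<in> Obj G" if "k < length ps" for k
    using S_fst_surj[OF ps that] S_Dom_nth[OF ps] a(3) G by (metis grpd_Dom)
  show "Dom (S_grpd G) ps \<in> Obj (S_grpd G)"
    using D a(1) by (auto simp: in_set_conv_nth simp flip: length_greater_0_conv)
  show "Cod (S_grpd G) ps \<in> Obj (S_grpd G)"
    using a(1) grpd_Cod[OF G a(3)] by (auto simp: in_set_conv_nth) (metis snd_conv)
  show "Cmp (S_grpd G) ps (Idn (S_grpd G) (Dom (S_grpd G) ps)) = ps"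
  proof (rule nth_equalityI)
    fix i assume i: "i < length (Cmp (S_grpd G) ps (Idn (S_grpd G) (Dom (S_grpd G) ps)))"
    then have "snd (Cmp (S_grpd G) ps (Idn (S_grpd G) (Dom (S_grpd G) ps)) ! i) = snd (ps ! i)"
      using a S_Dom_nth[OF ps] grpd_Idn_right[OF G] by (simp add: Cmp_S_nth)
    then show "Cmp (S_grpd G) ps (Idn (S_grpd G) (Dom (S_grpd G) ps)) ! i = ps ! i"
      using i a(2) by (simp add: Cmp_S_nth prod_eq_iff)
  qed simp
  show "Cmp (S_grpd G) (Idn (S_grpd G) (Cod (S_grpd G) ps)) ps = ps"
    by (rule nth_equalityI) (use a grpd_Idn_left[OF G] in \<open>simp_all add: Cmp_S_nth prod_eq_iff\<close>)
  \<comment> \<open>The inverse permutation: \<open>ix k\<close> is the entry with key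
    \<open>k\<close>. The inverse arrow has at \<open>k\<close> the inverse of the component that
    leaves \<open>k\<close>.\<close>
  define ix where "ix k = (SOME i. i < length ps \<and> fst (ps ! i) = k)" for k
  have ix: "ix k < length ps \<and> fst (ps ! ix k) = k" if "k < length ps" for k
    unfolding ix_def by (rule someI_ex) (use S_fst_surj[OF ps that] in blast)
  have ix': "ix (fst (ps ! i)) = i" if "i < length ps" for i
    using that ix S_fst_inj[OF ps] a(2) by blast
  define qs where "qs = map (\<lambda>k. (ix k, inv_arr G (leaving ps k))) [0..<length ps]"
  have len: "length qs = length ps" by (simp add: qs_def)
  have leav: "leaving ps k \<in> Arr G" "leaving ps k = snd (ps ! ix k)" if "k < length ps" for k
    using S_leaving[OF ps, of "ix k"] S_snd[OF ps, of "ix k"] ix[OF that] by simp_all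
  have qs: "qs \<in> Arr (S_grpd G)"
  proof (rule S_ArrI)
    fix i j assume *: "i < length qs" "j < length qs" "fst (qs ! i) = fst (qs ! j)"
    then have "ix i = ix j" by (simp add: len) (simp add: qs_def)
    then show "i = j" using ix[of i] ix[of j] *(1,2) unfolding len by metis
  next
    fix i assume "i < length qs"
    then have "i < length ps" by (simp add: len)
    then show "fst (qs ! i) < length qs" "snd (qs ! i) \<in> Arr G"
      using ix[of i] leav(1)[of i] G by (simp_all add: qs_def inv_arr_Arr)
  next
    show "qs \<noteq> []" using a(1) by (simp add: qs_def)
  qed
  show "\<exists>g\<in>Arr (S_grpd G). Dom (S_grpd G) g = Cod (S_grpd G) ps \<and> Cod (S_grpd G) g = Dom (S_grpd G) ps \<and>
      Cmp (S_grpd G) g ps = Idn (S_grpd G) (Dom (S_grpd G) ps) \<and>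
      Cmp (S_grpd G) ps g = Idn (S_grpd G) (Cod (S_grpd G) ps)"
  proof (rule bexI[OF _ qs], intro conjI)
    show "Dom (S_grpd G) qs = Cod (S_grpd G) ps"
      by (rule S_Dom_eqI[OF qs]) (use G ix leav len in \<open>auto simp: qs_def inv_arr_simps\<close>)
    show "Cod (S_grpd G) qs = Dom (S_grpd G) ps"
      by (rule nth_equalityI) (use G leav len in \<open>auto simp: qs_def inv_arr_simps S_grpd_def\<close>)
    show "Cmp (S_grpd G) qs ps = Idn (S_grpd G) (Dom (S_grpd G) ps)"
    proof (rule nth_equalityI)
      fix k assume "k < length (Cmp (S_grpd G) qs ps)"
      then have k: "k < length ps" by (simp add: len)
      have "Cmp G (inv_arr G (leaving ps k)) (snd (ps ! ix k)) = Idn G (Dom (S_grpd G) ps ! k)"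
        using leav[OF k] ix[OF k] S_Dom_nth[OF ps, of "ix k"] G by (simp add: inv_arr_simps)
      then show "Cmp (S_grpd G) qs ps ! k = Idn (S_grpd G) (Dom (S_grpd G) ps) ! k"
        using k ix[OF k] by (simp add: Cmp_S_nth len) (simp add: qs_def)
    qed (simp add: len)
    show "Cmp (S_grpd G) ps qs = Idn (S_grpd G) (Cod (S_grpd G) ps)"
    proof (rule nth_equalityI)
      fix i assume "i < length (Cmp (S_grpd G) ps qs)"
      then have i: "i < length ps" by simp
      show "Cmp (S_grpd G) ps qs ! i = Idn (S_grpd G) (Cod (S_grpd G) ps) ! i"
        using i a(2)[OF i] S_leaving[OF ps i] ix'[OF i] a(3)[OF i] G
        by (simp add: Cmp_S_nth) (simp add: qs_def inv_arr_simps)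
    qed simp
  qed
next
  fix as assume as: "as \<in> Obj (S_grpd G)"
  then have as': "as ! i \<in> Obj G" if "i < length as" for i using that by (auto simp: subset_iff)
  show *: "Idn (S_grpd G) as \<in> Arr (S_grpd G)"
    by (rule S_ArrI) (use as as' G in \<open>auto simp: grpd_simps\<close>)
  show "Dom (S_grpd G) (Idn (S_grpd G) as) = as"
    by (rule S_Dom_eqI[OF *]) (use as' G in \<open>auto simp: grpd_simps\<close>)
  show "Cod (S_grpd G) (Idn (S_grpd G) as) = as"
    by (rule nth_equalityI) (use as' G in \<open>auto simp: grpd_simps\<close>)
next
  fix ps qs assume ps: "ps \<in> Arr (S_grpd G)" and qs: "qs \<in> Arr (S_grpd G)"
    and pq: "Cod (S_grpd G) ps = Dom (S_grpd G) qs"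
  note c = S_composable[OF qs pq]
  note a = S_fst_less[OF ps] S_snd[OF ps] S_fst_less[OF qs] S_snd[OF qs]
  show *: "Cmp (S_grpd G) qs ps \<in> Arr (S_grpd G)"
  proof (rule S_ArrI)
    show "Cmp (S_grpd G) qs ps \<noteq> []"
      using S_Arr_nonempty[OF qs] by (metis length_Cmp_S length_0_conv)
    fix i assume i: "i < length (Cmp (S_grpd G) qs ps)"
    then show "fst (Cmp (S_grpd G) qs ps ! i) < length (Cmp (S_grpd G) qs ps)"
      "snd (Cmp (S_grpd G) qs ps ! i) \<in> Arr G"
      using a c G by (simp_all add: Cmp_S_nth grpd_simps)
    fix j assume j: "j < length (Cmp (S_grpd G) qs ps)"
      and eq: "fst (Cmp (S_grpd G) qs ps ! i) = fst (Cmp (S_grpd G) qs ps ! j)"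
    then have "fst (qs ! i) = fst (qs ! j)"
      using i a(3) c(1) S_fst_inj[OF ps, of "fst (qs ! i)" "fst (qs ! j)"] by (simp add: Cmp_S_nth)
    then show "i = j" using i j S_fst_inj[OF qs] by simp
  qed
  show "Dom (S_grpd G) (Cmp (S_grpd G) qs ps) = Dom (S_grpd G) ps"
    by (rule S_Dom_eqI[OF *]) (use a c G S_Dom_nth[OF ps] in \<open>auto simp: Cmp_S_nth grpd_simps\<close>)
  show "Cod (S_grpd G) (Cmp (S_grpd G) qs ps) = Cod (S_grpd G) qs"
    by (rule nth_equalityI) (use a c G in \<open>auto simp: Cmp_S_nth grpd_simps\<close>)
  fix rs assume rs: "rs \<in> Arr (S_grpd G)" and qr: "Cod (S_grpd G) qs = Dom (S_grpd G) rs"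
  note c' = S_composable[OF rs qr]
  show "Cmp (S_grpd G) rs (Cmp (S_grpd G) qs ps) = Cmp (S_grpd G) (Cmp (S_grpd G) rs qs) ps"
    by (rule nth_equalityI)
      (use a c c' G S_fst_less[OF rs] S_snd[OF rs] in \<open>auto simp: Cmp_S_nth grpd_assoc\<close>)
qed

lemma S_map_simps [simp]:
  "fo (S_map F) = map (fo F)" "fm (S_map F) = map (map_prod id (fm F))"
  by (simp_all add: S_map_def)

lemma gfunctor_S_map:
  assumes F: "gfunctor F G H"
  shows "gfunctor (S_map F) (S_grpd G) (S_grpd H)"
proof (rule gfunctorI)
  show "fo (S_map F) as \<in> Obj (S_grpd H)" if "as \<in> Obj (S_grpd G)" for as
    using that F by (auto simp: gfunctor_Obj subset_iff)
next
  fix ps assume ps: "ps \<in> Arr (S_grpd G)"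
  note a = S_Arr_nonempty[OF ps] S_fst_less[OF ps] S_snd[OF ps]
  show *: "fm (S_map F) ps \<in> Arr (S_grpd H)"
  proof (rule S_ArrI)
    fix i j assume "i < length (fm (S_map F) ps)" "j < length (fm (S_map F) ps)"
      "fst (fm (S_map F) ps ! i) = fst (fm (S_map F) ps ! j)"
    then show "i = j" using S_fst_inj[OF ps, of i j] by simp
  qed (use a F in \<open>auto simp: gfunctor_simps\<close>)
  show "Dom (S_grpd H) (fm (S_map F) ps) = fo (S_map F) (Dom (S_grpd G) ps)"
    by (rule S_Dom_eqI[OF *]) (use a F S_Dom_nth[OF ps] in \<open>auto simp: gfunctor_simps\<close>)
  show "Cod (S_grpd H) (fm (S_map F) ps) = fo (S_map F) (Cod (S_grpd G) ps)"
    by (rule nth_equalityI) (use a F in \<open>auto simp: gfunctor_simps\<close>)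
  fix qs assume qs: "qs \<in> Arr (S_grpd G)" and pq: "Cod (S_grpd G) ps = Dom (S_grpd G) qs"
  show "fm (S_map F) (Cmp (S_grpd G) qs ps) = Cmp (S_grpd H) (fm (S_map F) qs) (fm (S_map F) ps)"
    by (rule nth_equalityI)
      (use a F S_composable[OF qs pq] S_fst_less[OF qs] S_snd[OF qs] in \<open>auto simp: Cmp_S_nth gfunctor_simps\<close>)
qed

section \<open>Flattening as a block permutation\<close>

definition offs :: "'a list list \<Rightarrow> nat \<Rightarrow> nat"
  where "offs xss k = (\<Sum>l<k. length (xss ! l))"

lemma offs_0 [simp]: "offs xss 0 = 0"
  by (simp add: offs_def)

lemma offs_Cons_Suc [simp]: "offs (xs # xss) (Suc k) = length xs + offs xss k"
  by (simp add: offs_def sum.lessThan_Suc_shift del: sum.lessThan_Suc)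

lemma
  assumes "k < length xss" "j < length (xss ! k)"
  shows offs_less: "offs xss k + j < length (concat xss)"
    and concat_nth: "concat xss ! (offs xss k + j) = xss ! k ! j"
  using assms
proof (induction xss arbitrary: k)
  case (Cons xs xss)
  { case 1 with Cons show ?case by (cases k) auto }
  { case 2 with Cons show ?case by (cases k) (auto simp: nth_append add.assoc) }
qed simp_all

lemma offs_surj:
  assumes "i < length (concat xss)"
  obtains k j where "k < length xss" "j < length (xss ! k)" "i = offs xss k + j"
  using assms
proof (induction xss arbitrary: i thesis)
  case (Cons xs xss)
  show ?case
  proof (cases "i < length xs")
    case True
    then show ?thesis using Cons.prems(1)[of 0 i] by simp
  next
    case False
    with Cons.prems(2) have "i - length xs < length (concat xss)" by simp
    then obtain k j where "k < length xss" "j < length (xss ! k)" "i - length xs = offs xss k + j"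
      using Cons.IH by blast
    then show ?thesis using Cons.prems(1)[of "Suc k" j] False by simp
  qed
qed simp

text \<open>A position determines its block and its place there, so the injectivity of a block
  permutation can be checked blockwise.\<close>

lemma offs_inj:
  assumes "k < length xss" "j < length (xss ! k)" "k' < length xss" "j' < length (xss ! k')"
    and "offs xss k + j = offs xss k' + j'"
  shows "k = k' \<and> j = j'"
  using assms
proof (induction xss arbitrary: k k')
  case (Cons xs xss)
  then show ?case by (cases k; cases k') (auto simp: add.assoc)
qed simp

lemma S_mu_simps [simp]: "fo S_mu = concat"
  by (simp add: S_mu_def)

text \<open>\<open>S_mu\<close> computes its offsets from the components of the arrow. A component
  is as long as its domain, so these are the offsets of the blocks of \<open>Dom\<close>.\<close>

lemma S_mu_nth:
  assumes pss: "pss \<in> Arr (S_grpd (S_grpd G))"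
  shows length_S_mu: "length (fm S_mu pss) = length (concat (map snd pss))"
    and "i < length pss \<Longrightarrow> j < length (snd (pss ! i)) \<Longrightarrow>
      fm S_mu pss ! (offs (map snd pss) i + j) =
      (offs (Dom (S_grpd (S_grpd G)) pss) (fst (pss ! i)) + fst (snd (pss ! i) ! j), snd (snd (pss ! i) ! j))"
proof -
  define yss where
    "yss = map (\<lambda>(k, ps). map (\<lambda>(j, f). ((\<Sum>l<k. length (leaving pss l)) + j, f)) ps) pss"
  have mu: "fm S_mu pss = concat yss" by (simp add: S_mu_def yss_def)
  show "length (fm S_mu pss) = length (concat (map snd pss))"
    by (simp add: mu length_concat yss_def comp_def case_prod_unfold)
  show "fm S_mu pss ! (offs (map snd pss) i + j) =
      (offs (Dom (S_grpd (S_grpd G)) pss) (fst (pss ! i)) + fst (snd (pss ! i) ! j), snd (snd (pss ! i) ! j))"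
    if ij: "i < length pss" "j < length (snd (pss ! i))"
  proof -
    have "offs (map snd pss) i = offs yss i"
      using ij by (simp add: offs_def yss_def case_prod_unfold)
    then have "fm S_mu pss ! (offs (map snd pss) i + j) = yss ! i ! j"
      using ij by (simp add: mu) (rule concat_nth, simp_all add: yss_def case_prod_unfold)
    also have "\<dots> = ((\<Sum>l<fst (pss ! i). length (leaving pss l)) + fst (snd (pss ! i) ! j), snd (snd (pss ! i) ! j))"
      using ij by (simp add: yss_def case_prod_unfold)
    also have "(\<Sum>l<fst (pss ! i). length (leaving pss l)) = offs (Dom (S_grpd (S_grpd G)) pss) (fst (pss ! i))"
      unfolding offs_def
    proof (rule sum.cong)
      fix l assume "l \<in> {..<fst (pss ! i)}"
      then have "l < length pss" using S_fst_less[OF pss ij(1)] by simp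
      then obtain m where "m < length pss" "fst (pss ! m) = l" using S_fst_surj[OF pss] by blast
      then show "length (leaving pss l) = length (Dom (S_grpd (S_grpd G)) pss ! l)"
        using S_leaving[OF pss, of m] S_Dom_nth[OF pss, of m] by simp
    qed simp
    finally show ?thesis .
  qed
qed

text \<open>Entries are addressed through the blocks of the codomain and their keys through the
  blocks of the domain, so two families of offsets occur throughout.\<close>

lemma gfunctor_S_mu:
  fixes G :: "('a,'f) grpd"
  assumes G: "grpd G"
  shows "gfunctor S_mu (S_grpd (S_grpd G)) (S_grpd G)"
proof (rule gfunctorI)
  show "fo S_mu as \<in> Obj (S_grpd G)" if "as \<in> Obj (S_grpd (S_grpd G))" for as
    using that by (cases as) auto
next
  fix pss assume pss: "pss \<in> Arr (S_grpd (S_grpd G))"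
  let ?S = "S_mu :: ('a list list, 'f smor smor, 'a list, 'f smor) gfun"
  let ?D = "Dom (S_grpd (S_grpd G)) pss"
  let ?C = "map snd pss"
  let ?m = "fm ?S pss"
  note a = S_Arr_nonempty[OF pss] S_fst_less[OF pss] S_snd[OF pss]
  have mu: "?m ! (offs ?C i + j) = (offs ?D (fst (pss ! i)) + fst (snd (pss ! i) ! j), snd (snd (pss ! i) ! j))"
    if "i < length pss" "j < length (snd (pss ! i))" for i j
    using that by (rule S_mu_nth(2)[OF pss])
  note D = S_Dom_nth[OF pss]
  have lenD: "length (?D ! fst (pss ! i)) = length (snd (pss ! i))" if "i < length pss" for i
    using D[OF that] by simp
  have lenC: "length ?m = length (concat ?C)" by (rule length_S_mu[OF pss])
  \<comment> \<open>The blocks are only permuted, so both flattened lists have the same length; this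
    keeps the keys in range.\<close>
  have "bij_betw (\<lambda>i. fst (pss ! i)) {..<length pss} {..<length pss}"
    using a(2) S_fst_inj[OF pss] S_fst_surj[OF pss] unfolding bij_betw_def inj_on_def by (auto simp: image_iff Bex_def) metis
  then have "(\<Sum>i<length pss. length (?D ! i)) = (\<Sum>i<length pss. length (?D ! fst (pss ! i)))"
    by (rule sum.reindex_bij_betw[symmetric])
  also have "\<dots> = (\<Sum>i<length pss. length (?C ! i))"
    by (rule sum.cong) (auto simp: lenD)
  finally have len: "length (concat ?D) = length (concat ?C)"
    by (simp add: length_concat sum_list_sum_nth atLeast0LessThan)
  have inner: "snd (snd (pss ! i) ! j) \<in> Arr G" "fst (snd (pss ! i) ! j) < length (snd (pss ! i))"
    if "i < length pss" "j < length (snd (pss ! i))" for i j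
    using S_snd[OF a(3)[OF that(1)] that(2)] S_fst_less[OF a(3)[OF that(1)] that(2)] by auto
  have split: thesis if "x < length ?m"
    "\<And>i j. i < length pss \<Longrightarrow> j < length (snd (pss ! i)) \<Longrightarrow> x = offs ?C i + j \<Longrightarrow> thesis" for x thesis
    using that lenC offs_surj[of x ?C] by (metis length_map nth_map)
  show *: "?m \<in> Arr (S_grpd G)"
  proof (rule S_ArrI)
    have "snd (pss ! 0) \<noteq> []" using S_Arr_nonempty[OF a(3)[of 0]] a(1) by simp
    moreover have "snd (pss ! 0) \<in> set ?C" using a(1) by simp
    ultimately have "concat ?C \<noteq> []" by (metis concat_eq_Nil_conv)
    then show "?m \<noteq> []" using lenC by (metis length_0_conv)
  next
    fix x assume "x < length ?m"
    then obtain i j where ij: "i < length pss" "j < length (snd (pss ! i))" "x = offs ?C i + j"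
      by (rule split)
    have "offs ?D (fst (pss ! i)) + fst (snd (pss ! i) ! j) < length (concat ?D)"
      by (rule offs_less) (use ij a inner lenD in auto)
    then show "fst (?m ! x) < length ?m" using ij mu len lenC by simp
    show "snd (?m ! x) \<in> Arr G" using ij mu inner by simp
    fix y assume y: "y < length ?m" and eq: "fst (?m ! x) = fst (?m ! y)"
    from y obtain k l where kl: "k < length pss" "l < length (snd (pss ! k))" "y = offs ?C k + l"
      by (rule split)
    have "fst (pss ! i) = fst (pss ! k) \<and> fst (snd (pss ! i) ! j) = fst (snd (pss ! k) ! l)"
      by (rule offs_inj[of _ ?D]) (use ij kl a inner lenD eq mu in auto)
    then show "x = y" using ij kl S_fst_inj[OF pss] S_fst_inj[OF a(3)] by metis
  qed
  show "Dom (S_grpd G) ?m = fo ?S ?D"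
  proof (rule S_Dom_eqI[OF *])
    fix x assume "x < length ?m"
    then obtain i j where ij: "i < length pss" "j < length (snd (pss ! i))" "x = offs ?C i + j"
      by (rule split)
    have "concat ?D ! (offs ?D (fst (pss ! i)) + fst (snd (pss ! i) ! j)) = ?D ! fst (pss ! i) ! fst (snd (pss ! i) ! j)"
      by (rule concat_nth) (use ij a inner lenD in auto)
    then show "fo ?S ?D ! fst (?m ! x) = Dom G (snd (?m ! x))"
      using ij mu D S_Dom_nth[OF a(3)[OF ij(1)] ij(2)] by simp
  qed (use len lenC in simp)
  show "Cod (S_grpd G) ?m = fo ?S (Cod (S_grpd (S_grpd G)) pss)"
  proof (rule nth_equalityI)
    show "length (Cod (S_grpd G) ?m) = length (fo ?S (Cod (S_grpd (S_grpd G)) pss))"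
      using lenC by (simp add: length_concat comp_def)
    fix x assume "x < length (Cod (S_grpd G) ?m)"
    then have x: "x < length ?m" by simp
    then obtain i j where ij: "i < length pss" "j < length (snd (pss ! i))" "x = offs ?C i + j"
      by (rule split)
    have "offs ?C i = offs (Cod (S_grpd (S_grpd G)) pss) i"
      using ij by (simp add: offs_def)
    then have "fo ?S (Cod (S_grpd (S_grpd G)) pss) ! x = Cod (S_grpd (S_grpd G)) pss ! i ! j"
      using ij by (simp del: Cod_S_grpd) (rule concat_nth, auto)
    then show "Cod (S_grpd G) ?m ! x = fo ?S (Cod (S_grpd (S_grpd G)) pss) ! x"
      using ij mu x by simp
  qed
  fix qss assume qss: "qss \<in> Arr (S_grpd (S_grpd G))"
    and pq: "Cod (S_grpd (S_grpd G)) pss = Dom (S_grpd (S_grpd G)) qss"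
  note c = S_composable[OF qss pq]
  note b = S_fst_less[OF qss] S_snd[OF qss]
  let ?K = "Cmp (S_grpd (S_grpd G)) qss pss"
  have K: "?K \<in> Arr (S_grpd (S_grpd G))"
    by (rule grpd_Cmp[OF grpd_S[OF grpd_S[OF G]] pss qss pq])
  have DK: "Dom (S_grpd (S_grpd G)) ?K = ?D"
    by (rule grpd_Dom_Cmp[OF grpd_S[OF grpd_S[OF G]] pss qss pq])
  have lK: "length (snd (?K ! i)) = length (snd (qss ! i))" if "i < length qss" for i
    using that by (simp add: Cmp_S_nth)
  have oK: "offs (map snd ?K) i = offs (map snd qss) i" if "i < length qss" for i
    using that lK by (simp add: offs_def)
  \<comment> \<open>The codomain blocks of \<open>pss\<close> are the domain blocks of
    \<open>qss\<close>, so a key produced by the second arrow is a position of the first.\<close>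
  have oC: "offs ?C i = offs (Dom (S_grpd (S_grpd G)) qss) i" if "i < length qss" for i
    using that c(1) unfolding pq[symmetric] by (simp add: offs_def)
  show "fm ?S ?K = Cmp (S_grpd G) (fm ?S qss) ?m"
  proof (rule nth_equalityI)
    show "length (fm ?S ?K) = length (Cmp (S_grpd G) (fm ?S qss) ?m)"
      using lK by (simp add: length_S_mu[OF K] length_S_mu[OF qss] length_concat sum_list_sum_nth atLeast0LessThan)
    fix x assume "x < length (fm ?S ?K)"
    then have x: "x < length (concat (map snd ?K))" "x < length (fm ?S qss)"
      using \<open>length (fm ?S ?K) = _\<close> by (simp_all add: length_S_mu[OF K])
    obtain i j where "i < length (map snd ?K)" "j < length (map snd ?K ! i)" "x = offs (map snd ?K) i + j"
      using x(1) by (rule offs_surj)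
    then have ij: "i < length qss" "j < length (snd (qss ! i))" "x = offs (map snd qss) i + j"
      "x = offs (map snd ?K) i + j" "j < length (snd (?K ! i))" "i < length ?K"
      by (simp_all add: lK oK)
    let ?k = "fst (qss ! i)" and ?l = "fst (snd (qss ! i) ! j)"
    have len_kl: "length (snd (pss ! ?k)) = length (snd (qss ! i))"
      using c(2)[OF ij(1)] by (metis Cod_S_grpd length_Dom_S length_map)
    have kl: "?k < length pss" "?l < length (snd (pss ! ?k))" "?k < length qss"
      using b ij c S_fst_less[OF b(2)] len_kl by auto
    have "fm ?S ?K ! x = (offs ?D (fst (?K ! i)) + fst (snd (?K ! i) ! j), snd (snd (?K ! i) ! j))"
      unfolding ij(4) DK[symmetric] by (rule S_mu_nth(2)[OF K ij(6,5)])
    also have "\<dots> = Cmp (S_grpd G) (fm ?S qss) ?m ! x"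
      using mu[OF kl(1,2)] x(2) ij(1-3)
      by (simp add: Cmp_S_nth S_mu_nth(2)[OF qss ij(1,2)] oC[OF kl(3), symmetric])
    finally show "fm ?S ?K ! x = Cmp (S_grpd G) (fm ?S qss) ?m ! x" .
  qed
qed

section \<open>Counting and classifying arrows of tuples\<close>

lemma
  assumes "\<And>A. A \<in> set As \<Longrightarrow> finite A"
  shows finite_listset: "finite (listset As)"
    and card_listset: "card (listset As) = (\<Prod>A\<leftarrow>As. card A)"
proof -
  have set_Cons_eq: "set_Cons A B = (\<lambda>(x, xs). x # xs) ` (A \<times> B)" for A :: "'a set" and B
    by (auto simp: set_Cons_def)
  have inj: "inj_on (\<lambda>(x, xs). x # xs) C" for C :: "('a \<times> 'a list) set"
    by (auto simp: inj_on_def)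
  have "finite (listset As) \<and> card (listset As) = (\<Prod>A\<leftarrow>As. card A)"
    using assms by (induction As) (simp_all add: set_Cons_eq card_image[OF inj] card_cartesian_product)
  then show "finite (listset As)" "card (listset As) = (\<Prod>A\<leftarrow>As. card A)" by simp_all
qed

lemma in_listset_iff: "xs \<in> listset As \<longleftrightarrow> length xs = length As \<and> (\<forall>i<length As. xs ! i \<in> As ! i)"
proof (induction As arbitrary: xs)
  case (Cons A As)
  show ?case
    by (cases xs) (auto simp: set_Cons_def Cons.IH All_less_Suc2)
qed simp

text \<open>An arrow out of a tuple is a permutation together with one arrow out of each entry. The
  latter are listed by their position in the domain, via \<open>leaving\<close>, so that the second
  factor does not depend on the permutation.\<close>

lemma bij_betw_star_S:
  fixes G :: "('a,'f) grpd"
  assumes as: "as \<noteq> []"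
  shows "bij_betw (\<lambda>ps. (map fst ps, map (leaving ps) [0..<length as])) (star (S_grpd G) as)
    (permutations_of_set {..<length as} \<times> listset (map (star G) as))"
proof (rule bij_betw_byWitness[where f' = "\<lambda>(s, fs). map (\<lambda>k. (k, fs ! k)) s"])
  let ?n = "length as"
  have star: "ps \<in> Arr (S_grpd G)" "length ps = ?n" "Dom (S_grpd G) ps = as" if "ps \<in> star (S_grpd G) as" for ps
    using that length_Dom_S[of G ps] by (auto simp: star_def simp del: length_Dom_S)
  show "\<forall>ps\<in>star (S_grpd G) as. (case (map fst ps, map (leaving ps) [0..<?n]) of (s, fs) \<Rightarrow>
      map (\<lambda>k. (k, fs ! k)) s) = ps"
  proof
    fix ps assume ps: "ps \<in> star (S_grpd G) as"
    show "(case (map fst ps, map (leaving ps) [0..<?n]) of (s, fs) \<Rightarrow> map (\<lambda>k. (k, fs ! k)) s) = ps"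
      by (rule nth_equalityI)
        (use S_fst_less[OF star(1)[OF ps]] S_leaving[OF star(1)[OF ps]] star(2)[OF ps] in \<open>auto simp: prod_eq_iff\<close>)
  qed
  show "(\<lambda>ps. (map fst ps, map (leaving ps) [0..<?n])) ` star (S_grpd G) as
      \<subseteq> permutations_of_set {..<?n} \<times> listset (map (star G) as)"
  proof (rule image_subsetI, rule SigmaI)
    fix ps assume ps: "ps \<in> star (S_grpd G) as"
    note s = star[OF ps]
    from s(1,2) show "map fst ps \<in> permutations_of_set {..<?n}"
      by (simp add: permutations_of_set_def S_grpd_def)
    have "leaving ps k \<in> star G (as ! k)" if k: "k < ?n" for k
    proof -
      obtain i where i: "i < length ps" "fst (ps ! i) = k"
        using S_fst_surj[OF s(1), of k] k s(2) by auto
      then show ?thesis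
        using S_leaving[OF s(1) i(1)] S_snd[OF s(1) i(1)] S_Dom_nth[OF s(1) i(1)] s(3) by (simp add: star_def)
    qed
    then show "map (leaving ps) [0..<?n] \<in> listset (map (star G) as)"
      by (simp add: in_listset_iff)
  qed
  have leav: "leaving (map (\<lambda>k. (k, fs ! k)) s) k = fs ! k" if "k \<in> set s" for fs :: "'f list" and s k
    using that by (simp add: leaving_def map_of_map_restrict)
  have inv: "map (\<lambda>k. (k, fs ! k)) s \<in> star (S_grpd G) as"
    "map (leaving (map (\<lambda>k. (k, fs ! k)) s)) [0..<?n] = fs"
    if "s \<in> permutations_of_set {..<?n}" "fs \<in> listset (map (star G) as)" for s fs
  proof -
    from that have s: "distinct s" "set s = {..<?n}" and fs: "length fs = ?n" "\<And>i. i < ?n \<Longrightarrow> fs ! i \<in> star G (as ! i)"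
      by (auto simp: permutations_of_set_def in_listset_iff)
    have len: "length s = ?n" using distinct_card[OF s(1)] s(2) by simp
    have si: "s ! i < ?n" if "i < ?n" for i using nth_mem[of i s] s(2) len that by simp
    have A: "map (\<lambda>k. (k, fs ! k)) s \<in> Arr (S_grpd G)"
    proof (rule S_ArrI)
      show "map (\<lambda>k. (k, fs ! k)) s \<noteq> []" using len as by auto
    qed (use len s(1) si fs in \<open>auto simp: nth_eq_iff_index_eq star_def\<close>)
    have "Dom (S_grpd G) (map (\<lambda>k. (k, fs ! k)) s) = as"
      by (rule S_Dom_eqI[OF A]) (use len si fs in \<open>auto simp: star_def\<close>)
    with A show "map (\<lambda>k. (k, fs ! k)) s \<in> star (S_grpd G) as" by (simp add: star_def)
    show "map (leaving (map (\<lambda>k. (k, fs ! k)) s)) [0..<?n] = fs"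
      by (rule nth_equalityI) (use fs s(2) leav in auto)
  qed
  show "\<forall>x\<in>permutations_of_set {..<?n} \<times> listset (map (star G) as).
      (\<lambda>ps. (map fst ps, map (leaving ps) [0..<?n])) (case x of (s, fs) \<Rightarrow> map (\<lambda>k. (k, fs ! k)) s) = x"
    using inv(2) by (auto simp: comp_def)
  show "(\<lambda>(s, fs). map (\<lambda>k. (k, fs ! k)) s) ` (permutations_of_set {..<?n} \<times> listset (map (star G) as))
      \<subseteq> star (S_grpd G) as"
    using inv(1) by auto
qed

lemma
  assumes "\<And>a. a \<in> set as \<Longrightarrow> finite (star G a)"
  shows finite_star_S: "finite (star (S_grpd G) as)"
    and card_star_S: "as \<noteq> [] \<Longrightarrow> card (star (S_grpd G) as) = fact (length as) * (\<Prod>a\<leftarrow>as. card (star G a))"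
proof -
  have fin: "\<And>A. A \<in> set (map (star G) as) \<Longrightarrow> finite A" using assms by auto
  show "card (star (S_grpd G) as) = fact (length as) * (\<Prod>a\<leftarrow>as. card (star G a))" if "as \<noteq> []"
    using bij_betw_same_card[OF bij_betw_star_S[OF that, of G]] card_listset[of "map (star G) as", OF fin]
    by (simp add: card_cartesian_product comp_def)
  show "finite (star (S_grpd G) as)"
  proof (cases "as = []")
    case True
    then have "star (S_grpd G) as = {}" by (auto simp: star_def S_grpd_def)
    then show ?thesis by simp
  next
    case False
    then show ?thesis
      using bij_betw_finite[OF bij_betw_star_S[OF False, of G]] finite_listset[of "map (star G) as", OF fin] by simp
  qed
qed

lemma star_discrete: "x \<in> A \<Longrightarrow> star (discrete A) x = {x}"
  by (auto simp: star_def discrete_def)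

text \<open>\<open>cs\<close> is the domain rearranged by the permutation of an arrow, after which
  the components act entry by entry.\<close>

lemma isorel_S:
  assumes G: "grpd G"
  shows "(as, bs) \<in> isorel (S_grpd G) \<longleftrightarrow>
    as \<noteq> [] \<and> (\<exists>cs. mset cs = mset as \<and> list_all2 (\<lambda>a b. (a, b) \<in> isorel G) cs bs)"
proof
  assume "(as, bs) \<in> isorel (S_grpd G)"
  then obtain ps where ps: "ps \<in> Arr (S_grpd G)" "Dom (S_grpd G) ps = as" "Cod (S_grpd G) ps = bs"
    by (auto simp: isorel_def)
  let ?cs = "map (Dom G \<circ> snd) ps"
  have len: "length ps = length as" using ps(2) by auto
  have "mset (map fst ps) = mset [0..<length ps]"
    using ps(1) by (intro set_eq_iff_mset_eq_distinct[THEN iffD1]) (auto simp: S_grpd_def atLeast0LessThan)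
  then have "mset (map (nth as) (map fst ps)) = mset (map (nth as) [0..<length ps])"
    by (metis mset_map)
  also have "map (nth as) [0..<length ps] = as" by (simp add: len map_nth)
  also have "map (nth as) (map fst ps) = ?cs"
    by (rule nth_equalityI) (use S_Dom_nth[OF ps(1)] ps(2) in auto)
  finally have "mset ?cs = mset as" .
  moreover have "list_all2 (\<lambda>a b. (a, b) \<in> isorel G) ?cs bs"
    using ps(3) S_snd[OF ps(1)] by (auto simp: list_all2_conv_all_nth isorel_def)
  moreover have "as \<noteq> []" using S_Arr_nonempty[OF ps(1)] len by auto
  ultimately show "as \<noteq> [] \<and> (\<exists>cs. mset cs = mset as \<and> list_all2 (\<lambda>a b. (a, b) \<in> isorel G) cs bs)" by blast
next
  assume "as \<noteq> [] \<and> (\<exists>cs. mset cs = mset as \<and> list_all2 (\<lambda>a b. (a, b) \<in> isorel G) cs bs)"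
  then obtain cs where cs: "as \<noteq> []" "mset cs = mset as" "list_all2 (\<lambda>a b. (a, b) \<in> isorel G) cs bs" by blast
  obtain p where p: "p permutes {..<length as}" "permute_list p as = cs"
    using mset_eq_permutation[OF cs(2)] by metis
  have len: "length cs = length as" "length bs = length as"
    using mset_eq_length[OF cs(2)] list_all2_lengthD[OF cs(3)] by simp_all
  have "\<forall>i<length as. \<exists>f. f \<in> Arr G \<and> Dom G f = cs ! i \<and> Cod G f = bs ! i"
    using cs(3) len by (auto simp: list_all2_conv_all_nth isorel_def)
  then obtain f where f: "\<And>i. i < length as \<Longrightarrow> f i \<in> Arr G \<and> Dom G (f i) = cs ! i \<and> Cod G (f i) = bs ! i"
    by metis
  have pl: "p i < length as" if "i < length as" for i
    using permutes_in_image[OF p(1), of i] that by simp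
  define ps where "ps = map (\<lambda>i. (p i, f i)) [0..<length as]"
  have ps: "ps \<in> Arr (S_grpd G)"
  proof (rule S_ArrI)
    fix i j assume "i < length ps" "j < length ps" "fst (ps ! i) = fst (ps ! j)"
    then show "i = j" using permutes_inj[OF p(1)] by (simp add: ps_def inj_eq)
  qed (use f pl cs(1) in \<open>auto simp: ps_def\<close>)
  have "Dom (S_grpd G) ps = as"
    by (rule S_Dom_eqI[OF ps]) (use f p in \<open>auto simp: ps_def permute_list_nth\<close>)
  moreover have "Cod (S_grpd G) ps = bs"
    by (rule nth_equalityI) (use f len in \<open>auto simp: ps_def\<close>)
  ultimately show "(as, bs) \<in> isorel (S_grpd G)" using ps by (auto simp: isorel_def)
qed

section \<open>The bar construction of the symmetric operad of Ass\<close>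

text \<open>The multiset of the values of \<open>v\<close> on a list, as an exponent vector.\<close>

definition cont :: "('a \<Rightarrow> 'k) \<Rightarrow> 'a list \<Rightarrow> ('k \<Rightarrow>\<^sub>0 nat)"
  where "cont v as = (\<Sum>a\<leftarrow>as. Poly_Mapping.single (v a) 1)"

lemma cont_simps [simp]:
  "cont v [] = 0" "cont v (a # as) = Poly_Mapping.single (v a) 1 + cont v as"
  "cont v (as @ bs) = cont v as + cont v bs"
  by (simp_all add: cont_def)

lemma lookup_cont: "Poly_Mapping.lookup (cont v as) k = count (mset (map v as)) k"
  by (induction as) (auto simp: lookup_add lookup_single)

lemma cont_eq_iff: "cont v as = cont w bs \<longleftrightarrow> mset (map v as) = mset (map w bs)"
  by (simp add: poly_mapping_eq_iff fun_eq_iff lookup_cont multiset_eq_iff)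

lemma keys_cont: "Poly_Mapping.keys (cont v as) = v ` set as"
  by (auto simp: in_keys_iff lookup_cont count_eq_zero_iff simp flip: mset_map)

text \<open>Used twice: \<open>length\<close> classifies the objects of \<open>Posn\<close>, so
  operations are classified by exponent vectors; \<open>tmon\<close> classifies operations, so
  tuples of them are classified by monomials.\<close>

lemma isorel_S_cont:
  assumes G: "grpd G" and v: "\<And>a b. a \<in> Obj G \<Longrightarrow> b \<in> Obj G \<Longrightarrow> (a, b) \<in> isorel G \<longleftrightarrow> v a = v b"
    and as: "as \<in> Obj (S_grpd G)" and bs: "bs \<in> Obj (S_grpd G)"
  shows "(as, bs) \<in> isorel (S_grpd G) \<longleftrightarrow> cont v as = cont v bs"
proof -
  have *: "list_all2 (\<lambda>a b. (a, b) \<in> isorel G) cs bs \<longleftrightarrow> map v cs = map v bs" if "mset cs = mset as" for cs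
  proof -
    have "set cs \<subseteq> Obj G" using as mset_eq_setD[OF that] by simp
    then have "list_all2 (\<lambda>a b. (a, b) \<in> isorel G) cs bs \<longleftrightarrow> list_all2 (\<lambda>a b. v a = v b) cs bs"
      using bs v by (intro list.rel_cong) auto
    then show ?thesis by (simp add: list.rel_eq[symmetric] list.rel_map)
  qed
  have "(as, bs) \<in> isorel (S_grpd G) \<longleftrightarrow> (\<exists>cs. mset cs = mset as \<and> map v cs = map v bs)"
    unfolding isorel_S[OF G] using * as by auto
  also have "\<dots> \<longleftrightarrow> mset (map v as) = mset (map v bs)"
  proof
    assume "mset (map v as) = mset (map v bs)"
    then obtain p where p: "p permutes {..<length as}" "permute_list p (map v as) = map v bs"
      using mset_eq_permutation[of "map v bs" "map v as"] by (metis length_map)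
    then show "\<exists>cs. mset cs = mset as \<and> map v cs = map v bs"
      by (intro exI[of _ "permute_list p as"]) (simp add: permute_list_map[symmetric])
  qed (metis mset_map)
  finally show ?thesis by (simp add: cont_eq_iff)
qed

section \<open>Operations and two-level trees\<close>

abbreviation "unit_grpd \<equiv> discrete {()}"

text \<open>The arrows of the monoid of positive integers: \<open>n\<close> is represented by the list of \<open>n\<close> units.\<close>

definition Posn :: "(unit list, unit list) grpd"
  where "Posn = M_grpd unit_grpd"

lemma Posn_simps [simp]:
  "Obj Posn = {u. u \<noteq> []}" "Arr Posn = {u. u \<noteq> []}" "Dom Posn u = u" "Cod Posn u = u"
  "Idn Posn u = u" "Cmp Posn u u = u"
  by (auto simp: Posn_def M_grpd_def discrete_def map2_map_map[symmetric] intro!: map_idI nth_equalityI)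

lemma grpd_Posn: "grpd Posn"
  by (rule grpdI) auto

lemma star_Posn: "u \<noteq> [] \<Longrightarrow> star Posn u = {u}"
  by (auto simp: star_def)

lemma unit_list_eq: "(u :: unit list) = v \<longleftrightarrow> length u = length v"
  by (auto intro: nth_equalityI)

lemma isorel_Posn: "u \<noteq> [] \<Longrightarrow> (u, v) \<in> isorel Posn \<longleftrightarrow> length u = length v"
  by (auto simp: isorel_def intro: unit_list_eq[THEN iffD2])

text \<open>With a single colour, the conditions on equal inputs and equal targets in
  \<open>T_M\<close> and \<open>T_S\<close> hold for every operation.\<close>

lemma full_sub_trivial:
  fixes G :: "('a,'f) grpd"
  assumes "\<And>x. P x"
  shows "full_sub G P = G"
  using assms by (simp add: full_sub_def)

lemma i_ar_T_M_Ass: "i_ar (T_M Ass) = Posn"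
  by (simp add: T_M_def Ass_def full_sub_trivial Posn_def)

definition AssS :: "(unit, unit, unit list list, unit list smor) s_operad"
  where "AssS = T_S_M Ass"

text \<open>Multiplication of positive integers in unary notation, with \<open>r\<close> as the
  root.\<close>

definition mulU :: "unit list \<Rightarrow> unit list \<Rightarrow> unit list"
  where "mulU r u = concat (replicate (length r) u)"

lemma length_mulU [simp]: "length (mulU r u) = length r * length u"
  by (simp add: mulU_def length_concat sum_list_replicate)

lemma mulU_eq_Nil [simp]: "mulU r u = [] \<longleftrightarrow> r = [] \<or> u = []"
  by (simp only: length_0_conv[symmetric] length_mulU mult_eq_0_iff)

lemma s_col_AssS: "s_col AssS = unit_grpd"
  by (simp add: AssS_def T_S_M_def T_S_def T_M_def Ass_def)

lemma s_ops_AssS: "s_ops AssS = S_grpd Posn"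
  by (simp add: AssS_def T_S_M_def T_S_def i_ar_T_M_Ass full_sub_trivial)

lemma s_src_AssS: "s_src AssS = S_map \<lparr>fo = (\<lambda>_. ()), fm = (\<lambda>_. ())\<rparr>"
  by (simp add: AssS_def T_S_M_def T_S_def S_map_def) (auto intro!: ext simp: map_prod_def)

lemma s_unit_AssS: "s_unit AssS = \<lparr>fo = (\<lambda>_. [[()]]), fm = (\<lambda>_. [(0, [()])])\<rparr>"
  by (simp add: AssS_def T_S_M_def T_S_def T_M_def Ass_def gf_comp_def comp_def S_unit_def M_unit_def)

lemma s_mult_AssS: "s_mult AssS = S_mu \<bullet>
       \<lparr>fo = (\<lambda>(gss, fs). map2 (\<lambda>gs f. map (mulU f) gs) gss fs),
        fm = (\<lambda>(pss, rs). map2 (\<lambda>(k, ps) (_, r). (k, map (\<lambda>(j, p). (j, mulU r p)) ps)) pss rs)\<rparr>"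
  by (simp add: AssS_def T_S_M_def T_S_def T_M_def Ass_def gf_comp_def comp_def M_mu_def mulU_def[abs_def])

type_synonym atree = "(unit, unit list list) tree"
type_synonym amtree = "(unit, unit list smor) mtree"

lemma gfunctor_terminal: "gfunctor \<lparr>fo = (\<lambda>_. ()), fm = (\<lambda>_. ())\<rparr> G unit_grpd"
  by (rule gfunctorI) (auto simp: discrete_def)

definition Q0 :: "(atree, amtree) grpd" where "Q0 = barQ AssS 0"
definition Q1 :: "(atree, amtree) grpd" where "Q1 = barQ AssS 1"
definition Q2 :: "(atree, amtree) grpd" where "Q2 = barQ AssS 2"

abbreviation "src_f \<equiv> S_map \<lparr>fo = (\<lambda>_ :: unit list. ()), fm = (\<lambda>_ :: unit list. ())\<rparr>"
abbreviation "out_S \<equiv> S_map \<lparr>fo = (\<lambda>_ :: atree. ()), fm = (\<lambda>_ :: amtree. ())\<rparr>"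
abbreviation "pair_Q2 \<equiv> pullback (S_grpd Q1) out_S (S_grpd Posn) src_f"

lemma Q0_eq: "Q0 = relabel Col the_col MCol mthe_col unit_grpd"
  by (simp add: Q0_def s_col_AssS)

lemma Q1_eq: "Q1 = relabel Opn root_op MOpn mroot_op (S_grpd Posn)"
  by (simp add: Q1_def s_ops_AssS)

lemma out_f_AssS: "out_f AssS = \<lparr>fo = (\<lambda>_. ()), fm = (\<lambda>_. ())\<rparr>"
  by (simp add: out_f_def)

lemma Q2_eq: "Q2 = relabel (\<lambda>(ts, q). Lev ts q) (\<lambda>x. (subs x, root_op x))
    (\<lambda>(ts, q). MLev ts q) (\<lambda>x. (msubs x, mroot_op x)) pair_Q2"
  by (simp add: Q2_def numeral_2_eq_2 s_ops_AssS s_src_AssS out_f_AssS Q1_def)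

lemmas grpd_SPosn = grpd_S[OF grpd_Posn]

lemma grpd_Q0: "grpd Q0"
  unfolding Q0_eq by (rule grpd_relabel[OF grpd_discrete]) simp_all

lemma grpd_Q1: "grpd Q1"
  unfolding Q1_eq by (rule grpd_relabel[OF grpd_SPosn]) simp_all

lemma grpd_pair_Q2: "grpd pair_Q2"
  by (rule grpd_pullback[OF grpd_S[OF grpd_Q1] grpd_SPosn grpd_S[OF grpd_discrete]
      gfunctor_S_map[OF gfunctor_terminal] gfunctor_S_map[OF gfunctor_terminal]])

lemma grpd_Q2: "grpd Q2"
  unfolding Q2_eq by (rule grpd_relabel[OF grpd_pair_Q2]) auto

lemma Obj_Q1: "Obj Q1 = {Opn q | q. q \<noteq> [] \<and> [] \<notin> set q}"
  by (auto simp: Q1_eq)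

lemma map_unit_eq: "map (\<lambda>_. ()) xs = map (\<lambda>_. ()) ys \<longleftrightarrow> length xs = length ys"
  by (subst unit_list_eq) simp

text \<open>With one colour, grafting only requires that the number of subtrees be the arity of the
  root.\<close>

lemma Obj_Q2: "Obj Q2 = {Lev ts q | ts q. ts \<noteq> [] \<and> set ts \<subseteq> Obj Q1 \<and> [] \<notin> set q \<and> length ts = length q}"
  by (auto simp: Q2_eq image_iff map_unit_eq)

lemma fin_star_Posn: "finite (star Posn u)"
  by (cases "u = []") (simp_all add: star_Posn, simp add: star_def)

lemma star_Q1: "star Q1 (Opn q) = MOpn ` star (S_grpd Posn) q"
  unfolding Q1_eq by (rule star_relabel) simp_all

text \<open>\<open>Posn\<close> has only identities, so the arrows leaving a tuple are just the
  permutations.\<close>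

lemma card_star_SPosn: "q \<noteq> [] \<Longrightarrow> [] \<notin> set q \<Longrightarrow> card (star (S_grpd Posn) q) = fact (length q)"
proof -
  assume q: "q \<noteq> []" "[] \<notin> set q"
  from q(2) have "(\<Prod>u\<leftarrow>q. card (star Posn u)) = 1"
    by (induction q) (auto simp: star_Posn)
  with card_star_S[OF fin_star_Posn q(1)] show ?thesis by simp
qed

lemma card_star_Q1: "q \<noteq> [] \<Longrightarrow> [] \<notin> set q \<Longrightarrow> card (star Q1 (Opn q)) = fact (length q)"
  unfolding star_Q1 by (subst card_image) (auto simp: inj_on_def card_star_SPosn)

lemma fin_star_Q1: "finite (star Q1 t)"
proof (cases "t \<in> Obj Q1")
  case True
  then show ?thesis by (auto simp: Obj_Q1 star_Q1 intro!: finite_star_S fin_star_Posn)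
qed (simp add: star_empty[OF grpd_Q1])

lemma star_Q2: "star Q2 (Lev ts q) = (\<lambda>(ts, q). MLev ts q) ` star pair_Q2 (ts, q)"
  using star_relabel[of "\<lambda>x. (subs x, root_op x)" "\<lambda>(ts, q). Lev ts q"
      "\<lambda>x. (msubs x, mroot_op x)" "\<lambda>(ts, q). MLev ts q" pair_Q2 "(ts, q)"]
  unfolding Q2_eq by auto

text \<open>Since \<open>Posn\<close> is discrete, an isomorphism of trees is determined by its part above the root.\<close>

lemma bij_betw_star_pair_Q2:
  assumes "Lev ts q \<in> Obj Q2"
  shows "bij_betw fst (star pair_Q2 (ts, q)) (star (S_grpd Q1) ts)"
proof (rule bij_betw_imageI)
  have ob: "ts \<noteq> []" "set ts \<subseteq> Obj Q1" "[] \<notin> set q" "length ts = length q"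
    using assms by (auto simp: Obj_Q2)
  have len: "length rs = length pss" "\<And>i. i < length pss \<Longrightarrow> fst (rs ! i) = fst (pss ! i)"
    if "map (map_prod id (\<lambda>_. ())) pss = map (map_prod id (\<lambda>_. ())) rs"
    for pss :: "amtree smor" and rs :: "unit list smor"
  proof -
    show l: "length rs = length pss" using that by (metis length_map)
    show "fst (rs ! i) = fst (pss ! i)" if "i < length pss" for i
      using arg_cong[OF \<open>map _ pss = _\<close>, of "\<lambda>xs. fst (xs ! i)"] that l by simp
  qed
  have det: "snd (rs ! i) = q ! fst (rs ! i)"
    if "rs \<in> Arr (S_grpd Posn)" "Dom (S_grpd Posn) rs = q" "i < length rs" for rs i
    using S_Dom_nth[OF that(1,3)] that(2) by simp
  show "inj_on fst (star pair_Q2 (ts, q))"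
  proof (rule inj_onI)
    fix x y assume x: "x \<in> star pair_Q2 (ts, q)" and y: "y \<in> star pair_Q2 (ts, q)" and eq: "fst x = fst y"
    obtain pss rs ss where xy: "x = (pss, rs)" "y = (pss, ss)"
      using eq by (metis prod.collapse)
    have rs: "rs \<in> Arr (S_grpd Posn)" "Dom (S_grpd Posn) rs = q"
      "map (map_prod id (\<lambda>_. ())) pss = map (map_prod id (\<lambda>_. ())) rs"
      using x by (auto simp: xy star_def)
    have ss: "ss \<in> Arr (S_grpd Posn)" "Dom (S_grpd Posn) ss = q"
      "map (map_prod id (\<lambda>_. ())) pss = map (map_prod id (\<lambda>_. ())) ss"
      using y by (auto simp: xy star_def)
    have "rs = ss"
      by (rule nth_equalityI)
        (use len[OF rs(3)] len[OF ss(3)] det[OF rs(1,2)] det[OF ss(1,2)] in \<open>auto simp: prod_eq_iff\<close>)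
    then show "x = y" by (simp add: xy)
  qed
  show "fst ` star pair_Q2 (ts, q) = star (S_grpd Q1) ts"
  proof
    show "fst ` star pair_Q2 (ts, q) \<subseteq> star (S_grpd Q1) ts" by (auto simp: star_def)
    show "star (S_grpd Q1) ts \<subseteq> fst ` star pair_Q2 (ts, q)"
    proof
      fix pss assume "pss \<in> star (S_grpd Q1) ts"
      then have pss: "pss \<in> Arr (S_grpd Q1)" "Dom (S_grpd Q1) pss = ts" by (auto simp: star_def)
      have l: "length pss = length q" using pss(2) ob(4) length_Dom_S by metis
      \<comment> \<open>The gluing condition fixes the permutation at the root. Its components are
        identities, so the one with key \<open>k\<close> must be \<open>q ! k\<close>.\<close>
      define rs where "rs = map (\<lambda>p. (fst p, q ! fst p)) pss"
      have rs: "rs \<in> Arr (S_grpd Posn)"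
      proof (rule S_ArrI)
        fix i j assume "i < length rs" "j < length rs" "fst (rs ! i) = fst (rs ! j)"
        then show "i = j" using S_fst_inj[OF pss(1), of i j] by (simp add: rs_def)
      next
        fix i assume "i < length rs"
        then have "fst (pss ! i) < length pss" "i < length pss"
          using S_fst_less[OF pss(1)] by (simp_all add: rs_def)
        then show "fst (rs ! i) < length rs" "snd (rs ! i) \<in> Arr Posn"
          using ob(3) l by (auto simp: rs_def in_set_conv_nth)
      qed (use S_Arr_nonempty[OF pss(1)] in \<open>simp add: rs_def\<close>)
      have "Dom (S_grpd Posn) rs = q"
        by (rule S_Dom_eqI[OF rs]) (auto simp: rs_def l)
      then have "(pss, rs) \<in> star pair_Q2 (ts, q)"
        using pss rs by (auto simp: star_def rs_def)
      then show "pss \<in> fst ` star pair_Q2 (ts, q)" by force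
    qed
  qed
qed

text \<open>Forgetting the root is a bijection on stars, so the count is that of the tuple
  \<open>ts\<close>: rearrangements of the subtrees times rearrangements of the inputs of
  each.\<close>

lemma
  assumes "Lev ts q \<in> Obj Q2"
  shows fin_star_Lev: "finite (star Q2 (Lev ts q))"
    and card_star_Lev: "card (star Q2 (Lev ts q)) = fact (length q) * (\<Prod>t\<leftarrow>ts. fact (length (root_op t)))"
proof -
  have ts: "ts \<noteq> []" "set ts \<subseteq> Obj Q1" "length ts = length q" using assms by (auto simp: Obj_Q2)
  have inj: "inj_on (\<lambda>(ts, q). MLev ts q) A" for A :: "(('a,'b) mtree smor \<times> 'b) set" by (auto simp: inj_on_def)
  have "(\<Prod>t\<leftarrow>ts. card (star Q1 t)) = (\<Prod>t\<leftarrow>ts. fact (length (root_op t)))"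
    using ts(2) by (intro arg_cong[of _ _ prod_list] map_cong) (auto simp: Obj_Q1 card_star_Q1)
  then show "card (star Q2 (Lev ts q)) = fact (length q) * (\<Prod>t\<leftarrow>ts. fact (length (root_op t)))"
    using bij_betw_same_card[OF bij_betw_star_pair_Q2[OF assms]] ts card_star_S[OF fin_star_Q1 ts(1)]
    by (simp add: star_Q2 card_image[OF inj])
  show "finite (star Q2 (Lev ts q))"
    using bij_betw_finite[OF bij_betw_star_pair_Q2[OF assms]] finite_star_S[OF fin_star_Q1]
    by (simp add: star_Q2)
qed

lemma fin_star_Q2: "finite (star Q2 t)"
proof (cases "t \<in> Obj Q2")
  case True
  then show ?thesis using fin_star_Lev by (auto simp: Obj_Q2)
qed (simp add: star_empty[OF grpd_Q2])

section \<open>Functoriality of the face maps\<close>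

lemma gfunctor_cong:
  assumes G: "grpd G" and F: "gfunctor F G H"
    and "\<And>x. x \<in> Obj G \<Longrightarrow> fo F' x = fo F x" "\<And>f. f \<in> Arr G \<Longrightarrow> fm F' f = fm F f"
  shows "gfunctor F' G H"
  by (rule gfunctorI) (use assms in \<open>auto simp: gfunctor_simps grpd_simps\<close>)

lemma gfunctor_mulU: "r \<noteq> [] \<Longrightarrow> gfunctor \<lparr>fo = mulU r, fm = mulU r\<rparr> Posn Posn"
  by (rule gfunctorI) auto

text \<open>The inner face before flattening and without the constructor \<open>Opn\<close>: each
  root entry multiplies all entries of the operation grafted there.\<close>

definition act_f :: "(atree list \<times> unit list list, amtree smor \<times> unit list smor, unit list list list, unit list smor smor) gfun"
  where "act_f = \<lparr>fo = (\<lambda>(ts, q). map2 (\<lambda>gs f. map (mulU f) gs) (map root_op ts) q),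
     fm = (\<lambda>(pss, rs). map2 (\<lambda>(k, ps) (_, r). (k, map (\<lambda>(j, p). (j, mulU r p)) ps)) (map (map_prod id mroot_op) pss) rs)\<rparr>"

lemma act_f_nth:
  assumes "length pss = length rs" "i < length rs"
  shows "fm act_f (pss, rs) ! i =
    (fst (pss ! i), fm (S_map \<lparr>fo = mulU (snd (rs ! i)), fm = mulU (snd (rs ! i))\<rparr>) (mroot_op (snd (pss ! i))))"
  using assms by (simp add: act_f_def case_prod_unfold map_prod_def)

text \<open>The functor applied to a subtree, \<open>mulU r\<close>, varies with the root entry
  \<open>r\<close>. As the arrows of \<open>Posn\<close> are identities, \<open>r\<close> is
  constant along an arrow, and functoriality of each \<open>mulU r\<close> suffices.\<close>

lemma gfunctor_act_f: "gfunctor act_f pair_Q2 (S_grpd (S_grpd Posn))"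
proof (rule gfunctorI)
  fix x assume "x \<in> Obj pair_Q2"
  then obtain ts q where x: "x = (ts, q)" "ts \<noteq> []" "set ts \<subseteq> Obj Q1" "q \<noteq> []" "[] \<notin> set q" "length ts = length q"
    by (auto simp: map_unit_eq)
  have "map2 (\<lambda>gs f. map (mulU f) gs) (map root_op ts) q ! i \<in> Obj (S_grpd Posn)" if "i < length q" for i
  proof -
    have "ts ! i \<in> Obj Q1" "q ! i \<noteq> []"
      using x that nth_mem[of i ts] nth_mem[of i q] by (force simp: subset_iff)+
    then show ?thesis using x that by (auto simp: Obj_Q1)
  qed
  moreover have len: "length (fo act_f x) = length q" using x by (simp add: act_f_def)
  ultimately have "set (fo act_f x) \<subseteq> Obj (S_grpd Posn)"
    unfolding x(1) act_f_def by (metis (no_types, lifting) gfun.select_convs(1) in_set_conv_nth prod.case subsetI)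
  moreover have "fo act_f x \<noteq> []" using len x(4) by auto
  ultimately show "fo act_f x \<in> Obj (S_grpd (S_grpd Posn))" by simp
next
  let ?M = "\<lambda>r. S_map \<lparr>fo = mulU r, fm = mulU r\<rparr>"
  let ?T = "S_grpd Posn"
  note M = gfunctor_S_map[OF gfunctor_mulU]
  have arrD: "pss \<in> Arr (S_grpd Q1)" "rs \<in> Arr ?T" "length rs = length pss"
      "\<And>i. i < length pss \<Longrightarrow> fst (rs ! i) = fst (pss ! i)"
    if "(pss, rs) \<in> Arr pair_Q2" for pss rs
  proof -
    show "pss \<in> Arr (S_grpd Q1)" "rs \<in> Arr ?T" using that by auto
    have eq: "map (map_prod id (\<lambda>_. ())) pss = map (map_prod id (\<lambda>_. ())) rs" using that by auto
    show l: "length rs = length pss" using eq by (metis length_map)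
    show "fst (rs ! i) = fst (pss ! i)" if "i < length pss" for i
      using arg_cong[OF eq, of "\<lambda>xs. fst (xs ! i)"] that l by simp
  qed
  have Q1D: "mroot_op p \<in> Arr ?T" "Dom Q1 p = Opn (Dom ?T (mroot_op p))" "Cod Q1 p = Opn (Cod ?T (mroot_op p))"
    if "p \<in> Arr Q1" for p
    using that by (auto simp: Q1_eq simp del: Cod_S_grpd)
  fix x assume xA: "x \<in> Arr pair_Q2"
  obtain pss rs where x: "x = (pss, rs)" by (cases x)
  note a = arrD[OF xA[unfolded x]]
  have r: "snd (rs ! i) \<noteq> []" if "i < length pss" for i
    using S_snd[OF a(2), of i] that a(3) by simp
  have p: "snd (pss ! i) \<in> Arr Q1" if "i < length pss" for i
    using S_snd[OF a(1), of i] that by simp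
  have nth: "fm act_f x ! i = (fst (pss ! i), fm (?M (snd (rs ! i))) (mroot_op (snd (pss ! i))))"
    if "i < length pss" for i
    unfolding x using that a(3) by (intro act_f_nth) simp_all
  have len: "length (fm act_f x) = length pss" using a(3) by (simp add: act_f_def x)
  show *: "fm act_f x \<in> Arr (S_grpd ?T)"
  proof (rule S_ArrI)
    show "fm act_f x \<noteq> []" using S_Arr_nonempty[OF a(1)] len by (metis length_0_conv)
    fix i assume i: "i < length (fm act_f x)"
    then show "fst (fm act_f x ! i) < length (fm act_f x)"
      using S_fst_less[OF a(1)] nth len by simp
    show "snd (fm act_f x ! i) \<in> Arr ?T"
      using i nth len gfunctor_Arr[OF M[OF r] Q1D(1)[OF p]] by (simp del: S_map_simps)
    fix j assume "j < length (fm act_f x)" "fst (fm act_f x ! i) = fst (fm act_f x ! j)"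
    then show "i = j" using i nth len S_fst_inj[OF a(1), of i j] by simp
  qed
  have Df: "Dom pair_Q2 x = (Dom (S_grpd Q1) pss, Dom ?T rs)" "Cod pair_Q2 x = (Cod (S_grpd Q1) pss, Cod ?T rs)"
    by (simp_all add: x)
  show "Dom (S_grpd ?T) (fm act_f x) = fo act_f (Dom pair_Q2 x)"
  proof (rule S_Dom_eqI[OF *])
    show "length (fo act_f (Dom pair_Q2 x)) = length (fm act_f x)"
      using a(3) by (simp add: act_f_def x)
    fix i assume "i < length (fm act_f x)"
    then have i: "i < length pss" "i < length rs" using len a(3) by simp_all
    have k: "fst (pss ! i) < length pss" using S_fst_less[OF a(1) i(1)] .
    have "fo act_f (Dom pair_Q2 x) ! fst (fm act_f x ! i) =
        map (mulU (Dom ?T rs ! fst (pss ! i))) (root_op (Dom (S_grpd Q1) pss ! fst (pss ! i)))"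
      unfolding Df using i k a(3) by (simp add: nth) (simp add: act_f_def)
    also have "Dom ?T rs ! fst (pss ! i) = snd (rs ! i)"
      using S_Dom_nth[OF a(2) i(2)] a(4)[OF i(1)] by simp
    also have "Dom (S_grpd Q1) pss ! fst (pss ! i) = Opn (Dom ?T (mroot_op (snd (pss ! i))))"
      using S_Dom_nth[OF a(1) i(1)] Q1D(2)[OF p[OF i(1)]] by simp
    also have "map (mulU (snd (rs ! i))) (root_op (Opn (Dom ?T (mroot_op (snd (pss ! i))))))
        = fo (?M (snd (rs ! i))) (Dom ?T (mroot_op (snd (pss ! i))))" by simp
    also have "\<dots> = Dom ?T (snd (fm act_f x ! i))"
      using gfunctor_Dom[OF M[OF r] Q1D(1)[OF p]] i by (simp add: nth del: S_map_simps)
    finally show "fo act_f (Dom pair_Q2 x) ! fst (fm act_f x ! i) = Dom ?T (snd (fm act_f x ! i))" .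
  qed
  show "Cod (S_grpd ?T) (fm act_f x) = fo act_f (Cod pair_Q2 x)"
  proof (rule nth_equalityI)
    show "length (Cod (S_grpd ?T) (fm act_f x)) = length (fo act_f (Cod pair_Q2 x))"
      unfolding Df using len a(3) by (simp add: act_f_def)
    fix i assume "i < length (Cod (S_grpd ?T) (fm act_f x))"
    then have i: "i < length pss" "i < length rs" using len a(3) by simp_all
    have "Cod (S_grpd ?T) (fm act_f x) ! i = Cod ?T (fm (?M (snd (rs ! i))) (mroot_op (snd (pss ! i))))"
      using i len by (simp add: nth del: S_map_simps)
    also have "\<dots> = fo (?M (snd (rs ! i))) (Cod ?T (mroot_op (snd (pss ! i))))"
      by (rule gfunctor_Cod[OF M[OF r] Q1D(1)[OF p]]) (use i in simp_all)
    also have "\<dots> = fo act_f (Cod pair_Q2 x) ! i"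
      unfolding Df using i Q1D(3)[OF p[OF i(1)]] by (simp add: act_f_def)
    finally show "Cod (S_grpd ?T) (fm act_f x) ! i = fo act_f (Cod pair_Q2 x) ! i" .
  qed
  fix y assume yA: "y \<in> Arr pair_Q2" and xy: "Cod pair_Q2 x = Dom pair_Q2 y"
  obtain qss ss where y: "y = (qss, ss)" by (cases y)
  note b = arrD[OF yA[unfolded y]]
  have cp: "Cod (S_grpd Q1) pss = Dom (S_grpd Q1) qss" "Cod ?T rs = Dom ?T ss"
    using xy by (simp_all add: x y del: Cod_S_grpd)
  note c = S_composable[OF b(1) cp(1)] S_composable[OF b(2) cp(2)]
  have leny: "length (fm act_f y) = length qss" using b(3) by (simp add: act_f_def y)
  have nthy: "fm act_f y ! i = (fst (qss ! i), fm (?M (snd (ss ! i))) (mroot_op (snd (qss ! i))))"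
    if "i < length qss" for i
    unfolding y using that b(3) by (intro act_f_nth) simp_all
  let ?pq = "Cmp (S_grpd Q1) qss pss" and ?rs = "Cmp ?T ss rs"
  have xy': "Cmp pair_Q2 y x = (?pq, ?rs)" by (simp add: x y)
  show "fm act_f (Cmp pair_Q2 y x) = Cmp (S_grpd ?T) (fm act_f y) (fm act_f x)"
  proof (rule nth_equalityI)
    show "length (fm act_f (Cmp pair_Q2 y x)) = length (Cmp (S_grpd ?T) (fm act_f y) (fm act_f x))"
      using b(3) leny by (simp add: act_f_def xy')
    fix i assume "i < length (fm act_f (Cmp pair_Q2 y x))"
    then have i: "i < length qss" "i < length ss" using b(3) by (simp_all add: act_f_def xy')
    let ?k = "fst (qss ! i)"
    have k: "?k < length pss" using S_fst_less[OF b(1) i(1)] c(1) by simp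
    \<comment> \<open>Composability makes the matching root entries coincide, so the same
      \<open>mulU\<close> acts on both factors.\<close>
    have r_eq: "snd (rs ! ?k) = snd (ss ! i)" using c(4)[OF i(2)] b(4)[OF i(1)] by simp
    have rs_i: "snd (?rs ! i) = snd (ss ! i)"
      using i b(4)[OF i(1)] r_eq r[OF k] by (simp add: Cmp_S_nth)
    have qA: "snd (qss ! i) \<in> Arr Q1" using S_snd[OF b(1) i(1)] .
    have comp: "Cod ?T (mroot_op (snd (pss ! ?k))) = Dom ?T (mroot_op (snd (qss ! i)))"
      using c(2)[OF i(1)] Q1D(3)[OF p[OF k]] Q1D(2)[OF qA] by simp
    have "fm act_f (Cmp pair_Q2 y x) ! i = (fst (?pq ! i), fm (?M (snd (?rs ! i))) (mroot_op (snd (?pq ! i))))"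
      unfolding xy' by (rule act_f_nth) (use i b(3) in simp_all)
    also have "mroot_op (snd (?pq ! i)) = Cmp ?T (mroot_op (snd (qss ! i))) (mroot_op (snd (pss ! ?k)))"
      using i by (simp add: Cmp_S_nth Q1_eq)
    also have "fm (?M (snd (?rs ! i))) \<dots> =
        Cmp ?T (fm (?M (snd (?rs ! i))) (mroot_op (snd (qss ! i)))) (fm (?M (snd (?rs ! i))) (mroot_op (snd (pss ! ?k))))"
      by (rule gfunctor_Cmp[OF M Q1D(1)[OF p] Q1D(1)[OF qA] comp]) (use rs_i r[OF k] r_eq k in simp_all)
    also have "(fst (?pq ! i), \<dots>) = Cmp (S_grpd ?T) (fm act_f y) (fm act_f x) ! i"
      using i k leny rs_i r_eq by (simp add: Cmp_S_nth nth nthy del: S_map_simps)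
    finally show "fm act_f (Cmp pair_Q2 y x) ! i = Cmp (S_grpd ?T) (fm act_f y) (fm act_f x) ! i" .
  qed
qed

text \<open>\<open>tree_face\<close> is indexed by the level of its target: this is
  \<open>d_1\<close> on \<open>Q_2\<close>, which composes the two levels.\<close>

definition face1 :: "(atree, amtree, atree, amtree) gfun" where "face1 = tree_face AssS 1 1"

lemma fo_face1: "fo face1 (Lev ts q) = Opn (concat (map2 (\<lambda>gs f. map (mulU f) gs) (map root_op ts) q))"
  by (simp add: face1_def graft_f_def gf_comp_def gf_pair_def s_mult_AssS below_f_def root_f_def)

lemma gfunctor_Opn: "gfunctor \<lparr>fo = Opn, fm = MOpn\<rparr> (S_grpd Posn) Q1"
  unfolding Q1_eq by (rule gfunctor_relabel) simp_all

lemma gfunctor_unLev: "gfunctor \<lparr>fo = (\<lambda>x. (subs x, root_op x)), fm = (\<lambda>x. (msubs x, mroot_op x))\<rparr> Q2 pair_Q2"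
  unfolding Q2_eq by (rule gfunctor_unrelabel) auto

lemma Obj_Q2_Lev: "t \<in> Obj Q2 \<Longrightarrow> t = Lev (subs t) (root_op t)"
  by (auto simp: Obj_Q2)

lemma Arr_Q2_Lev: "f \<in> Arr Q2 \<Longrightarrow> f = MLev (msubs f) (mroot_op f)"
  by (auto simp: Q2_eq)

text \<open>The bar construction defines this face by cases on all trees; on \<open>Q2\<close> it
  factors through \<open>act_f\<close> and the flattening of tuples.\<close>

lemma gfunctor_face1: "gfunctor face1 Q2 Q1"
proof (rule gfunctor_cong[OF grpd_Q2])
  let ?F = "\<lparr>fo = Opn, fm = MOpn\<rparr> \<bullet> S_mu \<bullet> act_f \<bullet> \<lparr>fo = (\<lambda>x. (subs x, root_op x)), fm = (\<lambda>x. (msubs x, mroot_op x))\<rparr>"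
  show "gfunctor ?F Q2 Q1"
    by (intro gfunctor_comp[OF gfunctor_Opn] gfunctor_comp[OF gfunctor_S_mu[OF grpd_Posn]]
        gfunctor_comp[OF gfunctor_act_f] gfunctor_unLev)
  show "fo face1 x = fo ?F x" if "x \<in> Obj Q2" for x
    by (subst Obj_Q2_Lev[OF that]) (simp add: fo_face1 gf_comp_def act_f_def)
  show "fm face1 f = fm ?F f" if "f \<in> Arr Q2" for f
    by (subst Arr_Q2_Lev[OF that])
      (simp add: face1_def graft_f_def gf_comp_def gf_pair_def s_mult_AssS below_f_def root_f_def act_f_def)
qed

lemma gfunctor_face0: "gfunctor (tree_face AssS 1 0) Q2 Q1"
proof (rule gfunctor_cong[OF grpd_Q2])
  let ?F = "\<lparr>fo = Opn, fm = MOpn\<rparr> \<bullet> \<lparr>fo = snd, fm = snd\<rparr> \<bullet> \<lparr>fo = (\<lambda>x. (subs x, root_op x)), fm = (\<lambda>x. (msubs x, mroot_op x))\<rparr>"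
  show "gfunctor ?F Q2 Q1"
    by (rule gfunctor_comp[OF gfunctor_Opn gfunctor_comp[OF gfunctor_snd_pullback gfunctor_unLev]])
qed (simp_all add: graft_f_def gf_comp_def gf_pair_def root_f_def)

lemma gfunctor_below: "gfunctor (below_f AssS) Q2 (S_grpd Q1)"
proof (rule gfunctor_cong[OF grpd_Q2])
  let ?F = "\<lparr>fo = fst, fm = fst\<rparr> \<bullet> \<lparr>fo = (\<lambda>x. (subs x, root_op x)), fm = (\<lambda>x. (msubs x, mroot_op x))\<rparr>"
  show "gfunctor ?F Q2 (S_grpd Q1)"
    by (rule gfunctor_comp[OF gfunctor_fst_pullback gfunctor_unLev])
  show "fo (below_f AssS) x = fo ?F x" if "x \<in> Obj Q2" for x
    by (subst Obj_Q2_Lev[OF that]) (simp add: gf_comp_def below_f_def)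
  show "fm (below_f AssS) f = fm ?F f" if "f \<in> Arr Q2" for f
    by (subst Arr_Q2_Lev[OF that]) (simp add: gf_comp_def below_f_def)
qed

definition bar_Ass :: "(atree list, amtree smor) simp_grpd"
  where "bar_Ass = bar (T_S_M Ass)"

lemma bar_Ass_level: "level bar_Ass 0 = S_grpd Q0" "level bar_Ass 1 = S_grpd Q1" "level bar_Ass 2 = S_grpd Q2"
  by (simp_all add: bar_Ass_def bar_def Q0_def Q1_def Q2_def AssS_def)

lemma bar_Ass_face:
  "face bar_Ass 2 0 = S_map (tree_face AssS 1 0)" "face bar_Ass 2 1 = S_map face1"
  "face bar_Ass 2 2 = S_mu \<bullet> S_map (below_f AssS)"
  by (simp_all add: bar_Ass_def bar_def face1_def AssS_def)

lemma gfunctor_bar_Ass_face: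
  assumes "i \<le> 2"
  shows "gfunctor (face bar_Ass 2 i) (level bar_Ass 2) (level bar_Ass 1)"
proof -
  consider "i = 0" | "i = 1" | "i = 2" using assms by linarith
  then show ?thesis
    by cases (use gfunctor_S_map[OF gfunctor_face0] gfunctor_S_map[OF gfunctor_face1]
      gfunctor_comp[OF gfunctor_S_mu[OF grpd_Q1] gfunctor_S_map[OF gfunctor_below]] bar_Ass_level bar_Ass_face in simp_all)
qed

section \<open>The exponential formula\<close>

text \<open>Exponent vectors are viewed as multisets so that their arrangements are counted by a
  multinomial coefficient.\<close>

definition pm_mset :: "('k \<Rightarrow>\<^sub>0 nat) \<Rightarrow> 'k multiset"
  where "pm_mset m = Abs_multiset (Poly_Mapping.lookup m)"

lemma count_pm_mset: "count (pm_mset m) = Poly_Mapping.lookup m"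
  unfolding pm_mset_def by (rule count_Abs_multiset) simp

lemma set_pm_mset: "set_mset (pm_mset m) = Poly_Mapping.keys m"
  by (auto simp: set_mset_def count_pm_mset in_keys_iff)

definition lists_of :: "'a set \<Rightarrow> ('a \<Rightarrow> 'k) \<Rightarrow> ('k \<Rightarrow>\<^sub>0 nat) \<Rightarrow> 'a list set"
  where "lists_of A v m = {L. set L \<subseteq> A \<and> cont v L = m}"

lemma cont_eq_pm_mset: "cont v L = m \<longleftrightarrow> mset (map v L) = pm_mset m"
  by (simp add: poly_mapping_eq_iff fun_eq_iff lookup_cont multiset_eq_iff count_pm_mset)

lemma listset_fibres: "L \<in> listset (map (\<lambda>k. {a \<in> A. v a = k}) K) \<longleftrightarrow> set L \<subseteq> A \<and> map v L = K"
proof -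
  have "set L \<subseteq> A \<longleftrightarrow> (\<forall>i<length L. L ! i \<in> A)"
    by (auto simp: in_set_conv_nth subset_iff)
  then show ?thesis by (auto simp: in_listset_iff list_eq_iff_nth_eq)
qed

text \<open>Sort the lists by the word \<open>K\<close> of their values: \<open>K\<close> runs
  through the arrangements of \<open>m\<close>, and for fixed \<open>K\<close> the entries are
  chosen independently.\<close>

lemma lists_of_UN:
  "lists_of A v m = (\<Union>K\<in>permutations_of_multiset (pm_mset m). listset (map (\<lambda>k. {a \<in> A. v a = k}) K))"
  by (auto simp: lists_of_def listset_fibres cont_eq_pm_mset permutations_of_multiset_def)

lemma sum_listset:
  fixes W :: "'a \<Rightarrow> 'r :: comm_semiring_1"
  assumes "\<And>A. A \<in> set As \<Longrightarrow> finite A"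
  shows "(\<Sum>L\<in>listset As. \<Prod>a\<leftarrow>L. W a) = (\<Prod>A\<leftarrow>As. \<Sum>a\<in>A. W a)"
  using assms
proof (induction As)
  case (Cons A As)
  have eq: "listset (A # As) = (\<lambda>(x, xs). x # xs) ` (A \<times> listset As)"
    by (auto simp: set_Cons_def)
  have inj: "inj_on (\<lambda>(x, xs). x # xs) (A \<times> listset As)"
    by (auto simp: inj_on_def)
  have "(\<Sum>L\<in>listset (A # As). \<Prod>a\<leftarrow>L. W a) = (\<Sum>(x, xs)\<in>A \<times> listset As. W x * (\<Prod>a\<leftarrow>xs. W a))"
    unfolding eq by (subst sum.reindex[OF inj]) (simp add: case_prod_unfold)
  also have "\<dots> = (\<Sum>x\<in>A. W x) * (\<Sum>xs\<in>listset As. \<Prod>a\<leftarrow>xs. W a)"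
    by (simp add: sum_product sum.cartesian_product)
  finally show ?case using Cons by simp
qed simp

lemma prod_list_mset:
  fixes s :: "'k \<Rightarrow> 'r :: comm_monoid_mult"
  shows "(\<Prod>k\<leftarrow>K. s k) = (\<Prod>k\<in>set K. s k ^ count (mset K) k)"
proof -
  have "(\<Prod>k\<leftarrow>K. s k) = prod_mset (image_mset s (mset K))"
    by (simp add: prod_mset_prod_list[symmetric])
  then show ?thesis by (simp add: image_prod_mset_multiplicity)
qed

lemma set_permutation_pm_mset:
  assumes "K \<in> permutations_of_multiset (pm_mset m)"
  shows "set K = Poly_Mapping.keys m"
proof -
  have "set_mset (mset K) = set_mset (pm_mset m)"
    using assms by (simp add: permutations_of_multiset_def)
  then show ?thesis by (simp add: set_pm_mset)
qed

lemma finite_lists_of: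
  assumes "\<And>k. k \<in> Poly_Mapping.keys m \<Longrightarrow> finite {a \<in> A. v a = k}"
  shows "finite (lists_of A v m)"
  unfolding lists_of_UN
proof (intro finite_UN_I finite_listset)
  fix K B assume "K \<in> permutations_of_multiset (pm_mset m)" "B \<in> set (map (\<lambda>k. {a \<in> A. v a = k}) K)"
  then show "finite B" using assms set_permutation_pm_mset by auto
qed simp

lemma length_lists_of: "L \<in> lists_of A v m \<Longrightarrow> length L = size (pm_mset m)"
  unfolding lists_of_def cont_eq_pm_mset mem_Collect_eq by (metis length_map size_mset)

text \<open>The independent choices give the same product for each arrangement, so the number of
  arrangements factors out.\<close>

lemma sum_lists_of_aux:
  fixes W :: "'a \<Rightarrow> 'r :: comm_semiring_1"
  assumes fin: "\<And>k. k \<in> Poly_Mapping.keys m \<Longrightarrow> finite {a \<in> A. v a = k}"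
  shows "(\<Sum>L\<in>lists_of A v m. \<Prod>a\<leftarrow>L. W a) =
    of_nat (card (permutations_of_multiset (pm_mset m))) *
    (\<Prod>k\<in>Poly_Mapping.keys m. (\<Sum>a | a \<in> A \<and> v a = k. W a) ^ Poly_Mapping.lookup m k)"
proof -
  let ?P = "permutations_of_multiset (pm_mset m)"
  let ?F = "\<lambda>K. map (\<lambda>k. {a \<in> A. v a = k}) K"
  have K: "set K = Poly_Mapping.keys m" "mset K = pm_mset m" if "K \<in> ?P" for K
    using that by (auto simp: set_permutation_pm_mset permutations_of_multiset_def)
  have finK: "finite B" if "K \<in> ?P" "B \<in> set (?F K)" for K B
    using that K fin by auto
  have "(\<Sum>L\<in>lists_of A v m. \<Prod>a\<leftarrow>L. W a) = (\<Sum>K\<in>?P. \<Sum>L\<in>listset (?F K). \<Prod>a\<leftarrow>L. W a)"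
    unfolding lists_of_UN
  proof (rule sum.UNION_disjoint)
    show "\<forall>K\<in>?P. finite (listset (?F K))"
      using finK by (blast intro: finite_listset)
  qed (auto simp: listset_fibres)
  also have "\<dots> = (\<Sum>K\<in>?P. \<Prod>k\<in>Poly_Mapping.keys m. (\<Sum>a | a \<in> A \<and> v a = k. W a) ^ Poly_Mapping.lookup m k)"
  proof (rule sum.cong)
    fix K assume "K \<in> ?P"
    then show "(\<Sum>L\<in>listset (?F K). \<Prod>a\<leftarrow>L. W a) =
        (\<Prod>k\<in>Poly_Mapping.keys m. (\<Sum>a | a \<in> A \<and> v a = k. W a) ^ Poly_Mapping.lookup m k)"
      using finK by (subst sum_listset) (auto simp: comp_def prod_list_mset K count_pm_mset)
  qed simp
  finally show ?thesis by simp
qed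

text \<open>\<open>C\<close> is meant as the embedding of the scalars.\<close>

lemma sum_lists_of:
  fixes W :: "'a \<Rightarrow> 'r :: comm_semiring_1" and C :: "rat \<Rightarrow> 'r"
  assumes fin: "\<And>k. k \<in> Poly_Mapping.keys m \<Longrightarrow> finite {a \<in> A. v a = k}"
    and C: "\<And>a b. C (a * b) = C a * C b" "\<And>n. C (of_nat n) = of_nat n"
  shows "(\<Sum>L\<in>lists_of A v m. C (1 / fact (length L)) * (\<Prod>a\<leftarrow>L. W a)) =
    C (1 / (\<Prod>k\<in>Poly_Mapping.keys m. fact (Poly_Mapping.lookup m k))) *
    (\<Prod>k\<in>Poly_Mapping.keys m. (\<Sum>a | a \<in> A \<and> v a = k. W a) ^ Poly_Mapping.lookup m k)"
proof -
  let ?M = "pm_mset m"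
  let ?d = "\<Prod>k\<in>Poly_Mapping.keys m. fact (Poly_Mapping.lookup m k) :: nat"
  \<comment> \<open>The multinomial coefficient turns 1/n! into the reciprocal of the product of the
    factorials of the exponents.\<close>
  have "of_nat (card (permutations_of_multiset ?M)) * of_nat ?d = (of_nat (fact (size ?M)) :: rat)"
    using card_permutations_of_multiset[of ?M] unfolding set_pm_mset count_pm_mset
    by (metis dvd_div_mult_self of_nat_mult)
  then have card: "1 / fact (size ?M) * of_nat (card (permutations_of_multiset ?M)) = 1 / (of_nat ?d :: rat)"
    by (simp add: field_simps)
  have "(\<Sum>L\<in>lists_of A v m. C (1 / fact (length L)) * (\<Prod>a\<leftarrow>L. W a)) =
      C (1 / fact (size ?M)) * (\<Sum>L\<in>lists_of A v m. \<Prod>a\<leftarrow>L. W a)"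
    unfolding sum_distrib_left by (rule sum.cong) (simp_all add: length_lists_of)
  also have "\<dots> = C (1 / fact (size ?M)) * C (of_nat (card (permutations_of_multiset ?M))) *
      (\<Prod>k\<in>Poly_Mapping.keys m. (\<Sum>a | a \<in> A \<and> v a = k. W a) ^ Poly_Mapping.lookup m k)"
    by (simp add: sum_lists_of_aux[OF fin] C mult.assoc)
  also have "C (1 / fact (size ?M)) * C (of_nat (card (permutations_of_multiset ?M))) = C (1 / of_nat ?d)"
    by (simp only: C(1)[symmetric] card)
  finally show ?thesis by simp
qed

text \<open>Supplies an operation of every class in \<open>Lam\<close> and a tuple for every
  monomial other than 1.\<close>

lemma ex_lists_of:
  assumes "Poly_Mapping.keys m \<subseteq> v ` A"
  shows "\<exists>L. L \<in> lists_of A v m"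
proof -
  obtain K where K: "mset K = pm_mset m" using ex_mset by blast
  then have "\<forall>k\<in>set K. \<exists>a\<in>A. v a = k"
    using assms set_pm_mset[of m] by (metis image_iff set_mset_mset subsetD)
  then obtain g where g: "\<And>k. k \<in> set K \<Longrightarrow> g k \<in> A \<and> v (g k) = k" by metis
  then have "map v (map g K) = K" by (simp add: map_idI)
  then have "mset (map v (map g K)) = pm_mset m" using K by (simp only:)
  moreover have "set (map g K) \<subseteq> A" using g by auto
  ultimately have "map g K \<in> lists_of A v m"
    unfolding lists_of_def cont_eq_pm_mset by blast
  then show ?thesis ..
qed

section \<open>The basis of the incidence bialgebra\<close>

lemma isorel_relabel:
  assumes "\<And>x. d (e x) = x" "\<And>f. d' (e' f) = f"
  shows "(e x, e y) \<in> isorel (relabel e d e' d' G) \<longleftrightarrow> (x, y) \<in> isorel G"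
proof -
  have "e x = e y \<longleftrightarrow> x = y" for x y using assms(1) by metis
  then show ?thesis by (auto simp: isorel_def assms)
qed

lemma Lam_keys: "l \<in> Lam \<Longrightarrow> k \<in> Poly_Mapping.keys l \<Longrightarrow> k \<noteq> 0"
  by (cases "k = 0") (simp_all add: Lam_def in_keys_iff)

text \<open>An isomorphism class of operations is an exponent vector \<open>\<lambda>\<close>, read off the root by \<open>tmon\<close>; a class of tuples
  of operations is a monomial in the \<open>a\<^sub>\<lambda>\<close>.\<close>

definition tmon :: "atree \<Rightarrow> mono"
  where "tmon t = cont length (root_op t)"

definition amon :: "atree list \<Rightarrow> amono"
  where "amon = cont tmon"

lemma isorel_Q1:
  assumes "t \<in> Obj Q1" "t' \<in> Obj Q1"
  shows "(t, t') \<in> isorel Q1 \<longleftrightarrow> tmon t = tmon t'"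
proof -
  from assms obtain q q' where q: "t = Opn q" "t' = Opn q'" "q \<in> Obj (S_grpd Posn)" "q' \<in> Obj (S_grpd Posn)"
    by (auto simp: Obj_Q1)
  have "(q, q') \<in> isorel (S_grpd Posn) \<longleftrightarrow> cont length q = cont length q'"
    by (rule isorel_S_cont[OF grpd_Posn _ q(3,4)]) (simp add: isorel_Posn)
  moreover have "(Opn q, Opn q') \<in> isorel Q1 \<longleftrightarrow> (q, q') \<in> isorel (S_grpd Posn)"
    unfolding Q1_eq by (rule isorel_relabel) simp_all
  ultimately show ?thesis using q by (simp add: tmon_def)
qed

lemma isorel_SQ1:
  "L \<in> Obj (S_grpd Q1) \<Longrightarrow> L' \<in> Obj (S_grpd Q1) \<Longrightarrow> (L, L') \<in> isorel (S_grpd Q1) \<longleftrightarrow> amon L = amon L'"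
  unfolding amon_def by (rule isorel_S_cont[OF grpd_Q1 isorel_Q1])

lemmas grpd_SQ1 = grpd_S[OF grpd_Q1]
lemmas grpd_SQ2 = grpd_S[OF grpd_Q2]
lemmas fin_star_SQ1 = finite_star_S[OF fin_star_Q1]
lemmas fin_star_SQ2 = finite_star_S[OF fin_star_Q2]

lemma tmon_Lam: "t \<in> Obj Q1 \<Longrightarrow> tmon t \<in> Lam"
proof -
  assume "t \<in> Obj Q1"
  then obtain q where q: "t = Opn q" "q \<noteq> []" "[] \<notin> set q" by (auto simp: Obj_Q1)
  have "Poly_Mapping.keys (tmon t) \<noteq> {}" using q by (simp add: tmon_def keys_cont)
  moreover have "0 \<notin> Poly_Mapping.keys (tmon t)" using q by (auto simp: tmon_def keys_cont)
  ultimately show "tmon t \<in> Lam" by (auto simp: Lam_def in_keys_iff)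
qed

definition cls :: "amono \<Rightarrow> atree list set"
  where "cls m = {L \<in> Obj (S_grpd Q1). amon L = m}"

text \<open>The empty tuple is not an object, so the monomial 1 corresponds to the adjoined unit
  \<open>None\<close>.\<close>

definition hb :: "amono \<Rightarrow> atree list set option"
  where "hb m = (if m = 0 then None else Some (cls m))"

lemma amon_amonos: "L \<in> Obj (S_grpd Q1) \<Longrightarrow> amon L \<in> amonos \<and> amon L \<noteq> 0"
proof -
  assume L: "L \<in> Obj (S_grpd Q1)"
  then have "Poly_Mapping.keys (amon L) \<noteq> {}" "Poly_Mapping.keys (amon L) \<subseteq> Lam"
    by (auto simp: amon_def keys_cont intro: tmon_Lam)
  then show ?thesis by (auto simp: amonos_def)
qed

lemma iso_class_SQ1: "L \<in> Obj (S_grpd Q1) \<Longrightarrow> isorel (S_grpd Q1) `` {L} = cls (amon L)"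
  using isorel_SQ1[of L] equiv_type[OF equiv_isorel[OF grpd_SQ1]]
  by (auto simp: cls_def simp del: Obj_S_grpd)

lemma cls_lists_of: "m \<noteq> 0 \<Longrightarrow> cls m = lists_of (Obj Q1) tmon m"
  by (auto simp: cls_def lists_of_def amon_def)

lemma tmon_surj: "l \<in> Lam \<Longrightarrow> \<exists>t\<in>Obj Q1. tmon t = l"
proof -
  assume l: "l \<in> Lam"
  have "Poly_Mapping.keys l \<subseteq> length ` {u :: unit list. u \<noteq> []}"
  proof
    fix k assume "k \<in> Poly_Mapping.keys l"
    then have "k \<noteq> 0" by (rule Lam_keys[OF l])
    then show "k \<in> length ` {u :: unit list. u \<noteq> []}"
      by (intro image_eqI[of _ _ "replicate k ()"]) auto
  qed
  then obtain q where "q \<in> lists_of {u :: unit list. u \<noteq> []} length l" using ex_lists_of by blast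
  then have "Opn q \<in> Obj Q1" "tmon (Opn q) = l"
    using l by (auto simp: lists_of_def Obj_Q1 tmon_def Lam_def)
  then show ?thesis by blast
qed

lemma amon_surj: "m \<in> amonos \<Longrightarrow> m \<noteq> 0 \<Longrightarrow> \<exists>L\<in>Obj (S_grpd Q1). amon L = m"
proof -
  assume m: "m \<in> amonos" "m \<noteq> 0"
  then have "Poly_Mapping.keys m \<subseteq> tmon ` Obj Q1"
    using tmon_surj by (fastforce simp: amonos_def)
  then obtain L where "L \<in> lists_of (Obj Q1) tmon m" using ex_lists_of by blast
  then have "set L \<subseteq> Obj Q1" "amon L = m" by (auto simp: lists_of_def amon_def)
  moreover from this have "L \<noteq> []" using m by (auto simp: amon_def)
  ultimately show ?thesis by auto
qed

text \<open>\<open>amon\<close> separates the classes, and it attains every monomial except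
  1.\<close>

lemma pi0_SQ1: "pi0 (S_grpd Q1) = cls ` (amonos - {0})"
proof
  show "pi0 (S_grpd Q1) \<subseteq> cls ` (amonos - {0})"
    unfolding pi0_isorel
  proof
    fix c assume "c \<in> Obj (S_grpd Q1) // isorel (S_grpd Q1)"
    then obtain L where "L \<in> Obj (S_grpd Q1)" "c = isorel (S_grpd Q1) `` {L}" by (rule quotientE)
    then show "c \<in> cls ` (amonos - {0})"
      using iso_class_SQ1 amon_amonos by auto
  qed
  show "cls ` (amonos - {0}) \<subseteq> pi0 (S_grpd Q1)"
  proof
    fix c assume "c \<in> cls ` (amonos - {0})"
    then obtain m where m: "m \<in> amonos" "m \<noteq> 0" "c = cls m" by auto
    obtain L where L: "L \<in> Obj (S_grpd Q1)" "amon L = m" using amon_surj[OF m(1,2)] by blast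
    have "c = isorel (S_grpd Q1) `` {L}" using iso_class_SQ1[OF L(1)] L(2) m(3) by simp
    then show "c \<in> pi0 (S_grpd Q1)"
      using quotientI[OF L(1)] by (simp only: pi0_isorel)
  qed
qed

lemma inj_on_hb: "inj_on hb amonos"
proof (rule inj_onI)
  fix m n assume m: "m \<in> amonos" and n: "n \<in> amonos" and eq: "hb m = hb n"
  show "m = n"
  proof (cases "m = 0 \<or> n = 0")
    case True
    then show ?thesis using eq by (auto simp: hb_def split: if_splits)
  next
    case False
    then have "cls m = cls n" using eq by (simp add: hb_def)
    moreover obtain L where "L \<in> Obj (S_grpd Q1)" "amon L = m" using amon_surj m False by blast
    ultimately show ?thesis by (auto simp: cls_def)
  qed
qed

lemma hb_image: "hb ` amonos = insert None (Some ` pi0 (S_grpd Q1))"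
proof -
  have "0 \<in> amonos" by (simp add: amonos_def)
  then have "hb ` amonos = insert (hb 0) (hb ` (amonos - {0}))" by blast
  also have "hb ` (amonos - {0}) = Some ` cls ` (amonos - {0})"
    unfolding image_image by (rule image_cong) (auto simp: hb_def)
  finally show ?thesis by (simp add: pi0_SQ1 hb_def)
qed

text \<open>Contents add under concatenation, whichever representatives are juxtaposed.\<close>

lemma juxt_hb:
  assumes "m \<in> amonos" "n \<in> amonos"
  shows "juxt (S_grpd Q1) (hb m) (hb n) = hb (m + n)"
proof (cases "m = 0 \<or> n = 0")
  case True
  then show ?thesis by (auto simp: hb_def)
next
  case False
  have "rep (cls m) \<in> cls m" "rep (cls n) \<in> cls n"
    by (rule rep_in[OF grpd_SQ1], use pi0_SQ1 assms False in blast)+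
  then have L: "rep (cls m) \<in> Obj (S_grpd Q1)" "amon (rep (cls m)) = m"
    "rep (cls n) \<in> Obj (S_grpd Q1)" "amon (rep (cls n)) = n" by (auto simp: cls_def)
  then have "rep (cls m) @ rep (cls n) \<in> Obj (S_grpd Q1)" "amon (rep (cls m) @ rep (cls n)) = m + n"
    by (auto simp: amon_def)
  then have "iso_class (S_grpd Q1) (rep (cls m) @ rep (cls n)) = cls (m + n)" "m + n \<noteq> 0"
    using iso_class_SQ1 amon_amonos by (auto simp: iso_class_isorel)
  then show ?thesis using False by (simp add: hb_def)
qed

section \<open>Automorphisms of a tuple of operations\<close>

lemma finite_fib_Posn: "finite {u :: unit list. u \<noteq> [] \<and> length u = k}"
proof -
  have "{u :: unit list. u \<noteq> [] \<and> length u = k} \<subseteq> {replicate k ()}"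
    by (auto intro: unit_list_eq[THEN iffD2])
  then show ?thesis by (rule finite_subset) simp
qed

lemma fib_Posn: "k \<noteq> 0 \<Longrightarrow> {u :: unit list. u \<noteq> [] \<and> length u = k} = {replicate k ()}"
  by (auto intro: unit_list_eq[THEN iffD2])

abbreviation "pos_lists \<equiv> lists_of {u :: unit list. u \<noteq> []} length"

lemma finite_pos_lists: "finite (pos_lists l)"
  by (rule finite_lists_of) (simp add: finite_fib_Posn)

text \<open>The exponential formula with trivial weights, as there is one list of units of each
  positive length. This is where the normalisation of the series coefficients meets the groupoid
  count.\<close>

lemma sum_pos_lists:
  assumes "l \<in> Lam"
  shows "(\<Sum>q\<in>pos_lists l. 1 / fact (length q)) = (1 / of_nat (mono_fact l) :: rat)"
proof -
  have "(\<Sum>q\<in>pos_lists l. 1 / fact (length q)) =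
    (\<Sum>q\<in>pos_lists l. (1 / fact (length q) :: rat) * (\<Prod>u\<leftarrow>q. 1))"
    by (rule sum.cong) (simp_all add: map_replicate_const)
  also have "\<dots> = 1 / (\<Prod>k\<in>Poly_Mapping.keys l. fact (Poly_Mapping.lookup l k)) *
      (\<Prod>k\<in>Poly_Mapping.keys l. (\<Sum>u | u \<in> {u :: unit list. u \<noteq> []} \<and> length u = k. 1) ^ Poly_Mapping.lookup l k)"
    by (rule sum_lists_of) (simp_all add: finite_fib_Posn)
  also have "(\<Prod>k\<in>Poly_Mapping.keys l. (\<Sum>u | u \<in> {u :: unit list. u \<noteq> []} \<and> length u = k. 1) ^ Poly_Mapping.lookup l k) = (1 :: rat)"
  proof (rule prod.neutral, rule ballI)
    fix k assume "k \<in> Poly_Mapping.keys l"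
    then have "k \<noteq> 0" by (rule Lam_keys[OF assms])
    then show "(\<Sum>u | u \<in> {u :: unit list. u \<noteq> []} \<and> length u = k. 1) ^ Poly_Mapping.lookup l k = (1 :: rat)"
      by (simp add: fib_Posn)
  qed
  finally show ?thesis by (simp add: mono_fact_def)
qed

lemma fib_Q1: "l \<in> Lam \<Longrightarrow> {t. t \<in> Obj Q1 \<and> tmon t = l} = Opn ` pos_lists l"
  by (auto simp: Obj_Q1 tmon_def lists_of_def Lam_def image_iff)

text \<open>This is the order of a product of wreath products, with \<open>mono_fact l\<close> for a
  single operation of class \<open>l\<close>. It is found as the reciprocal of the total weight of
  the class, by the exponential formula for tuples and once more inside each operation.\<close>

lemma card_aut_cls:
  assumes m: "m \<in> amonos" "m \<noteq> 0"
  shows "(of_nat (card (aut (S_grpd Q1) (rep (cls m)))) :: rat) =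
    (\<Prod>l\<in>Poly_Mapping.keys m. fact (Poly_Mapping.lookup m l) * of_nat (mono_fact l) ^ Poly_Mapping.lookup m l)"
proof -
  have c: "cls m \<in> pi0 (S_grpd Q1)" using m pi0_SQ1 by blast
  have Lam: "l \<in> Lam" if "l \<in> Poly_Mapping.keys m" for l using that m by (auto simp: amonos_def)
  have finl: "finite {t \<in> Obj Q1. tmon t = l}" if "l \<in> Poly_Mapping.keys m" for l
    using fib_Q1[OF Lam[OF that]] finite_pos_lists by simp
  have fin: "finite (cls m)"
    unfolding cls_lists_of[OF m(2)] by (rule finite_lists_of[OF finl])
  have "1 / of_nat (card (aut (S_grpd Q1) (rep (cls m)))) = (\<Sum>L\<in>cls m. 1 / of_nat (card (star (S_grpd Q1) L)) :: rat)"
    unfolding aut_hom by (rule sum_star_class[OF grpd_SQ1 fin_star_SQ1 c fin rep_in[OF grpd_SQ1 c], symmetric])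
  also have "\<dots> = (\<Sum>L\<in>cls m. 1 / fact (length L) * (\<Prod>t\<leftarrow>L. 1 / of_nat (card (star Q1 t))))"
  proof (rule sum.cong)
    fix L assume L: "L \<in> cls m"
    have "(\<Prod>t\<leftarrow>L. 1 / of_nat (card (star Q1 t))) = (1 / of_nat (\<Prod>t\<leftarrow>L. card (star Q1 t)) :: rat)" for L
      by (induction L) simp_all
    then show "1 / of_nat (card (star (S_grpd Q1) L)) =
        (1 / fact (length L) * (\<Prod>t\<leftarrow>L. 1 / of_nat (card (star Q1 t))) :: rat)"
      using L by (subst card_star_S[OF fin_star_Q1]) (auto simp: cls_def)
  qed simp
  also have "\<dots> = 1 / (\<Prod>k\<in>Poly_Mapping.keys m. fact (Poly_Mapping.lookup m k)) *
    (\<Prod>l\<in>Poly_Mapping.keys m. (\<Sum>t | t \<in> Obj Q1 \<and> tmon t = l. 1 / of_nat (card (star Q1 t))) ^ Poly_Mapping.lookup m l)"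
    unfolding cls_lists_of[OF m(2)] by (rule sum_lists_of) (use finl in simp_all)
  also have "(\<Prod>l\<in>Poly_Mapping.keys m. (\<Sum>t | t \<in> Obj Q1 \<and> tmon t = l. 1 / of_nat (card (star Q1 t))) ^ Poly_Mapping.lookup m l) =
    (\<Prod>l\<in>Poly_Mapping.keys m. (1 / of_nat (mono_fact l)) ^ Poly_Mapping.lookup m l :: rat)"
  proof (rule prod.cong)
    fix l assume "l \<in> Poly_Mapping.keys m"
    then have l: "l \<in> Lam" by (rule Lam)
    have "(\<Sum>t | t \<in> Obj Q1 \<and> tmon t = l. 1 / of_nat (card (star Q1 t)) :: rat) =
        (\<Sum>q\<in>pos_lists l. 1 / of_nat (card (star Q1 (Opn q))))"
      unfolding fib_Q1[OF l] by (subst sum.reindex) (auto simp: inj_on_def)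
    also have "\<dots> = (\<Sum>q\<in>pos_lists l. 1 / fact (length q))"
    proof (rule sum.cong)
      fix q assume "q \<in> pos_lists l"
      then have "q \<noteq> []" "[] \<notin> set q" using l by (auto simp: lists_of_def Lam_def)
      then show "1 / of_nat (card (star Q1 (Opn q))) = (1 / fact (length q) :: rat)"
        by (simp add: card_star_Q1)
    qed simp
    also have "\<dots> = 1 / of_nat (mono_fact l)" by (rule sum_pos_lists[OF l])
    finally show "(\<Sum>t | t \<in> Obj Q1 \<and> tmon t = l. 1 / of_nat (card (star Q1 t))) ^ Poly_Mapping.lookup m l =
      (1 / of_nat (mono_fact l) :: rat) ^ Poly_Mapping.lookup m l" by simp
  qed simp
  finally have "1 / of_nat (card (aut (S_grpd Q1) (rep (cls m)))) =
     (1 / (\<Prod>l\<in>Poly_Mapping.keys m. fact (Poly_Mapping.lookup m l) * of_nat (mono_fact l) ^ Poly_Mapping.lookup m l) :: rat)"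
    by (simp add: power_divide prod_dividef prod.distrib)
  moreover have "a = b" if "1 / a = 1 / b" for a b :: rat
    using that by (metis inverse_eq_divide inverse_inverse_eq)
  ultimately show ?thesis by blast
qed

section \<open>Comultiplication of the incidence bialgebra\<close>

text \<open>Composition of the leaf operations \<open>gss\<close> with the root \<open>q\<close>.\<close>

definition act :: "unit list list list \<Rightarrow> unit list list \<Rightarrow> unit list list"
  where "act gss q = concat (map2 (\<lambda>gs f. map (mulU f) gs) gss q)"

lemma act_simps [simp]: "act [] q = []" "act gss [] = []" "act (gs # gss) (f # q) = map (mulU f) gs @ act gss q"
  by (simp_all add: act_def)

definition dmon :: "atree \<Rightarrow> mono"
  where "dmon y = tmon (fo face1 y)"

lemma dmon_Lev: "dmon (Lev ts q) = cont length (act (map root_op ts) q)"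
  by (simp add: dmon_def fo_face1 tmon_def act_def)

text \<open>Multiplying by positive integers and concatenating nonempty lists never shrinks
  anything. The bounds confine both levels of a tree in terms of its composite and serve to prove
  finiteness.\<close>

lemma act_bounds:
  assumes "length gss = length q" "\<forall>gs\<in>set gss. gs \<noteq> [] \<and> [] \<notin> set gs" "[] \<notin> set q"
  shows "length gss \<le> length (act gss q) \<and> (\<forall>gs\<in>set gss. length gs \<le> length (act gss q)) \<and>
    (\<forall>f\<in>set q. \<exists>u\<in>set (act gss q). length f \<le> length u) \<and>
    (\<forall>gs\<in>set gss. \<forall>g\<in>set gs. \<exists>u\<in>set (act gss q). length g \<le> length u)"
  using assms
proof (induction gss q rule: list_induct2)
  case (Cons gs0 gss f0 q)
  let ?a = "act (gs0 # gss) (f0 # q)"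
  have gs0: "gs0 \<noteq> []" "[] \<notin> set gs0" and f0: "f0 \<noteq> []" using Cons.prems by auto
  have IH: "length gss \<le> length (act gss q)" "\<forall>gs\<in>set gss. length gs \<le> length (act gss q)"
    "\<forall>f\<in>set q. \<exists>u\<in>set (act gss q). length f \<le> length u"
    "\<forall>gs\<in>set gss. \<forall>g\<in>set gs. \<exists>u\<in>set (act gss q). length g \<le> length u"
    using Cons.IH Cons.prems by auto
  have len: "length ?a = length gs0 + length (act gss q)" "length gs0 > 0" using gs0 by simp_all
  have sub: "set (act gss q) \<subseteq> set ?a" by simp
  have leaf: "mulU f0 g \<in> set ?a" "length g \<le> length (mulU f0 g)" if "g \<in> set gs0" for g
    using that f0 by (auto simp: Suc_le_eq)
  have root: "mulU f0 (hd gs0) \<in> set ?a" "length f0 \<le> length (mulU f0 (hd gs0))"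
    using leaf(1)[of "hd gs0"] gs0 hd_in_set[OF gs0(1)] by (cases "hd gs0"; auto)+
  show ?case
  proof (intro conjI)
    show "length (gs0 # gss) \<le> length ?a" using IH(1) len by (cases gs0) simp_all
    show "\<forall>gs\<in>set (gs0 # gss). length gs \<le> length ?a" using IH(2) len(1) by auto
    show "\<forall>f\<in>set (f0 # q). \<exists>u\<in>set ?a. length f \<le> length u"
      using IH(3) root sub by (metis set_ConsD subsetD)
    show "\<forall>gs\<in>set (gs0 # gss). \<forall>g\<in>set gs. \<exists>u\<in>set ?a. length g \<le> length u"
      using IH(4) leaf sub by (metis set_ConsD subsetD)
  qed
qed simp

lemma act_pos: "[] \<notin> set q \<Longrightarrow> \<forall>gs\<in>set gss. [] \<notin> set gs \<Longrightarrow> [] \<notin> set (act gss q)"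
proof (induction gss q rule: list_induct2')
  case (4 gs gss f q)
  moreover have "[] \<notin> set (map (mulU f) gs)"
    using 4 by (auto dest!: sym[of "[]"])
  ultimately show ?case by simp
qed simp_all

definition graftings :: "unit list list \<Rightarrow> mono \<Rightarrow> unit list list list set"
  where "graftings q l = {gss. length gss = length q \<and> (\<forall>gs\<in>set gss. gs \<noteq> [] \<and> [] \<notin> set gs) \<and>
    cont length (act gss q) = l}"

text \<open>Two-level trees as bare lists, the root first; this is the form in which plethysm
  expands.\<close>

definition graft_pairs :: "mono \<Rightarrow> (unit list list \<times> unit list list list) set"
  where "graft_pairs l = (SIGMA q:{q. [] \<notin> set q}. graftings q l)"

lemma finite_graft_pairs: "finite (graft_pairs l)"
proof -
  \<comment> \<open>Bounds for the arity and for the entries of all operations of class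
    \<open>l\<close>; by \<open>act_bounds\<close> they bound both levels of the tree.\<close>
  define n where "n = Max (length ` pos_lists l)"
  define b where "b = Max (insert 0 (length ` (\<Union>q\<in>pos_lists l. set q)))"
  have fin_b: "finite {u :: unit list. length u \<le> b}"
    using finite_lists_length_le[of "UNIV :: unit set" b] by simp
  let ?B = "{gs. set gs \<subseteq> {u :: unit list. length u \<le> b} \<and> length gs \<le> n}"
  have fin_B: "finite ?B" by (rule finite_lists_length_le[OF fin_b])
  have "graft_pairs l \<subseteq> ?B \<times> {gss. set gss \<subseteq> ?B \<and> length gss \<le> n}"
  proof
    fix x assume "x \<in> graft_pairs l"
    then obtain q gss where x: "x = (q, gss)" and q: "[] \<notin> set q" and gss: "length gss = length q"
      "\<And>gs. gs \<in> set gss \<Longrightarrow> gs \<noteq> [] \<and> [] \<notin> set gs" "cont length (act gss q) = l"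
      by (auto simp: graft_pairs_def graftings_def)
    have act: "act gss q \<in> pos_lists l"
      using gss(3) act_pos[OF q, of gss] gss(2) by (auto simp: lists_of_def)
    have n: "length (act gss q) \<le> n"
      unfolding n_def using act finite_pos_lists by (intro Max_ge) auto
    have b: "length u \<le> b" if "u \<in> set (act gss q)" for u
      unfolding b_def using act that finite_pos_lists by (intro Max_ge) auto
    note L = act_bounds[OF gss(1) _ q]
    have 1: "length gss \<le> n" using L gss(2) n by (meson le_trans)
    have 2: "length f \<le> b" if "f \<in> set q" for f using L gss(2) b that by (meson le_trans)
    have 3: "length gs \<le> n" if "gs \<in> set gss" for gs using L gss(2) n that by (meson le_trans)
    have 4: "length g \<le> b" if "gs \<in> set gss" "g \<in> set gs" for g gs using L gss(2) b that by (meson le_trans)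
    show "x \<in> ?B \<times> {gss. set gss \<subseteq> ?B \<and> length gss \<le> n}"
      using 1 2 3 4 gss(1) by (auto simp: x)
  qed
  then show ?thesis
    by (rule finite_subset) (intro finite_cartesian_product fin_B finite_lists_length_le)
qed

definition tree_of :: "unit list list \<times> unit list list list \<Rightarrow> atree"
  where "tree_of x = Lev (map Opn (snd x)) (fst x)"

lemma fib_Q2:
  assumes "l \<in> Lam"
  shows "bij_betw tree_of (graft_pairs l) {y. y \<in> Obj Q2 \<and> dmon y = l}"
proof (rule bij_betw_imageI)
  show "inj_on tree_of (graft_pairs l)"
    by (auto simp: inj_on_def tree_of_def dest!: map_injective intro: injI)
  show "tree_of ` graft_pairs l = {y. y \<in> Obj Q2 \<and> dmon y = l}"
  proof (intro set_eqI iffI)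
    fix y assume "y \<in> tree_of ` graft_pairs l"
    then obtain q gss where y: "y = Lev (map Opn gss) q" "[] \<notin> set q" "gss \<in> graftings q l"
      by (auto simp: graft_pairs_def tree_of_def)
    \<comment> \<open>An empty tuple would compose to the exponent 0, which is not in
      \<open>Lam\<close>.\<close>
    then have "gss \<noteq> []" using assms by (auto simp: graftings_def Lam_def)
    then show "y \<in> {y. y \<in> Obj Q2 \<and> dmon y = l}"
      using y by (auto simp: graftings_def Obj_Q2 Obj_Q1 dmon_Lev comp_def)
  next
    fix y assume "y \<in> {y. y \<in> Obj Q2 \<and> dmon y = l}"
    then obtain ts q where y: "y = Lev ts q" "set ts \<subseteq> Obj Q1" "[] \<notin> set q" "length ts = length q" "dmon y = l"
      by (auto simp: Obj_Q2)
    have ts: "ts = map Opn (map root_op ts)"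
      using y(2) by (auto simp: Obj_Q1 subset_iff intro!: map_idI[symmetric])
    have "map root_op ts \<in> graftings q l"
      using y by (auto simp: graftings_def Obj_Q1 dmon_Lev subset_iff)
    then have "(q, map root_op ts) \<in> graft_pairs l" using y(3) by (simp add: graft_pairs_def)
    then show "y \<in> tree_of ` graft_pairs l"
      using y(1) ts by (intro image_eqI[of _ _ "(q, map root_op ts)"]) (simp_all add: tree_of_def)
  qed
qed

lemma finite_fib_Q2: "l \<in> Lam \<Longrightarrow> finite {y. y \<in> Obj Q2 \<and> dmon y = l}"
  using bij_betw_finite[OF fib_Q2] finite_graft_pairs by blast

section \<open>Linear extensions and the weights of trees\<close>

lemma lookup_bscale [simp]: "Poly_Mapping.lookup (bscale c v) k = c * Poly_Mapping.lookup v k"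
  by (simp add: bscale_def Poly_Mapping.map.rep_eq when_def)

lemma bscale_simps [simp]: "bscale 0 v = 0" "bscale c 0 = 0" "bscale 1 v = v"
  by (simp_all add: poly_mapping_eq_iff fun_eq_iff)

lemma bscale_add: "bscale (a + b) v = bscale a v + bscale b v" "bscale c (u + v) = bscale c u + bscale c v"
  by (simp_all add: poly_mapping_eq_iff fun_eq_iff lookup_add algebra_simps)

lemma bscale_bscale: "bscale a (bscale b v) = bscale (a * b) v"
  by (simp add: poly_mapping_eq_iff fun_eq_iff)

lemma bscale_sum: "bscale c (sum f A) = (\<Sum>a\<in>A. bscale c (f a))" "bscale (sum g A) v = (\<Sum>a\<in>A. bscale (g a) v)"
  by (induction A rule: infinite_finite_induct) (simp_all add: bscale_add)

lemma lin_ext_superset: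
  assumes "finite S" "Poly_Mapping.keys v \<subseteq> S"
  shows "lin_ext f v = (\<Sum>a\<in>S. bscale (Poly_Mapping.lookup v a) (f a))"
  unfolding lin_ext_def by (rule sum.mono_neutral_left) (use assms in \<open>auto simp: in_keys_iff\<close>)

lemma lin_ext_single [simp]: "lin_ext f (Poly_Mapping.single a c) = bscale c (f a)"
  by (subst lin_ext_superset[of "{a}"]) auto

lemma lin_ext_add: "lin_ext f (u + v) = lin_ext f u + lin_ext f v"
proof -
  let ?S = "Poly_Mapping.keys u \<union> Poly_Mapping.keys v"
  have "Poly_Mapping.keys (u + v) \<subseteq> ?S" by (rule Poly_Mapping.keys_add)
  then show ?thesis
    by (simp add: lin_ext_superset[of ?S] lookup_add bscale_add sum.distrib)
qed

lemma lin_ext_0 [simp]: "lin_ext f 0 = 0"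
  by (simp add: lin_ext_def)

lemma lin_ext_sum: "lin_ext f (sum g A) = (\<Sum>a\<in>A. lin_ext f (g a))"
  by (induction A rule: infinite_finite_induct) (simp_all add: lin_ext_add)

lemma lin_ext_bscale: "lin_ext f (bscale c v) = bscale c (lin_ext f v)"
  by (subst lin_ext_superset[of "Poly_Mapping.keys v"])
    (auto simp: in_keys_iff bscale_bscale bscale_sum lin_ext_def)

text \<open>An element of the tensor square, with the leaves in the first factor and the root in the
  second. Multiplication there corresponds to juxtaposition of trees.\<close>

definition tree_weight :: "atree \<Rightarrow> (amono \<times> amono \<Rightarrow>\<^sub>0 rat)"
  where "tree_weight y = Poly_Mapping.single (amon (subs y), Poly_Mapping.single (tmon y) 1) (1 / of_nat (card (star Q2 y)))"

text \<open>The factor is the order of the automorphism group of one operation of class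
  \<open>l\<close>; \<open>Poly_Mapping.single 0 c\<close> is the scalar \<open>c\<close>.\<close>

definition comult_gen :: "mono \<Rightarrow> (amono \<times> amono \<Rightarrow>\<^sub>0 rat)"
  where "comult_gen l = Poly_Mapping.single 0 (of_nat (mono_fact l)) * (\<Sum>y | y \<in> Obj Q2 \<and> dmon y = l. tree_weight y)"

definition comult_mono :: "amono \<Rightarrow> (amono \<times> amono \<Rightarrow>\<^sub>0 rat)"
  where "comult_mono m = (\<Prod>l\<in>Poly_Mapping.keys m. comult_gen l ^ Poly_Mapping.lookup m l)"

lemma single_0_hom:
  "Poly_Mapping.single 0 (a * b) = (Poly_Mapping.single 0 a * Poly_Mapping.single 0 b :: 'a :: comm_monoid_add \<Rightarrow>\<^sub>0 rat)"
  by (simp add: mult_single)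

lemma single_0_prod:
  "(Poly_Mapping.single 0 (prod f A) :: 'a :: comm_monoid_add \<Rightarrow>\<^sub>0 rat) = (\<Prod>a\<in>A. Poly_Mapping.single 0 (f a))"
  by (induction A rule: infinite_finite_induct) (simp_all add: single_0_hom del: mult_single)

lemma single_0_power:
  "(Poly_Mapping.single 0 (c ^ n) :: 'a :: comm_monoid_add \<Rightarrow>\<^sub>0 rat) = Poly_Mapping.single 0 c ^ n"
  by (induction n) (simp_all add: single_0_hom del: mult_single)

lemma prod_tree_weight: "(\<Prod>y\<leftarrow>x. tree_weight y) =
  Poly_Mapping.single (amon (concat (map subs x)), cont tmon x) (1 / of_nat (\<Prod>y\<leftarrow>x. card (star Q2 y)))"
  by (induction x) (simp_all add: tree_weight_def mult_single amon_def zero_prod_def[symmetric])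

text \<open>Expand the product of generators over tuples of trees. The order of the automorphism
  group accounts for the factor of each generator and for the factorials in the exponential formula;
  the remaining 1/n! completes the stars of the trees to the star of the tuple.\<close>

lemma comult_mono_eq:
  assumes m: "m \<in> amonos" "m \<noteq> 0"
  shows "comult_mono m = (\<Sum>x\<in>lists_of (Obj Q2) dmon m.
    Poly_Mapping.single (amon (concat (map subs x)), cont tmon x)
      (of_nat (card (aut (S_grpd Q1) (rep (cls m)))) / of_nat (card (star (S_grpd Q2) x))))"
proof -
  let ?C = "Poly_Mapping.single 0 :: rat \<Rightarrow> (amono \<times> amono \<Rightarrow>\<^sub>0 rat)"
  let ?aut = "of_nat (card (aut (S_grpd Q1) (rep (cls m)))) :: rat"
  let ?w = "\<lambda>l. \<Sum>y | y \<in> Obj Q2 \<and> dmon y = l. tree_weight y"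
  let ?k = "Poly_Mapping.keys m" and ?m = "Poly_Mapping.lookup m"
  have finl: "finite {y \<in> Obj Q2. dmon y = l}" if "l \<in> Poly_Mapping.keys m" for l
    by (rule finite_fib_Q2) (use m that in \<open>auto simp: amonos_def\<close>)
  have "?aut * (1 / (\<Prod>l\<in>?k. fact (?m l))) = (\<Prod>l\<in>?k. of_nat (mono_fact l) ^ ?m l)"
    by (simp add: card_aut_cls[OF m] prod.distrib)
  moreover have "comult_mono m = (\<Prod>l\<in>?k. ?C (of_nat (mono_fact l)) ^ ?m l) * (\<Prod>l\<in>?k. ?w l ^ ?m l)"
    by (simp only: comult_mono_def comult_gen_def power_mult_distrib prod.distrib)
  ultimately have "comult_mono m = ?C (?aut * (1 / (\<Prod>l\<in>?k. fact (?m l)))) * (\<Prod>l\<in>?k. ?w l ^ ?m l)"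
    by (simp only: single_0_prod single_0_power)
  also have "\<dots> = ?C ?aut * (?C (1 / (\<Prod>l\<in>?k. fact (?m l))) * (\<Prod>l\<in>?k. ?w l ^ ?m l))"
    by (simp only: single_0_hom mult.assoc)
  also have "?C (1 / (\<Prod>l\<in>?k. fact (?m l))) * (\<Prod>l\<in>?k. ?w l ^ ?m l) =
      (\<Sum>x\<in>lists_of (Obj Q2) dmon m. ?C (1 / fact (length x)) * (\<Prod>y\<leftarrow>x. tree_weight y))"
    by (rule sum_lists_of[of m "Obj Q2" dmon ?C, OF finl, symmetric]) (simp_all add: single_0_hom del: mult_single)
  also have "?C ?aut * \<dots> = (\<Sum>x\<in>lists_of (Obj Q2) dmon m. ?C ?aut * (?C (1 / fact (length x)) * (\<Prod>y\<leftarrow>x. tree_weight y)))"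
    by (rule sum_distrib_left)
  also have "\<dots> = (\<Sum>x\<in>lists_of (Obj Q2) dmon m.
      Poly_Mapping.single (amon (concat (map subs x)), cont tmon x) (?aut / of_nat (card (star (S_grpd Q2) x))))"
  proof (rule sum.cong)
    fix x assume x: "x \<in> lists_of (Obj Q2) dmon m"
    then have "x \<noteq> []" using m by (auto simp: lists_of_def)
    then show "?C ?aut * (?C (1 / fact (length x)) * (\<Prod>y\<leftarrow>x. tree_weight y)) =
      Poly_Mapping.single (amon (concat (map subs x)), cont tmon x) (?aut / of_nat (card (star (S_grpd Q2) x)))"
      by (simp add: prod_tree_weight mult_single card_star_S[OF fin_star_Q2] zero_prod_def[symmetric] del: single_of_nat)
  qed simp
  finally show ?thesis .
qed

lemma bar_Ass_faces_fo:
  assumes "x \<in> Obj (S_grpd Q2)"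
  shows "fo (face bar_Ass 2 1) x = map (fo face1) x" "fo (face bar_Ass 2 2) x = concat (map subs x)"
    "amon (fo (face bar_Ass 2 0) x) = cont tmon x"
proof -
  show "fo (face bar_Ass 2 1) x = map (fo face1) x" by (simp only: bar_Ass_face S_map_simps)
  have "fo (below_f AssS) y = subs y" if "y \<in> Obj Q2" for y
    by (subst Obj_Q2_Lev[OF that]) (simp add: below_f_def)
  then have below: "map (fo (below_f AssS)) x = map subs x" using assms by auto
  show "fo (face bar_Ass 2 2) x = concat (map subs x)"
    by (simp only: bar_Ass_face gf_comp_def S_map_simps gfun.simps comp_apply S_mu_simps below)
  show "amon (fo (face bar_Ass 2 0) x) = cont tmon x"
    by (simp add: bar_Ass_face amon_def cont_def tmon_def graft_f_def gf_comp_def gf_pair_def root_f_def comp_def)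
qed

lemma cls_iff:
  assumes "c \<in> pi0 (S_grpd Q1)" "L \<in> Obj (S_grpd Q1)"
  shows "L \<in> c \<longleftrightarrow> c = cls (amon L)"
  using assms by (auto simp: pi0_SQ1 cls_def)

text \<open>Both sides are one sum over the tuples of trees that compose to \<open>m\<close>: the
  incidence coefficients group them by the pair \<open>psi\<close> of classes, the product of
  generators lists them singly.\<close>

lemma inc_comult_cls:
  assumes m: "m \<in> amonos" "m \<noteq> 0"
  shows "inc_comult bar_Ass (Some (cls m)) = lin_ext (\<lambda>(a, b). delta (hb a, hb b)) (comult_mono m)"
proof -
  let ?S = "lists_of (Obj Q2) dmon m" and ?pi = "pi0 (S_grpd Q1)"
  let ?aut = "of_nat (card (aut (S_grpd Q1) (rep (cls m)))) :: rat"
  let ?wt = "\<lambda>x. ?aut / of_nat (card (star (S_grpd Q2) x))"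
  define psi where "psi x = (cls (amon (fo (face bar_Ass 2 2) x)), cls (amon (fo (face bar_Ass 2 0) x)))" for x
  let ?v = "\<lambda>(a, b). delta (Some a, Some b) :: (atree list set option \<times> atree list set option \<Rightarrow>\<^sub>0 rat)"
  have c: "cls m \<in> ?pi" using m by (auto simp: pi0_SQ1)
  have finS: "finite ?S"
    by (rule finite_lists_of, rule finite_fib_Q2) (use m in \<open>auto simp: amonos_def\<close>)
  have faces: "fo (face bar_Ass 2 i) x \<in> Obj (S_grpd Q1)" if "i \<le> 2" "x \<in> Obj (S_grpd Q2)" for i x
    using gfunctor_Obj[OF gfunctor_bar_Ass_face[OF that(1)]] that(2) by (simp only: bar_Ass_level)
  have S: "?S = {x \<in> Obj (S_grpd Q2). fo (face bar_Ass 2 1) x \<in> cls m}"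
  proof -
    have "amon (map (fo face1) x) = cont dmon x" for x
      by (simp add: amon_def cont_def dmon_def comp_def)
    then have "fo (face bar_Ass 2 1) x \<in> cls m \<longleftrightarrow> cont dmon x = m" if "x \<in> Obj (S_grpd Q2)" for x
      using faces[of 1 x] that bar_Ass_faces_fo(1)[OF that] by (simp add: cls_def del: Obj_S_grpd)
    moreover have "?S = {x \<in> Obj (S_grpd Q2). cont dmon x = m}"
      using m(2) by (auto simp: lists_of_def)
    ultimately show ?thesis by blast
  qed
  have coeff: "inc_coeff bar_Ass (cls m) a b = (\<Sum>x | x \<in> ?S \<and> psi x = (a, b). ?wt x)" if "a \<in> ?pi" "b \<in> ?pi" for a b
  proof -
    have "inc_coeff bar_Ass (cls m) a b = ?aut * (\<Sum>x | x \<in> Obj (S_grpd Q2) \<and> fo (face bar_Ass 2 1) x \<in> cls m \<and>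
        fo (face bar_Ass 2 2) x \<in> a \<and> fo (face bar_Ass 2 0) x \<in> b. 1 / of_nat (card (star (S_grpd Q2) x)))"
      using inc_coeff_eq[of bar_Ass "cls m" a b, unfolded bar_Ass_level, OF grpd_SQ1 grpd_SQ2 _ fin_star_SQ1 fin_star_SQ2 c that]
        gfunctor_bar_Ass_face[unfolded bar_Ass_level] finS unfolding S by blast
    also have "\<dots> = (\<Sum>x | x \<in> Obj (S_grpd Q2) \<and> fo (face bar_Ass 2 1) x \<in> cls m \<and>
        fo (face bar_Ass 2 2) x \<in> a \<and> fo (face bar_Ass 2 0) x \<in> b. ?wt x)"
      by (simp add: sum_distrib_left)
    also have "\<dots> = (\<Sum>x | x \<in> ?S \<and> psi x = (a, b). ?wt x)"
    proof (rule sum.cong[OF Collect_cong])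
      fix x
      have "x \<in> Obj (S_grpd Q2) \<Longrightarrow> fo (face bar_Ass 2 2) x \<in> a \<and> fo (face bar_Ass 2 0) x \<in> b \<longleftrightarrow> psi x = (a, b)"
        using cls_iff[OF that(1) faces[of 2 x]] cls_iff[OF that(2) faces[of 0 x]]
        by (simp add: psi_def eq_commute del: Obj_S_grpd)
      then show "(x \<in> Obj (S_grpd Q2) \<and> fo (face bar_Ass 2 1) x \<in> cls m \<and> fo (face bar_Ass 2 2) x \<in> a \<and> fo (face bar_Ass 2 0) x \<in> b)
          = (x \<in> ?S \<and> psi x = (a, b))"
        unfolding S by blast
    qed simp
    finally show ?thesis .
  qed
  have psi: "psi ` ?S \<subseteq> ?pi \<times> ?pi"
    using faces amon_amonos by (auto simp: psi_def S pi0_SQ1 simp del: Obj_S_grpd)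
  have "inc_comult bar_Ass (Some (cls m)) =
      (\<Sum>p\<in>{(a, b) \<in> ?pi \<times> ?pi. inc_coeff bar_Ass (cls m) a b \<noteq> 0}. bscale (inc_coeff bar_Ass (cls m) (fst p) (snd p)) (?v p))"
    by (simp add: bar_Ass_level[unfolded One_nat_def] case_prod_unfold)
  \<comment> \<open>A pair that no tuple realises has an empty sum as coefficient.\<close>
  also have "\<dots> = (\<Sum>p\<in>psi ` ?S. bscale (inc_coeff bar_Ass (cls m) (fst p) (snd p)) (?v p))"
  proof (rule sum.mono_neutral_left)
    show "{(a, b) \<in> ?pi \<times> ?pi. inc_coeff bar_Ass (cls m) a b \<noteq> 0} \<subseteq> psi ` ?S"
    proof clarify
      fix a b assume ab: "a \<in> ?pi" "b \<in> ?pi" "inc_coeff bar_Ass (cls m) a b \<noteq> 0"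
      have "{x. x \<in> ?S \<and> psi x = (a, b)} = {}" if "(a, b) \<notin> psi ` ?S"
        using that by (metis (mono_tags, lifting) empty_Collect_eq image_eqI)
      then show "(a, b) \<in> psi ` ?S" using coeff[OF ab(1,2)] ab(3) by (metis (no_types, lifting) sum.empty)
    qed
    show "\<forall>p\<in>psi ` ?S - {(a, b) \<in> ?pi \<times> ?pi. inc_coeff bar_Ass (cls m) a b \<noteq> 0}.
        bscale (inc_coeff bar_Ass (cls m) (fst p) (snd p)) (?v p) = 0"
    proof
      fix p assume p: "p \<in> psi ` ?S - {(a, b) \<in> ?pi \<times> ?pi. inc_coeff bar_Ass (cls m) a b \<noteq> 0}"
      then have "p \<in> ?pi \<times> ?pi" using psi by blast
      with p have "inc_coeff bar_Ass (cls m) (fst p) (snd p) = 0" by (cases p) auto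
      then show "bscale (inc_coeff bar_Ass (cls m) (fst p) (snd p)) (?v p) = 0" by simp
    qed
  qed (use finS in simp)
  also have "\<dots> = (\<Sum>p\<in>psi ` ?S. \<Sum>x | x \<in> ?S \<and> psi x = p. bscale (?wt x) (?v (psi x)))"
  proof (rule sum.cong)
    fix p assume "p \<in> psi ` ?S"
    then have "p \<in> ?pi \<times> ?pi" using psi by blast
    then have "inc_coeff bar_Ass (cls m) (fst p) (snd p) = (\<Sum>x | x \<in> ?S \<and> psi x = p. ?wt x)"
      using coeff[of "fst p" "snd p"] by (simp only: mem_Times_iff prod.collapse)
    then show "bscale (inc_coeff bar_Ass (cls m) (fst p) (snd p)) (?v p) = (\<Sum>x | x \<in> ?S \<and> psi x = p. bscale (?wt x) (?v (psi x)))"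
      by (simp add: bscale_sum)
  qed simp
  also have "\<dots> = (\<Sum>x\<in>?S. bscale (?wt x) (?v (psi x)))"
    by (rule sum.image_gen[OF finS, symmetric])
  also have "\<dots> = lin_ext (\<lambda>(a, b). delta (hb a, hb b)) (comult_mono m)"
    unfolding comult_mono_eq[OF m] lin_ext_sum lin_ext_single
  proof (rule sum.cong)
    fix x assume "x \<in> ?S"
    then have x: "x \<in> Obj (S_grpd Q2)" by (simp add: S)
    \<comment> \<open>Neither component is the monomial 1, so \<open>hb\<close> avoids the adjoined
      unit.\<close>
    have "amon (concat (map subs x)) \<noteq> 0" "cont tmon x \<noteq> 0"
      using amon_amonos[OF faces[of 2, OF _ x]] amon_amonos[OF faces[of 0, OF _ x]] bar_Ass_faces_fo[OF x] by simp_all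
    then have "?v (psi x) = delta (hb (amon (concat (map subs x))), hb (cont tmon x))"
      by (simp add: psi_def bar_Ass_faces_fo[OF x] hb_def)
    then show "bscale (?wt x) (?v (psi x)) =
        bscale (?wt x) (case (amon (concat (map subs x)), cont tmon x) of (a, b) \<Rightarrow> delta (hb a, hb b))" by simp
  qed simp
  finally show ?thesis .
qed

section \<open>Plethysm in terms of two-level trees\<close>

lemma coef_mult: "coef (F * G) l = (\<Sum>p\<in>splits l. coef F (fst p) * coef G (snd p))"
  by (simp add: times_mps_def case_prod_unfold)

lemma coef_var: "coef (mps_var i) l = (if l = Poly_Mapping.single i 1 then 1 else 0)"
  by (simp add: mps_var_def)

lemma coef_prod_var:
  "coef (\<Prod>g\<leftarrow>gs. mps_var (v g)) m = (if cont v gs = m then 1 else 0)"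
proof (induction gs arbitrary: m)
  case Nil
  show ?case by (auto simp: one_mps_def)
next
  case (Cons g gs)
  have "coef (\<Prod>g\<leftarrow>g # gs. mps_var (v g)) m =
      (\<Sum>p\<in>splits m. coef (mps_var (v g)) (fst p) * coef (\<Prod>g\<leftarrow>gs. mps_var (v g)) (snd p))"
    by (simp add: coef_mult)
  also have "\<dots> = (\<Sum>p\<in>splits m. if p = (Poly_Mapping.single (v g) 1, cont v gs) then 1 else 0)"
    by (rule sum.cong) (auto simp: Cons.IH coef_var)
  finally show ?case by (simp add: sum.delta) (simp add: splits_def)
qed

text \<open>Passes between a monomial and any list that represents it.\<close>

lemma prod_cont:
  fixes h :: "'k \<Rightarrow> 'r :: comm_monoid_mult"
  shows "(\<Prod>k\<in>Poly_Mapping.keys (cont v L). h k ^ Poly_Mapping.lookup (cont v L) k) = (\<Prod>a\<leftarrow>L. h (v a))"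
  using prod_list_mset[of h "map v L"] by (simp add: comp_def keys_cont lookup_cont)

lemma mono_fact_nonzero: "mono_fact l \<noteq> 0"
  by (simp add: mono_fact_def)

text \<open>The lists with content \<open>l\<close> have total weight 1/l!, which cancels the factor
  in \<open>a_coef\<close>; outside \<open>Lam\<close> the coefficient is 0.\<close>

lemma coef_eq_sum:
  assumes "F \<in> pseries"
  shows "coef F l = (\<Sum>q\<in>pos_lists l. a_coef l F / fact (length q))"
proof (cases "l \<in> Lam")
  case True
  have "(\<Sum>q\<in>pos_lists l. a_coef l F / fact (length q)) = a_coef l F * (\<Sum>q\<in>pos_lists l. 1 / fact (length q))"
    by (simp add: sum_distrib_left)
  then show ?thesis
    using mono_fact_nonzero[of l] by (simp add: sum_pos_lists[OF True] a_coef_def)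
next
  case False
  then show ?thesis using assms by (simp add: pseries_def a_coef_def)
qed

text \<open>\<open>Sum_any\<close> is 0 when the support is infinite. Writing each summand as a sum
  over a fibre of \<open>g\<close> in a finite set bounds the support and evaluates the sum at
  once.\<close>

lemma Sum_any_group:
  fixes f :: "'b \<Rightarrow> 'c :: comm_monoid_add"
  assumes H: "finite H" and f: "\<And>k. f k = (\<Sum>x | x \<in> H \<and> g x = k. h x)"
  shows "Sum_any f = (\<Sum>x\<in>H. h x)"
proof -
  have "f k = 0" if "k \<notin> g ` H" for k
    unfolding f using that by (intro sum.neutral) auto
  then have "Sum_any f = (\<Sum>k\<in>g ` H. f k)"
    by (intro Sum_any.expand_superset) (use H in auto)
  then show ?thesis
    unfolding f by (simp add: sum.image_gen[OF H, of h g])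
qed

text \<open>\<open>a_coef\<close> times the share 1/n! that one list has in 1/\<lambda>!.\<close>

definition branch_weight :: "mps \<Rightarrow> unit list list \<Rightarrow> rat"
  where "branch_weight F gs = a_coef (cont length gs) F / fact (length gs)"

text \<open>The operations that acquire class \<open>m\<close> when grafted onto a root entry
  \<open>u\<close>.\<close>

definition branches :: "unit list \<Rightarrow> mono \<Rightarrow> unit list list set"
  where "branches u m = {gs. gs \<noteq> [] \<and> [] \<notin> set gs \<and> cont length (map (mulU u) gs) = m}"

lemma finite_graftings: "[] \<notin> set q \<Longrightarrow> finite (graftings q l)"
  by (rule finite_subset[OF _ finite_imageI[OF finite_graft_pairs[of l], of snd]])
    (force simp: graft_pairs_def)

text \<open>A branch is a tree whose root has one input.\<close>

lemma finite_branches: "u \<noteq> [] \<Longrightarrow> finite (branches u m)"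
proof -
  assume "u \<noteq> []"
  then have "finite ((\<lambda>gs. [gs]) -` graftings [u] m)"
    by (intro finite_vimageI finite_graftings injI) auto
  then show ?thesis
    by (rule finite_subset[rotated]) (auto simp: branches_def graftings_def)
qed

lemma cont_eq_0_iff: "cont v as = 0 \<longleftrightarrow> as = []"
  by (metis keys_cont keys_eq_empty image_is_empty set_empty)

lemma cont_map: "cont v (map f xs) = cont (v \<circ> f) xs"
  by (simp add: cont_def comp_def)

text \<open>Replacing \<open>x_i\<close> by \<open>x_{ik}\<close> multiplies the entries of a list
  by \<open>k\<close>, which is grafting onto a root entry of length \<open>k\<close>.\<close>

lemma coef_dilate:
  assumes F: "F \<in> pseries" and u: "u \<noteq> []"
  shows "coef (dilate (length u) F) m = (\<Sum>gs\<in>branches u m. branch_weight F gs)"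
proof -
  have "coef F l * coef (\<Prod>k\<in>Poly_Mapping.keys l. mps_var (k * length u) ^ Poly_Mapping.lookup l k) m =
      (\<Sum>gs | gs \<in> branches u m \<and> cont length gs = l. branch_weight F gs)" for l
  proof (cases "l = 0")
    case True
    \<comment> \<open>The absence of a constant term matches the exclusion of the empty list from
      \<open>branches\<close>.\<close>
    have "coef F 0 = 0" using F by (simp add: pseries_def Lam_def)
    moreover have "(\<Sum>gs | gs \<in> branches u m \<and> cont length gs = 0. branch_weight F gs) = 0"
      by (rule sum.neutral) (auto simp: branches_def cont_eq_0_iff)
    ultimately show ?thesis using True by simp
  next
    case False
    let ?c = "coef (\<Prod>k\<in>Poly_Mapping.keys l. mps_var (k * length u) ^ Poly_Mapping.lookup l k) m"
    have c: "?c = (if cont length (map (mulU u) gs) = m then 1 else 0)" if "gs \<in> pos_lists l" for gs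
    proof -
      have "l = cont length gs" using that by (simp add: lists_of_def)
      then have "?c = coef (\<Prod>g\<leftarrow>gs. mps_var (length g * length u)) m"
        using prod_cont[of "\<lambda>k. mps_var (k * length u)" length gs] by simp
      then show ?thesis by (simp add: coef_prod_var cont_map comp_def mult.commute)
    qed
    have "coef F l * ?c = (\<Sum>gs\<in>pos_lists l. a_coef l F / fact (length gs) * ?c)"
      by (simp only: coef_eq_sum[OF F] sum_distrib_right)
    also have "\<dots> = (\<Sum>gs\<in>pos_lists l. if cont length (map (mulU u) gs) = m then branch_weight F gs else 0)"
      by (rule sum.cong) (auto simp: c branch_weight_def lists_of_def)
    also have "\<dots> = (\<Sum>gs | gs \<in> pos_lists l \<and> cont length (map (mulU u) gs) = m. branch_weight F gs)"
      by (rule sum.inter_filter[OF finite_pos_lists, symmetric])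
    also have "\<dots> = (\<Sum>gs | gs \<in> branches u m \<and> cont length gs = l. branch_weight F gs)"
      by (rule sum.cong) (use False in \<open>auto simp: lists_of_def branches_def\<close>)
    finally show ?thesis .
  qed
  from Sum_any_group[OF finite_branches[OF u] this] show ?thesis
    by (simp add: dilate_def mps_subst_def)
qed

text \<open>For a fixed split of \<open>l\<close>, the branch on the first root entry and those on
  the others are chosen independently.\<close>

lemma graftings_Cons:
  assumes "m + n = l"
  shows "{L \<in> graftings (u # q) l. (cont length (map (mulU u) (hd L)), cont length (act (tl L) q)) = (m, n)} =
    (\<lambda>(gs, gss). gs # gss) ` (branches u m \<times> graftings q n)"
proof (intro set_eqI iffI)
  fix L
  assume L: "L \<in> {L \<in> graftings (u # q) l. (cont length (map (mulU u) (hd L)), cont length (act (tl L) q)) = (m, n)}"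
  then obtain gs gss where "L = gs # gss" by (auto simp: graftings_def length_Suc_conv)
  with L show "L \<in> (\<lambda>(gs, gss). gs # gss) ` (branches u m \<times> graftings q n)"
    by (auto simp: graftings_def branches_def)
qed (use assms in \<open>auto simp: graftings_def branches_def\<close>)

text \<open>Each factor expands over one branch, so the product expands over graftings; the
  induction splits off the first root entry.\<close>

lemma coef_prod_dilate:
  assumes F: "F \<in> pseries" and q: "[] \<notin> set q"
  shows "coef (\<Prod>u\<leftarrow>q. dilate (length u) F) l = (\<Sum>gss\<in>graftings q l. \<Prod>gs\<leftarrow>gss. branch_weight F gs)"
  using q
proof (induction q arbitrary: l)
  case Nil
  have "graftings [] l = (if l = 0 then {[]} else {})" by (auto simp: graftings_def)
  then show ?case by (simp add: one_mps_def)
next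
  case (Cons u q)
  let ?g = "\<lambda>L. (cont length (map (mulU u) (hd L)), cont length (act (tl L) q))"
  let ?h = "\<lambda>L. \<Prod>gs\<leftarrow>L. branch_weight F gs"
  have inj: "inj_on (\<lambda>x. fst x # snd x) A" for A :: "(unit list list \<times> unit list list list) set"
    by (auto simp: inj_on_def)
  have "coef (\<Prod>u\<leftarrow>u # q. dilate (length u) F) l =
      (\<Sum>p\<in>splits l. (\<Sum>gs\<in>branches u (fst p). branch_weight F gs) * (\<Sum>gss\<in>graftings q (snd p). ?h gss))"
    using Cons by (auto simp: coef_mult coef_dilate[OF F] intro!: sum.cong)
  also have "\<dots> = (\<Sum>p\<in>splits l. \<Sum>L | L \<in> graftings (u # q) l \<and> ?g L = p. ?h L)"
  proof (rule sum.cong)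
    fix p assume "p \<in> splits l"
    then have p: "fst p + snd p = l" by (auto simp: splits_def)
    have "{L. L \<in> graftings (u # q) l \<and> ?g L = p} =
        (\<lambda>(gs, gss). gs # gss) ` (branches u (fst p) \<times> graftings q (snd p))"
      using graftings_Cons[OF p, of u q] by simp
    then show "(\<Sum>gs\<in>branches u (fst p). branch_weight F gs) * (\<Sum>gss\<in>graftings q (snd p). ?h gss) =
        (\<Sum>L | L \<in> graftings (u # q) l \<and> ?g L = p. ?h L)"
      by (simp add: sum.reindex[OF inj] sum_product sum.cartesian_product case_prod_unfold)
  qed simp
  also have "\<dots> = (\<Sum>L\<in>graftings (u # q) l. ?h L)"
  proof (rule sum.group)
    show "?g ` graftings (u # q) l \<subseteq> splits l"
      by (auto simp: splits_def graftings_def length_Suc_conv)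
  qed (use finite_graftings[OF Cons.prems] in simp_all)
  finally show ?case .
qed

text \<open>The lists that represent a monomial of \<open>G\<close> are the possible roots, and
  their entries select the dilations of \<open>F\<close>.\<close>

lemma coef_plethysm:
  assumes F: "F \<in> pseries" and G: "G \<in> pseries"
  shows "coef (G \<circledast> F) l = (\<Sum>x\<in>graft_pairs l. branch_weight G (fst x) * (\<Prod>gs\<leftarrow>snd x. branch_weight F gs))"
proof -
  have "coef G m * coef (\<Prod>k\<in>Poly_Mapping.keys m. dilate k F ^ Poly_Mapping.lookup m k) l =
      (\<Sum>x | x \<in> graft_pairs l \<and> cont length (fst x) = m. branch_weight G (fst x) * (\<Prod>gs\<leftarrow>snd x. branch_weight F gs))" for m
  proof -
    let ?c = "coef (\<Prod>k\<in>Poly_Mapping.keys m. dilate k F ^ Poly_Mapping.lookup m k) l"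
    have c: "?c = (\<Sum>gss\<in>graftings q l. \<Prod>gs\<leftarrow>gss. branch_weight F gs)" if "q \<in> pos_lists m" for q
    proof -
      have "m = cont length q" "[] \<notin> set q" using that by (auto simp: lists_of_def)
      then show ?thesis
        using prod_cont[of "\<lambda>k. dilate k F" length q] coef_prod_dilate[OF F, of q l] by simp
    qed
    have "coef G m * ?c = (\<Sum>q\<in>pos_lists m. a_coef m G / fact (length q) * ?c)"
      by (simp only: coef_eq_sum[OF G] sum_distrib_right)
    also have "\<dots> = (\<Sum>q\<in>pos_lists m. \<Sum>gss\<in>graftings q l. branch_weight G q * (\<Prod>gs\<leftarrow>gss. branch_weight F gs))"
    proof (rule sum.cong)
      fix q assume q: "q \<in> pos_lists m"
      then have "a_coef m G / fact (length q) = branch_weight G q" by (auto simp: lists_of_def branch_weight_def)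
      then show "a_coef m G / fact (length q) * ?c = (\<Sum>gss\<in>graftings q l. branch_weight G q * (\<Prod>gs\<leftarrow>gss. branch_weight F gs))"
        by (simp add: c[OF q] sum_distrib_left)
    qed simp
    also have "\<dots> = (\<Sum>x\<in>(SIGMA q:pos_lists m. graftings q l). branch_weight G (fst x) * (\<Prod>gs\<leftarrow>snd x. branch_weight F gs))"
      by (subst sum.Sigma) (use finite_pos_lists finite_graftings in \<open>auto simp: case_prod_unfold lists_of_def\<close>)
    also have "\<dots> = (\<Sum>x | x \<in> graft_pairs l \<and> cont length (fst x) = m. branch_weight G (fst x) * (\<Prod>gs\<leftarrow>snd x. branch_weight F gs))"
      by (rule sum.cong) (auto simp: graft_pairs_def lists_of_def)
    finally show ?thesis .
  qed
  from Sum_any_group[OF finite_graft_pairs this] show ?thesis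
    by (simp add: plethysm_def mps_subst_def)
qed

section \<open>Evaluation of tensors on pairs of series\<close>

lemma eval2_superset:
  assumes "finite S" "Poly_Mapping.keys w \<subseteq> S"
  shows "eval2 w F G = (\<Sum>p\<in>S. Poly_Mapping.lookup w p * eval_amono (fst p) F * eval_amono (snd p) G)"
  unfolding eval2_def case_prod_unfold prod.collapse
  by (rule sum.mono_neutral_left) (use assms in \<open>auto simp: in_keys_iff\<close>)

lemma eval2_add: "eval2 (u + w) F G = eval2 u F G + eval2 w F G"
proof -
  let ?S = "Poly_Mapping.keys u \<union> Poly_Mapping.keys w"
  have "Poly_Mapping.keys (u + w) \<subseteq> ?S" by (rule Poly_Mapping.keys_add)
  then show ?thesis
    by (simp add: eval2_superset[of ?S] lookup_add distrib_right sum.distrib)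
qed

lemma eval2_single: "eval2 (Poly_Mapping.single p c) F G = c * eval_amono (fst p) F * eval_amono (snd p) G"
  by (subst eval2_superset[of "{p}"]) auto

lemma eval2_sum: "eval2 (sum f A) F G = (\<Sum>a\<in>A. eval2 (f a) F G)"
  by (induction A rule: infinite_finite_induct) (simp_all add: eval2_add, simp_all add: eval2_def)

lemma eval_amono_cont: "eval_amono (cont v L) F = (\<Prod>a\<leftarrow>L. a_coef (v a) F)"
  unfolding eval_amono_def by (rule prod_cont)

lemma comult_gen_eq: "comult_gen l = (\<Sum>y | y \<in> Obj Q2 \<and> dmon y = l.
    Poly_Mapping.single (amon (subs y), Poly_Mapping.single (tmon y) 1)
      (of_nat (mono_fact l) / of_nat (card (star Q2 y))))"
  by (simp add: comult_gen_def sum_distrib_left tree_weight_def mult_single zero_prod_def[symmetric] del: single_of_nat)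

text \<open>The star of a tree has n! times the factorials of the arities of its subtrees as its
  size, which is exactly the product of the denominators in the branch weights.\<close>

lemma eval2_comult_gen:
  assumes F: "F \<in> pseries" and G: "G \<in> pseries" and l: "l \<in> Lam"
  shows "eval2 (comult_gen l) F G = a_coef l (G \<circledast> F)"
proof -
  have "eval2 (comult_gen l) F G = (\<Sum>y | y \<in> Obj Q2 \<and> dmon y = l.
      of_nat (mono_fact l) / of_nat (card (star Q2 y)) * eval_amono (amon (subs y)) F * eval_amono (Poly_Mapping.single (tmon y) 1) G)"
    by (simp add: comult_gen_eq eval2_sum eval2_single)
  also have "\<dots> = (\<Sum>x\<in>graft_pairs l. of_nat (mono_fact l) / of_nat (card (star Q2 (tree_of x))) *
      eval_amono (amon (subs (tree_of x))) F * eval_amono (Poly_Mapping.single (tmon (tree_of x)) 1) G)"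
    by (rule sum.reindex_bij_betw[OF fib_Q2[OF l], symmetric])
  also have "\<dots> = (\<Sum>x\<in>graft_pairs l. of_nat (mono_fact l) * (branch_weight G (fst x) * (\<Prod>gs\<leftarrow>snd x. branch_weight F gs)))"
  proof (rule sum.cong)
    fix x assume x: "x \<in> graft_pairs l"
    obtain q gss where qg: "x = (q, gss)" by (cases x)
    have "tree_of x \<in> Obj Q2" using bij_betwE[OF fib_Q2[OF l]] x by blast
    then have "card (star Q2 (tree_of x)) = fact (length q) * (\<Prod>gs\<leftarrow>gss. fact (length gs))"
      unfolding qg tree_of_def fst_conv snd_conv by (subst card_star_Lev) (simp_all add: comp_def)
    moreover have "eval_amono (amon (subs (tree_of x))) F = (\<Prod>gs\<leftarrow>gss. a_coef (cont length gs) F)"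
      by (simp add: qg tree_of_def amon_def eval_amono_cont cont_map comp_def tmon_def)
    moreover have "eval_amono (Poly_Mapping.single (tmon (tree_of x)) 1) G = a_coef (cont length q) G"
      using eval_amono_cont[of tmon "[tree_of x]" G] by (simp add: qg tree_of_def tmon_def)
    moreover have "(\<Prod>gs\<leftarrow>gss. branch_weight F gs) =
        (\<Prod>gs\<leftarrow>gss. a_coef (cont length gs) F) / of_nat (\<Prod>gs\<leftarrow>gss. fact (length gs))"
      by (induction gss) (simp_all add: branch_weight_def)
    ultimately show "of_nat (mono_fact l) / of_nat (card (star Q2 (tree_of x))) *
      eval_amono (amon (subs (tree_of x))) F * eval_amono (Poly_Mapping.single (tmon (tree_of x)) 1) G =
      of_nat (mono_fact l) * (branch_weight G (fst x) * (\<Prod>gs\<leftarrow>snd x. branch_weight F gs))"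
      by (simp add: qg branch_weight_def)
  qed simp
  also have "\<dots> = a_coef l (G \<circledast> F)"
    by (simp add: a_coef_def coef_plethysm[OF F G] sum_distrib_left)
  finally show ?thesis .
qed

text \<open>Dedekind's argument: subtracting \<open>chi j y\<close> times the relation at \<open>x\<close> from the relation at \<open>times y x\<close>
  removes the term of \<open>j\<close>.\<close>

lemma characters_independent:
  fixes chi :: "'i \<Rightarrow> 'm \<Rightarrow> rat" and times :: "'m \<Rightarrow> 'm \<Rightarrow> 'm"
  assumes "finite S" and mult: "\<And>i x y. chi i (times x y) = chi i x * chi i y" and unit: "\<And>i. chi i one = 1"
    and "\<And>i j. i \<in> S \<Longrightarrow> j \<in> S \<Longrightarrow> i \<noteq> j \<Longrightarrow> \<exists>x. chi i x \<noteq> chi j x"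
    and "\<And>x. (\<Sum>i\<in>S. c i * chi i x) = 0" and "i \<in> S"
  shows "c i = 0"
  using assms(1,4-)
proof (induction S arbitrary: c i rule: finite_induct)
  case (insert j T)
  have T: "c k = 0" if k: "k \<in> T" for k
  proof -
    obtain y where y: "chi k y \<noteq> chi j y" using insert.prems(1)[of k j] insert.hyps k by auto
    have "c k * (chi k y - chi j y) = 0"
    proof (rule insert.IH[where c = "\<lambda>k. c k * (chi k y - chi j y)"])
      fix x
      have "(\<Sum>i\<in>T. c i * (chi i y - chi j y) * chi i x) = (\<Sum>i\<in>insert j T. c i * (chi i y - chi j y) * chi i x)"
        using insert.hyps by simp
      also have "\<dots> = (\<Sum>i\<in>insert j T. c i * chi i (times y x)) - chi j y * (\<Sum>i\<in>insert j T. c i * chi i x)"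
        unfolding sum_distrib_left sum_subtractf[symmetric] by (rule sum.cong) (simp_all add: mult algebra_simps)
      finally show "(\<Sum>i\<in>T. c i * (chi i y - chi j y) * chi i x) = 0"
        by (simp only: insert.prems(2))
    qed (use insert.prems(1) k in auto)
    then show ?thesis using y by simp
  qed
  moreover have "c j = 0"
    using insert.prems(2)[of one] insert.hyps T by (simp add: unit)
  ultimately show ?case using insert.prems(3) by auto
qed simp

section \<open>Uniqueness of the coproduct on generators\<close>

definition gen_series :: "(mono \<Rightarrow> rat) \<Rightarrow> mps"
  where "gen_series p = Mps (\<lambda>l. if l \<in> Lam then p l / of_nat (mono_fact l) else 0)"

lemma gen_series_pseries: "gen_series p \<in> pseries"
  by (simp add: gen_series_def pseries_def)

definition monomial :: "amono \<Rightarrow> (mono \<Rightarrow> rat) \<Rightarrow> rat"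
  where "monomial m p = (\<Prod>l\<in>Poly_Mapping.keys m. p l ^ Poly_Mapping.lookup m l)"

text \<open>The division by \<open>mono_fact l\<close> in \<open>gen_series\<close> lets the
  \<open>a_coef\<close> take arbitrary prescribed values.\<close>

lemma eval_gen_series: "m \<in> amonos \<Longrightarrow> eval_amono m (gen_series p) = monomial m p"
  unfolding eval_amono_def monomial_def
  by (rule prod.cong) (auto simp: amonos_def a_coef_def gen_series_def mono_fact_nonzero)

text \<open>Powers of 2 are distinct, so this point reads off the exponent of
  \<open>l\<close>.\<close>

lemma monomial_point: "monomial m (\<lambda>k. if k = l then 2 else 1) = 2 ^ Poly_Mapping.lookup m l"
proof -
  have "monomial m (\<lambda>k. if k = l then 2 else 1) =
      (\<Prod>k\<in>Poly_Mapping.keys m. if k = l then 2 ^ Poly_Mapping.lookup m l else 1)"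
    unfolding monomial_def by (rule prod.cong) auto
  then show ?thesis by (simp add: prod.delta in_keys_iff)
qed

lemma monomial_one [simp]: "monomial m (\<lambda>_. 1) = 1"
  by (simp add: monomial_def)

lemma monomial_separate:
  assumes "m \<noteq> n"
  shows "\<exists>p. monomial m p \<noteq> monomial n p"
proof -
  obtain l where "Poly_Mapping.lookup m l \<noteq> Poly_Mapping.lookup n l"
    using assms by (auto simp: poly_mapping_eq_iff fun_eq_iff)
  then have "monomial m (\<lambda>k. if k = l then 2 else 1) \<noteq> monomial n (\<lambda>k. if k = l then 2 else 1)"
    by (simp add: monomial_point)
  then show ?thesis by blast
qed

text \<open>Pairs of points form a monoid under pointwise multiplication, and pairs of monomials are
  distinct characters of it; hence the differences of the coefficients vanish.\<close>

lemma eval2_inject: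
  assumes keys: "Poly_Mapping.keys w \<subseteq> amonos \<times> amonos" "Poly_Mapping.keys w' \<subseteq> amonos \<times> amonos"
    and eq: "\<And>F G. F \<in> pseries \<Longrightarrow> G \<in> pseries \<Longrightarrow> eval2 w F G = eval2 w' F G"
  shows "w = w'"
proof -
  let ?S = "Poly_Mapping.keys w \<union> Poly_Mapping.keys w'"
  define chi where "chi p x = monomial (fst p) (fst x) * monomial (snd p) (snd x)"
    for p :: "amono \<times> amono" and x :: "(mono \<Rightarrow> rat) \<times> (mono \<Rightarrow> rat)"
  define c where "c p = Poly_Mapping.lookup w p - Poly_Mapping.lookup w' p" for p
  have c: "c p = 0" if "p \<in> ?S" for p
  proof (rule characters_independent[of ?S chi "\<lambda>x y. (\<lambda>l. fst x l * fst y l, \<lambda>l. snd x l * snd y l)" "(\<lambda>_. 1, \<lambda>_. 1)"])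
    show "chi p (\<lambda>l. fst x l * fst y l, \<lambda>l. snd x l * snd y l) = chi p x * chi p y" for p x y
      by (simp add: chi_def monomial_def power_mult_distrib prod.distrib)
    \<comment> \<open>All monomials are 1 at the constant point 1, so separating one component is
      enough.\<close>
    show "\<exists>x. chi p x \<noteq> chi p' x" if "p \<noteq> p'" for p p'
    proof (cases "fst p = fst p'")
      case True
      then have "snd p \<noteq> snd p'" using that by (simp add: prod_eq_iff)
      then obtain q where "monomial (snd p) q \<noteq> monomial (snd p') q" using monomial_separate by blast
      then show ?thesis by (intro exI[of _ "(\<lambda>_. 1, q)"]) (simp add: chi_def)
    next
      case False
      then obtain q where "monomial (fst p) q \<noteq> monomial (fst p') q" using monomial_separate by blast
      then show ?thesis by (intro exI[of _ "(q, \<lambda>_. 1)"]) (simp add: chi_def)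
    qed
    show "(\<Sum>p\<in>?S. c p * chi p x) = 0" for x
    proof -
      let ?F = "gen_series (fst x)" and ?G = "gen_series (snd x)"
      have "(\<Sum>p\<in>?S. c p * chi p x) = (\<Sum>p\<in>?S. c p * eval_amono (fst p) ?F * eval_amono (snd p) ?G)"
        by (rule sum.cong) (use keys in \<open>auto simp: chi_def eval_gen_series\<close>)
      also have "\<dots> = eval2 w ?F ?G - eval2 w' ?F ?G"
        by (simp add: eval2_superset[of ?S] c_def left_diff_distrib sum_subtractf)
      finally show ?thesis by (simp add: eq gen_series_pseries)
    qed
  qed (use that in \<open>simp_all add: chi_def\<close>)
  have "Poly_Mapping.lookup w p = Poly_Mapping.lookup w' p" for p
    using c[of p] by (cases "p \<in> ?S") (auto simp: c_def in_keys_iff)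
  then show ?thesis by (simp add: poly_mapping_eq_iff fun_eq_iff)
qed

lemma keys_comult_gen: "Poly_Mapping.keys (comult_gen l) \<subseteq> amonos \<times> amonos"
proof -
  have "(amon (subs y), Poly_Mapping.single (tmon y) 1) \<in> amonos \<times> amonos" if "y \<in> Obj Q2" for y
  proof -
    have "subs y \<in> Obj (S_grpd Q1)" using that by (auto simp: Obj_Q2)
    then have "amon (subs y) \<in> amonos" using amon_amonos by blast
    moreover have "amon [Opn (root_op y)] \<in> amonos"
      using that by (intro amon_amonos[THEN conjunct1]) (auto simp: Obj_Q2 Obj_Q1)
    ultimately show ?thesis by (simp add: amon_def tmon_def)
  qed
  then show ?thesis
    unfolding comult_gen_eq by (intro subset_trans[OF keys_sum]) (auto split: if_splits)
qed

text \<open>The definite description needs existence, which is the expansion of plethysm over trees,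
  and uniqueness, which is the independence of characters.\<close>

lemma P_comult_gen_eq:
  assumes "l \<in> Lam"
  shows "P_comult_gen l = comult_gen l"
  unfolding P_comult_gen_def
  by (rule the_equality)
    (use keys_comult_gen eval2_comult_gen[OF _ _ assms] eval2_inject in \<open>auto intro!: eval2_inject\<close>)

section \<open>The isomorphism\<close>

lemma lin_ext_cong: "(\<And>a. a \<in> Poly_Mapping.keys v \<Longrightarrow> f a = g a) \<Longrightarrow> lin_ext f v = lin_ext g v"
  by (simp add: lin_ext_def)

lemma lin_ext_lin_ext: "lin_ext f (lin_ext g v) = lin_ext (\<lambda>a. lin_ext f (g a)) v"
  by (simp add: lin_ext_def[of g] lin_ext_def[of "\<lambda>a. lin_ext f (g a)"] lin_ext_sum lin_ext_bscale)

lemma lin_ext_delta_arg [simp]: "lin_ext f (delta a) = f a"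
  by (simp add: delta_def)

lemma bscale_delta: "bscale c (delta a) = Poly_Mapping.single a c"
  by (simp add: poly_mapping_eq_iff fun_eq_iff delta_def lookup_single when_def)

lemma bscale_single: "bscale c (Poly_Mapping.single a d) = Poly_Mapping.single a (c * d)"
  by (simp add: poly_mapping_eq_iff fun_eq_iff lookup_single when_def)

lemma sum_single_lookup:
  "(\<Sum>a\<in>Poly_Mapping.keys v. Poly_Mapping.single a (Poly_Mapping.lookup v a)) = (v :: 'a \<Rightarrow>\<^sub>0 rat)"
  by (rule poly_mapping_eqI) (auto simp: lookup_sum lookup_single when_def in_keys_iff)

lemma lin_ext_delta: "lin_ext delta v = v"
  unfolding lin_ext_def bscale_delta by (rule sum_single_lookup)

text \<open>The convolution product in the form in which juxtaposition is defined on the other side,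
  as a bilinear extension from basis elements.\<close>

lemma times_eq_lin_ext:
  fixes u v :: "'a :: comm_monoid_add \<Rightarrow>\<^sub>0 rat"
  shows "u * v = lin_ext (\<lambda>a. lin_ext (\<lambda>b. delta (a + b)) v) u"
proof -
  have "u * v = (\<Sum>a\<in>Poly_Mapping.keys u. Poly_Mapping.single a (Poly_Mapping.lookup u a)) *
      (\<Sum>b\<in>Poly_Mapping.keys v. Poly_Mapping.single b (Poly_Mapping.lookup v b))"
    by (simp only: sum_single_lookup)
  also have "\<dots> = lin_ext (\<lambda>a. lin_ext (\<lambda>b. delta (a + b)) v) u"
    by (simp add: lin_ext_def sum_product mult_single bscale_sum bscale_delta bscale_single)
  finally show ?thesis .
qed

lemma keys_lin_ext_delta: "Poly_Mapping.keys (lin_ext (\<lambda>a. delta (g a)) v) \<subseteq> g ` Poly_Mapping.keys v"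
  unfolding lin_ext_def bscale_delta by (rule subset_trans[OF keys_sum]) (auto split: if_splits)

lemma bij_betw_lin_ext_delta:
  assumes "bij_betw g A B"
  shows "bij_betw (lin_ext (\<lambda>a. delta (g a))) {v. Poly_Mapping.keys v \<subseteq> A} {v. Poly_Mapping.keys v \<subseteq> B}"
proof (rule bij_betw_byWitness[where f' = "lin_ext (\<lambda>b. delta (inv_into A g b))"])
  have g: "inv_into A g (g a) = a" if "a \<in> A" for a
    using assms that by (simp add: bij_betw_def inv_into_f_f)
  have g': "g (inv_into A g b) = b" "inv_into A g b \<in> A" if "b \<in> B" for b
    using assms that by (simp_all add: bij_betw_def f_inv_into_f inv_into_into)
  show "\<forall>v\<in>{v. Poly_Mapping.keys v \<subseteq> A}. lin_ext (\<lambda>b. delta (inv_into A g b)) (lin_ext (\<lambda>a. delta (g a)) v) = v"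
  proof
    fix v :: "'a \<Rightarrow>\<^sub>0 rat" assume "v \<in> {v. Poly_Mapping.keys v \<subseteq> A}"
    then have "lin_ext (\<lambda>a. delta (inv_into A g (g a))) v = lin_ext delta v"
      by (intro lin_ext_cong) (auto simp: g)
    then show "lin_ext (\<lambda>b. delta (inv_into A g b)) (lin_ext (\<lambda>a. delta (g a)) v) = v"
      by (simp add: lin_ext_lin_ext lin_ext_delta)
  qed
  show "\<forall>v\<in>{v. Poly_Mapping.keys v \<subseteq> B}. lin_ext (\<lambda>a. delta (g a)) (lin_ext (\<lambda>b. delta (inv_into A g b)) v) = v"
  proof
    fix v :: "'b \<Rightarrow>\<^sub>0 rat" assume "v \<in> {v. Poly_Mapping.keys v \<subseteq> B}"
    then have "lin_ext (\<lambda>b. delta (g (inv_into A g b))) v = lin_ext delta v"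
      by (intro lin_ext_cong) (auto simp: g')
    then show "lin_ext (\<lambda>a. delta (g a)) (lin_ext (\<lambda>b. delta (inv_into A g b)) v) = v"
      by (simp add: lin_ext_lin_ext lin_ext_delta)
  qed
  show "lin_ext (\<lambda>a. delta (g a)) ` {v. Poly_Mapping.keys v \<subseteq> A} \<subseteq> {v. Poly_Mapping.keys v \<subseteq> B}"
    using keys_lin_ext_delta[of g] bij_betwE[OF assms] by blast
  show "lin_ext (\<lambda>b. delta (inv_into A g b)) ` {v. Poly_Mapping.keys v \<subseteq> B} \<subseteq> {v. Poly_Mapping.keys v \<subseteq> A}"
    using keys_lin_ext_delta[of "inv_into A g"] g'(2) by blast
qed

lemma tensor_map_lin_ext_delta:
  "tensor_map (lin_ext (\<lambda>a. delta (g a))) = lin_ext (\<lambda>(a, b). delta (g a, g b))"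
  by (simp add: tensor_map_def tensor_def case_prod_unfold)

section \<open>The counit\<close>

abbreviation "unit_lam \<equiv> Poly_Mapping.single (1 :: nat) (1 :: nat)"

lemma Obj_Q0: "Obj Q0 = {Col ()}"
  by (simp add: Q0_eq discrete_def)

lemma Obj_SQ0: "Obj (S_grpd Q0) = {replicate n (Col ()) | n. n \<noteq> 0}"
proof (intro set_eqI iffI)
  fix x assume "x \<in> Obj (S_grpd Q0)"
  then have "x \<noteq> []" "set x \<subseteq> {Col ()}" by (auto simp: Obj_Q0)
  then have "x = replicate (length x) (Col ())" "length x \<noteq> 0"
    by (auto simp: subset_singleton_iff intro!: replicate_eqI)
  then show "x \<in> {replicate n (Col ()) | n. n \<noteq> 0}" by blast
qed (auto simp: Obj_Q0)

lemma star_Q0: "star Q0 (Col ()) = {MCol ()}"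
  unfolding Q0_eq by (subst star_relabel) (simp_all add: star_discrete)

lemma fin_star_Q0: "finite (star Q0 t)"
  by (cases "t \<in> Obj Q0") (simp_all add: Obj_Q0 star_Q0 star_empty[OF grpd_Q0])

lemma degen_AssS:
  "tree_degen AssS 0 0 = \<lparr>fo = (\<lambda>_. Opn [[()]]), fm = (\<lambda>_. MOpn [(0, [()])])\<rparr>"
  by (simp add: tree_unit_def graft_f_def gf_comp_def gf_pair_def s_unit_AssS comp_def)

lemma gfunctor_degen: "gfunctor (tree_degen AssS 0 0) Q0 Q1"
proof (rule gfunctorI)
  let ?e = "[(0, [()])] :: unit list smor"
  have e: "?e \<in> Arr (S_grpd Posn)" by (rule S_ArrI) auto
  have De: "Dom (S_grpd Posn) ?e = [[()]]" by (rule S_Dom_eqI[OF e]) auto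
  show "fo (tree_degen AssS 0 0) x \<in> Obj Q1" for x by (simp add: degen_AssS Obj_Q1 del: tree_degen.simps)
  show "fm (tree_degen AssS 0 0) f \<in> Arr Q1" for f using e by (simp add: degen_AssS Q1_eq del: tree_degen.simps)
  show "Dom Q1 (fm (tree_degen AssS 0 0) f) = fo (tree_degen AssS 0 0) (Dom Q0 f)" for f
    using De by (simp add: degen_AssS Q1_eq del: tree_degen.simps)
  show "Cod Q1 (fm (tree_degen AssS 0 0) f) = fo (tree_degen AssS 0 0) (Cod Q0 f)" for f
    by (simp add: degen_AssS Q1_eq del: tree_degen.simps)
  show "fm (tree_degen AssS 0 0) (Cmp Q0 g f) = Cmp Q1 (fm (tree_degen AssS 0 0) g) (fm (tree_degen AssS 0 0) f)" for f g
    by (simp add: degen_AssS Q1_eq S_grpd_def del: tree_degen.simps)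
qed

text \<open>The degeneracy sends n colours to n copies of the unit operation. So the fibre is
  nonempty only over powers of the generator at \<open>unit_lam\<close>, where the n! automorphisms
  cancel the n! arrows leaving the tuple of colours.\<close>

lemma inc_counit_cls:
  assumes m: "m \<in> amonos" "m \<noteq> 0"
  shows "inc_counit bar_Ass (Some (cls m)) = (if Poly_Mapping.keys m \<subseteq> {unit_lam} then 1 else 0)"
proof -
  let ?F = "S_map (tree_degen AssS 0 0)"
  have c: "cls m \<in> pi0 (S_grpd Q1)" using m by (auto simp: pi0_SQ1)
  have F: "gfunctor ?F (S_grpd Q0) (S_grpd Q1)" by (rule gfunctor_S_map[OF gfunctor_degen])
  have fo: "fo ?F (replicate n (Col ())) = replicate n (Opn [[()]])" for n
    by (simp add: degen_AssS del: tree_degen.simps)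
  have amon: "amon (replicate n (Opn [[()]])) = Poly_Mapping.single unit_lam n" for n
    by (induction n) (simp_all add: amon_def tmon_def single_add[symmetric])
  have iso: "(fo ?F (replicate n (Col ())), rep (cls m)) \<in> isorel (S_grpd Q1) \<longleftrightarrow> Poly_Mapping.single unit_lam n = m"
    if "n \<noteq> 0" for n
    unfolding isorel_rep[OF grpd_SQ1 c] fo using that by (auto simp: cls_def amon Obj_Q1)
  have set: "{x. x \<in> Obj (S_grpd Q0) \<and> (fo ?F x, rep (cls m)) \<in> isorel (S_grpd Q1)} =
      {replicate n (Col ()) | n. n \<noteq> 0 \<and> Poly_Mapping.single unit_lam n = m}"
    unfolding Obj_SQ0 using iso by blast
  \<comment> \<open>The exponent determines the number of colours.\<close>
  have le1: "{replicate n (Col ()) | n. n \<noteq> 0 \<and> Poly_Mapping.single unit_lam n = m} \<subseteq>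
      {replicate (Poly_Mapping.lookup m unit_lam) (Col () :: atree)}"
    by auto
  have "inc_counit bar_Ass (Some (cls m)) = hcard (hofib ?F (S_grpd Q0) (S_grpd Q1) (rep (cls m)))"
    by (simp add: bar_Ass_level[unfolded One_nat_def] bar_Ass_def bar_def AssS_def Q0_def Q1_def)
  also have "\<dots> = of_nat (card (aut (S_grpd Q1) (rep (cls m)))) *
      (\<Sum>x | x \<in> Obj (S_grpd Q0) \<and> (fo ?F x, rep (cls m)) \<in> isorel (S_grpd Q1). 1 / of_nat (card (star (S_grpd Q0) x)))"
  proof (rule hcard_hofib[OF grpd_S[OF grpd_Q0] grpd_SQ1 F finite_star_S[OF fin_star_Q0] fin_star_SQ1])
    show "finite {x \<in> Obj (S_grpd Q0). (fo ?F x, rep (cls m)) \<in> isorel (S_grpd Q1)}"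
      unfolding set by (rule finite_subset[OF le1]) simp
    show "rep (cls m) \<in> Obj (S_grpd Q1)"
      using rep_in[OF grpd_SQ1 c] pi0_subset[OF grpd_SQ1 c] by blast
  qed
  also have "\<dots> = (if Poly_Mapping.keys m \<subseteq> {unit_lam} then 1 else 0)"
  proof (cases "Poly_Mapping.keys m \<subseteq> {unit_lam}")
    case True
    define n where "n = Poly_Mapping.lookup m unit_lam"
    have mn: "m = Poly_Mapping.single unit_lam n"
    proof (rule poly_mapping_eqI)
      fix l
      show "Poly_Mapping.lookup m l = Poly_Mapping.lookup (Poly_Mapping.single unit_lam n) l"
      proof (cases "l = unit_lam")
        case False
        then have "l \<notin> Poly_Mapping.keys m" using True by blast
        with False show ?thesis by (simp add: in_keys_iff lookup_single_not_eq)
      qed (simp add: n_def)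
    qed
    then have n: "n \<noteq> 0" using m(2) by (metis single_zero)
    have one: "{replicate k (Col ()) | k. k \<noteq> 0 \<and> Poly_Mapping.single unit_lam k = m} = {replicate n (Col () :: atree)}"
    proof (rule subset_antisym)
      show "{replicate k (Col ()) | k. k \<noteq> 0 \<and> Poly_Mapping.single unit_lam k = m} \<subseteq> {replicate n (Col () :: atree)}"
        using le1 by (simp only: n_def)
      have "n \<noteq> 0 \<and> Poly_Mapping.single unit_lam n = m" using n mn by simp
      then show "{replicate n (Col () :: atree)} \<subseteq> {replicate k (Col ()) | k. k \<noteq> 0 \<and> Poly_Mapping.single unit_lam k = m}"
        by auto
    qed
    have "card (star (S_grpd Q0) (replicate n (Col ()))) = fact n"
      using n by (subst card_star_S[OF fin_star_Q0]) (simp_all add: star_Q0 map_replicate_const)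
    moreover have "of_nat (card (aut (S_grpd Q1) (rep (cls m)))) = (fact n :: rat)"
      unfolding card_aut_cls[OF m] using n by (simp add: mn mono_fact_def)
    ultimately show ?thesis using True unfolding set one by simp
  next
    case False
    have none: "{replicate k (Col ()) | k. k \<noteq> 0 \<and> Poly_Mapping.single unit_lam k = m} = ({} :: atree list set)"
      using False by auto
    show ?thesis using False unfolding set none by simp
  qed
  finally show ?thesis .
qed

text \<open>The series \<open>x_1\<close> has only one nonzero coefficient, 1 at
  \<open>unit_lam\<close>, and the factorial there is 1.\<close>

lemma eval_amono_var: "eval_amono m (mps_var 1) = (if Poly_Mapping.keys m \<subseteq> {unit_lam} then 1 else 0)"
proof -
  have a: "a_coef l (mps_var 1) = (if l = unit_lam then 1 else 0)" for l
    by (simp add: a_coef_def coef_var mono_fact_def)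
  show ?thesis
  proof (cases "Poly_Mapping.keys m \<subseteq> {unit_lam}")
    case True
    then show ?thesis by (auto simp: eval_amono_def a[unfolded One_nat_def] intro!: prod.neutral)
  next
    case False
    then obtain l where "l \<in> Poly_Mapping.keys m" "l \<noteq> unit_lam" by blast
    then have "a_coef l (mps_var 1) ^ Poly_Mapping.lookup m l = 0" by (simp only: a) (simp add: in_keys_iff)
    then have "eval_amono m (mps_var 1) = 0"
      unfolding eval_amono_def using \<open>l \<in> Poly_Mapping.keys m\<close> by (intro prod_zero) auto
    then show ?thesis using False by simp
  qed
qed

lemma inc_counit_hb: "m \<in> amonos \<Longrightarrow> inc_counit bar_Ass (hb m) = eval_amono m (mps_var 1)"
  by (cases "m = 0")
    (simp_all add: hb_def inc_counit_cls eval_amono_var[unfolded One_nat_def] del: inc_counit.simps(2))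

lemma inc_comult_hb:
  assumes "m \<in> amonos"
  shows "inc_comult bar_Ass (hb m) = lin_ext (\<lambda>(a, b). delta (hb a, hb b))
    (\<Prod>l\<in>Poly_Mapping.keys m. P_comult_gen l ^ Poly_Mapping.lookup m l)"
proof -
  have "(\<Prod>l\<in>Poly_Mapping.keys m. P_comult_gen l ^ Poly_Mapping.lookup m l) = comult_mono m"
    unfolding comult_mono_def by (rule prod.cong) (use assms in \<open>auto simp: amonos_def P_comult_gen_eq\<close>)
  moreover have "inc_comult bar_Ass (hb m) = lin_ext (\<lambda>(a, b). delta (hb a, hb b)) (comult_mono m)"
  proof (cases "m = 0")
    case True
    have "comult_mono 0 = Poly_Mapping.single (0, 0) 1" by (simp add: comult_mono_def zero_prod_def[symmetric])
    then show ?thesis using True by (simp add: hb_def)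
  next
    case False
    then show ?thesis using inc_comult_cls[OF assms] by (simp add: hb_def)
  qed
  ultimately show ?thesis by simp
qed

lemma eval_counit_superset:
  assumes "finite S" "Poly_Mapping.keys v \<subseteq> S"
  shows "(\<Sum>a\<in>Poly_Mapping.keys v. Poly_Mapping.lookup v a * (e a :: rat)) = (\<Sum>a\<in>S. Poly_Mapping.lookup v a * e a)"
  by (rule sum.mono_neutral_left) (use assms in \<open>auto simp: in_keys_iff\<close>)

text \<open>Keys may merge or cancel under \<open>g\<close>, so the sum is first extended to the
  whole image of the keys of \<open>v\<close> and then regrouped.\<close>

lemma counit_lin_ext:
  fixes e :: "'b \<Rightarrow> rat"
  shows "(\<Sum>b\<in>Poly_Mapping.keys (lin_ext (\<lambda>a. delta (g a)) v). Poly_Mapping.lookup (lin_ext (\<lambda>a. delta (g a)) v) b * e b) =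
    (\<Sum>a\<in>Poly_Mapping.keys v. Poly_Mapping.lookup v a * e (g a))"
proof -
  let ?w = "lin_ext (\<lambda>a. delta (g a)) v" and ?K = "Poly_Mapping.keys v"
  have w: "Poly_Mapping.lookup ?w b = (\<Sum>a\<in>?K. Poly_Mapping.lookup v a * (if g a = b then 1 else 0))" for b
    by (auto simp: lin_ext_def bscale_delta lookup_sum lookup_single when_def intro!: sum.cong)
  have "(\<Sum>b\<in>Poly_Mapping.keys ?w. Poly_Mapping.lookup ?w b * e b) = (\<Sum>b\<in>g ` ?K. Poly_Mapping.lookup ?w b * e b)"
    by (rule eval_counit_superset) (simp_all add: keys_lin_ext_delta)
  also have "\<dots> = (\<Sum>b\<in>g ` ?K. \<Sum>a\<in>?K. Poly_Mapping.lookup v a * (if g a = b then e b else 0))"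
    by (auto simp: w sum_distrib_right intro!: sum.cong)
  also have "\<dots> = (\<Sum>a\<in>?K. \<Sum>b\<in>g ` ?K. Poly_Mapping.lookup v a * (if g a = b then e b else 0))"
    by (rule sum.swap)
  also have "\<dots> = (\<Sum>a\<in>?K. Poly_Mapping.lookup v a * e (g a))"
    by (rule sum.cong) (simp_all add: sum_distrib_left[symmetric])
  finally show ?thesis .
qed

theorem theorem5p12:
  "isomorphic_bialg P_exp (incidence_bialg (bar (T_S_M Ass)))"
  unfolding bar_Ass_def[symmetric] isomorphic_bialg_def
proof
  let ?h = "lin_ext (\<lambda>m. delta (hb m))"
  let ?B = "incidence_bialg bar_Ass"
  have keys: "Poly_Mapping.keys v \<subseteq> amonos" if "v \<in> bcarrier P_exp" for v
    using that by (simp add: bcarrier_def P_exp_def)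
  have level: "level bar_Ass (Suc 0) = S_grpd Q1" using bar_Ass_level(2) by simp
  have bij: "bij_betw hb amonos (bbasis ?B)"
    using inj_on_hb hb_image by (simp add: bij_betw_def incidence_bialg_def level)
  show "bialg_iso P_exp ?B ?h"
    unfolding bialg_iso_def
  proof (intro conjI ballI allI)
    show "bij_betw ?h (bcarrier P_exp) (bcarrier ?B)"
      using bij_betw_lin_ext_delta[OF bij] by (simp add: bcarrier_def P_exp_def)
    show "?h (u + v) = ?h u + ?h v" for u v by (rule lin_ext_add)
    show "?h (bscale c v) = bscale c (?h v)" for c v by (rule lin_ext_bscale)
    show "?h (bone P_exp) = bone ?B"
      by (simp add: P_exp_def incidence_bialg_def hb_def flip: single_one)
    fix v assume v: "v \<in> bcarrier P_exp"
    \<comment> \<open>Both sides extend linearly from monomials, where \<open>inc_comult_hb\<close>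
      compares them.\<close>
    show "bcomult ?B (?h v) = tensor_map ?h (bcomult P_exp v)"
      unfolding tensor_map_lin_ext_delta
      by (simp add: P_exp_def incidence_bialg_def lin_ext_lin_ext)
        (use keys[OF v] in \<open>auto intro!: lin_ext_cong simp: inc_comult_hb\<close>)
    show "bcounit ?B (?h v) = bcounit P_exp v"
      using keys[OF v] by (auto simp: P_exp_def incidence_bialg_def counit_lin_ext eval1_def inc_counit_hb
        simp flip: One_nat_def intro!: sum.cong)
    fix u assume u: "u \<in> bcarrier P_exp"
    have "?h (u * v) = lin_ext (\<lambda>a. lin_ext (\<lambda>b. delta (hb (a + b))) v) u"
      by (simp add: times_eq_lin_ext lin_ext_lin_ext)
    also have "\<dots> = lin_ext (\<lambda>a. lin_ext (\<lambda>b. delta (juxt (S_grpd Q1) (hb a) (hb b))) v) u"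
      using keys[OF u] keys[OF v] by (intro lin_ext_cong) (auto simp: juxt_hb subset_iff)
    finally show "?h (bmult P_exp u v) = bmult ?B (?h u) (?h v)"
      by (simp add: P_exp_def incidence_bialg_def level lin_ext_lin_ext)
  qed
qed

end
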